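(* Consider the nonparametric regression model $Y_n=f(X_n)+\varepsilon_n$, $n\ge 1$, where $(X_n)$ are i.i.d. real random variables with positive probability density function $g$. Assume the following: (1) the kernel $K:\mathbb{R}\to\mathbb{R}$ is a positive symmetric bounded function, differentiable with bounded derivative, satisfying $\int_{\mathbb{R}} K(x)\,dx=1$, $\int_{\mathbb{R}} K'(x)\,dx=0$, $\int_{\mathbb{R}} xK'(x)\,dx=-1$, $\int_{\mathbb{R}} x^2K'(x)\,dx=0$, $\int_{\mathbb{R}} x^4K(x)\,dx<\infty$ and $\int_{\mathbb{R}} x^4|K'(x)|\,dx<\infty$; (2) $f$ and $g$ are bounded continuous, twice differentiable with bounded derivatives; (3) the sequences $(\varepsilon_n)$ and $(X_n)$ are independent, and $(\varepsilon_n)$ is a sequence of independent, identically distributed, square integrable random variables with $\mathbb{E}[\varepsilon_n]=0$ and $\mathbb{E}[\varepsilon_n^2]=\sigma^2$; (4) $(\varepsilon_n)$ has a finite moment of some order $p>2$, i.e. $\mathbb{E}[|\varepsilon_n|^p]<\infty$. Let $h_n=n^{-\alpha}$ with $1/5<\alpha<1/3$, and let $\xi^2=\int_{\mathbb{R}}(K'(x))^2\,dx$. Then, for any $x\in\mathbb{R}$ such that $g(x)>0$, the following convergences in distribution hold as $n\to\infty$: $$\sqrt{nh_n^3}\,\big(\widehat f_n^{\,\prime}(x)-f'(x)\big)\xrightarrow{\ \mathcal{D}\ }\mathcal{N}\Big(0,\frac{\xi^2}{(1+3\alpha)g(x)}\,\sigma^2\Big),$$ $$\sqrt{nh_n^3}\,\big(\widetilde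 f_n^{\,\prime}(x)-f'(x)\big)\xrightarrow{\ \mathcal{D}\ }\mathcal{N}\Big(0,\frac{\xi^2}{(1+3\alpha)g(x)}\,\big(f^2(x)+\sigma^2\big)\Big),$$ $$\sqrt{nh_n^3}\,\big(\check f_n^{\,\prime}(x)-f'(x)\big)\xrightarrow{\ \mathcal{D}\ }\mathcal{N}\Big(0,\frac{\xi^2}{(1+3\alpha)g(x)}\,\big(f^2(x)+\sigma^2\big)\Big),$$ where $\widehat f_n^{\,\prime}$, $\widetilde f_n^{\,\prime}$, $\check f_n^{\,\prime}$ are the three derivative estimators (built from $(X_k,Y_k)_{1\le k\le n}$, $K$ and $(h_k)$) defined in the context.
   Context: Given the observations $(X_k,Y_k)$, the kernel $K$ and the bandwidths $h_k>0$, define for $x\in\mathbb{R}$ $$\widehat h_n(x)=\frac1n\sum_{k=1}^n\frac{Y_k}{h_k}K\Big(\frac{x-X_k}{h_k}\Big),\qquad \widehat g_n(x)=\frac1n\sum_{k=1}^n\frac{1}{h_k}K\Big(\frac{x-X_k}{h_k}\Big).$$ (The function $\widehat h_n(x)$ is not to be confused with the bandwidth $h_n$.) Their derivatives in $x$ are $$\widehat h_n'(x)=\frac1n\sum_{k=1}^n\frac{Y_k}{h_k^2}K'\Big(\frac{x-X_k}{h_k}\Big),\qquad \widehat g_n^{\,\prime}(x)=\frac1n\sum_{k=1}^n\frac{1}{h_k^2}K'\Big(\frac{x-X_k}{h_k}\Big).$$ The three estimators of $f$ are: the recursive Nadaraya-Watson estimator $\widehat f_n(x)=\widehat h_n(x)/\widehat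 g_n(x)$; the estimator $\widetilde f_n(x)=\widehat h_n(x)/g(x)$; and $\check f_n(x)=\frac1n\sum_{k=1}^n\frac{Y_k}{g(X_k)h_k}K\big(\frac{x-X_k}{h_k}\big)$. Their derivatives are given, for $x$ with $g(x)>0$ (denominators being positive), by $$\widehat f_n^{\,\prime}(x)=\frac{\widehat h_n'(x)}{\widehat g_n(x)}-\frac{\widehat h_n(x)\,\widehat g_n^{\,\prime}(x)}{\widehat g_n(x)^2},\qquad \widetilde f_n^{\,\prime}(x)=\frac{\widehat h_n'(x)}{g(x)}-\frac{\widehat h_n(x)\,g'(x)}{g(x)^2},$$ $$\check f_n^{\,\prime}(x)=\frac1n\sum_{k=1}^n\frac{Y_k}{g(X_k)h_k^2}K'\Big(\frac{x-X_k}{h_k}\Big).$$ $\mathcal{N}(0,v)$ denotes the centered normal distribution with variance $v$ (the Dirac mass at $0$ if $v=0$). *)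

theory Defs
  imports "HOL-Probability.Probability"
begin

definition bounded_twice_differentiable :: "(real \<Rightarrow> real) \<Rightarrow> bool" where
  "bounded_twice_differentiable f \<longleftrightarrow>
     continuous_on UNIV f \<and> bounded (range f) \<and>
     (\<forall>x. f differentiable (at x)) \<and> bounded (range (deriv f)) \<and>
     (\<forall>x. deriv f differentiable (at x)) \<and> bounded (range (deriv (deriv f)))"

text \<open>
  The estimators are deterministic functions of the kernel \<open>K\<close>, the bandwidths \<open>h\<close>, the
  observations \<open>X 1, Y 1, \<dots>, X n, Y n\<close>, the sample size \<open>n\<close> and the point \<open>x\<close>; values of the
  sequences at index 0 are never used.
\<close>

definition h_hat ::
  "(real \<Rightarrow> real) \<Rightarrow> (nat \<Rightarrow> real) \<Rightarrow> (nat \<Rightarrow> real) \<Rightarrow> (nat \<Rightarrow> real) \<Rightarrow> nat \<Rightarrow> real \<Rightarrow> real" where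
  "h_hat K h X Y n x = 1 / real n * (\<Sum>k=1..n. Y k / h k * K ((x - X k) / h k))"

definition g_hat ::
  "(real \<Rightarrow> real) \<Rightarrow> (nat \<Rightarrow> real) \<Rightarrow> (nat \<Rightarrow> real) \<Rightarrow> nat \<Rightarrow> real \<Rightarrow> real" where
  "g_hat K h X n x = 1 / real n * (\<Sum>k=1..n. 1 / h k * K ((x - X k) / h k))"

definition f_hat ::
  "(real \<Rightarrow> real) \<Rightarrow> (nat \<Rightarrow> real) \<Rightarrow> (nat \<Rightarrow> real) \<Rightarrow> (nat \<Rightarrow> real) \<Rightarrow> nat \<Rightarrow> real \<Rightarrow> real" where
  "f_hat K h X Y n x = h_hat K h X Y n x / g_hat K h X n x"

definition f_tilde ::
  "(real \<Rightarrow> real) \<Rightarrow> (real \<Rightarrow> real) \<Rightarrow> (nat \<Rightarrow> real) \<Rightarrow> (nat \<Rightarrow> real) \<Rightarrow> (nat \<Rightarrow> real) \<Rightarrow>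
    nat \<Rightarrow> real \<Rightarrow> real" where
  "f_tilde g K h X Y n x = h_hat K h X Y n x / g x"

definition f_check ::
  "(real \<Rightarrow> real) \<Rightarrow> (real \<Rightarrow> real) \<Rightarrow> (nat \<Rightarrow> real) \<Rightarrow> (nat \<Rightarrow> real) \<Rightarrow> (nat \<Rightarrow> real) \<Rightarrow>
    nat \<Rightarrow> real \<Rightarrow> real" where
  "f_check g K h X Y n x =
     1 / real n * (\<Sum>k=1..n. Y k / (g (X k) * h k) * K ((x - X k) / h k))"

definition h_hat' ::
  "(real \<Rightarrow> real) \<Rightarrow> (nat \<Rightarrow> real) \<Rightarrow> (nat \<Rightarrow> real) \<Rightarrow> (nat \<Rightarrow> real) \<Rightarrow> nat \<Rightarrow> real \<Rightarrow> real" where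
  "h_hat' K h X Y n x =
     1 / real n * (\<Sum>k=1..n. Y k / (h k)\<^sup>2 * deriv K ((x - X k) / h k))"

definition g_hat' ::
  "(real \<Rightarrow> real) \<Rightarrow> (nat \<Rightarrow> real) \<Rightarrow> (nat \<Rightarrow> real) \<Rightarrow> nat \<Rightarrow> real \<Rightarrow> real" where
  "g_hat' K h X n x = 1 / real n * (\<Sum>k=1..n. 1 / (h k)\<^sup>2 * deriv K ((x - X k) / h k))"

text \<open>
  The derivatives of the three estimators of the regression function, as explicit formulas. They
  are the true derivatives wherever the denominators do not vanish (lemmas below); where a
  denominator is zero the convention \<open>a / 0 = 0\<close> applies.
\<close>

definition f_hat' ::
  "(real \<Rightarrow> real) \<Rightarrow> (nat \<Rightarrow> real) \<Rightarrow> (nat \<Rightarrow> real) \<Rightarrow> (nat \<Rightarrow> real) \<Rightarrow> nat \<Rightarrow> real \<Rightarrow> real" where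
  "f_hat' K h X Y n x =
     h_hat' K h X Y n x / g_hat K h X n x
     - h_hat K h X Y n x * g_hat' K h X n x / (g_hat K h X n x)\<^sup>2"

definition f_tilde' ::
  "(real \<Rightarrow> real) \<Rightarrow> (real \<Rightarrow> real) \<Rightarrow> (nat \<Rightarrow> real) \<Rightarrow> (nat \<Rightarrow> real) \<Rightarrow> (nat \<Rightarrow> real) \<Rightarrow>
    nat \<Rightarrow> real \<Rightarrow> real" where
  "f_tilde' g K h X Y n x =
     h_hat' K h X Y n x / g x - h_hat K h X Y n x * deriv g x / (g x)\<^sup>2"

definition f_check' ::
  "(real \<Rightarrow> real) \<Rightarrow> (real \<Rightarrow> real) \<Rightarrow> (nat \<Rightarrow> real) \<Rightarrow> (nat \<Rightarrow> real) \<Rightarrow> (nat \<Rightarrow> real) \<Rightarrow>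
    nat \<Rightarrow> real \<Rightarrow> real" where
  "f_check' g K h X Y n x =
     1 / real n * (\<Sum>k=1..n. Y k / (g (X k) * (h k)\<^sup>2) * deriv K ((x - X k) / h k))"

lemma kernel_term_has_derivative:
  assumes "\<And>u. K differentiable (at u)"
  shows "((\<lambda>x. c * K ((x - a) / b)) has_real_derivative c / b * deriv K ((x - a) / b)) (at x)"
proof -
  have K: "(K has_real_derivative deriv K ((x - a) / b)) (at ((x - a) / b))"
    using assms DERIV_deriv_iff_real_differentiable by blast
  have "((\<lambda>x. (x - a) / b) has_real_derivative 1 / b) (at x)"
    by (intro DERIV_cdivide derivative_eq_intros) auto
  from DERIV_chain2[OF K this]
  have "((\<lambda>x. K ((x - a) / b)) has_real_derivative deriv K ((x - a) / b) * (1 / b)) (at x)" .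
  from DERIV_cmult[OF this, of c] show ?thesis by (simp add: mult.commute)
qed

lemma h_hat_has_derivative:
  assumes "\<And>u. K differentiable (at u)"
  shows "(h_hat K h X Y n has_real_derivative h_hat' K h X Y n x) (at x)"
proof -
  have "((\<lambda>x. 1 / real n * (\<Sum>k=1..n. Y k / h k * K ((x - X k) / h k))) has_real_derivative
     1 / real n * (\<Sum>k=1..n. Y k / h k / h k * deriv K ((x - X k) / h k))) (at x)"
    by (intro DERIV_cmult DERIV_sum kernel_term_has_derivative assms)
  then show ?thesis
    unfolding h_hat_def[abs_def] h_hat'_def by (simp add: power2_eq_square)
qed

lemma g_hat_has_derivative:
  assumes "\<And>u. K differentiable (at u)"
  shows "(g_hat K h X n has_real_derivative g_hat' K h X n x) (at x)"
  using h_hat_has_derivative[OF assms, of h X "\<lambda>_. 1"]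
  by (simp add: h_hat_def[abs_def] g_hat_def[abs_def] h_hat'_def g_hat'_def)

lemma f_hat_has_derivative:
  assumes "\<And>u. K differentiable (at u)" and "g_hat K h X n x \<noteq> 0"
  shows "(f_hat K h X Y n has_real_derivative f_hat' K h X Y n x) (at x)"
  using DERIV_divide[OF h_hat_has_derivative[OF assms(1), of h X Y n x]
      g_hat_has_derivative[OF assms(1), of h X n x] assms(2)] assms(2)
  unfolding f_hat_def[abs_def] f_hat'_def
  by (simp add: diff_divide_distrib power2_eq_square)

lemma f_tilde_has_derivative:
  assumes "\<And>u. K differentiable (at u)" and "g differentiable (at x)" and "g x \<noteq> 0"
  shows "(f_tilde g K h X Y n has_real_derivative f_tilde' g K h X Y n x) (at x)"
  using DERIV_divide[OF h_hat_has_derivative[OF assms(1), of h X Y n x],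
      OF assms(2)[folded DERIV_deriv_iff_real_differentiable] assms(3)] assms(3)
  unfolding f_tilde_def[abs_def] f_tilde'_def
  by (simp add: diff_divide_distrib power2_eq_square)

lemma f_check_has_derivative:
  assumes "\<And>u. K differentiable (at u)"
  shows "(f_check g K h X Y n has_real_derivative f_check' g K h X Y n x) (at x)"
  using h_hat_has_derivative[OF assms, of h X "\<lambda>k. Y k / g (X k)"]
  by (simp add: h_hat_def[abs_def] f_check_def[abs_def] h_hat'_def f_check'_def)

text \<open>The centered normal law with variance \<open>v \<ge> 0\<close>, degenerate to a Dirac mass for \<open>v = 0\<close>.\<close>

definition centered_normal :: "real \<Rightarrow> real measure" where
  "centered_normal v =
     (if v = 0 then return borel 0
      else density lborel (\<lambda>x. ennreal (normal_density 0 (sqrt v) x)))"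

definition converges_in_distribution ::
  "'a measure \<Rightarrow> (nat \<Rightarrow> 'a \<Rightarrow> real) \<Rightarrow> real measure \<Rightarrow> bool" where
  "converges_in_distribution M Z L \<longleftrightarrow> weak_conv_m (\<lambda>n. distr M borel (Z n)) L"

end

theory Submission
  imports Defs "HOL-Real_Asymp.Real_Asymp"
begin

text \<open>
  The sums occurring in the estimators have the form
  \<open>1/n \<Sum> L ((x - X k) / h k) (\<phi> (X k) + \<psi> (X k) e k) / h k ^ j\<close>, with \<open>L = K\<close>, \<open>j = 1\<close> or
  \<open>L = K'\<close>, \<open>j = 2\<close>. Write \<open>s n = sqrt (n h n ^ 3)\<close>. A quadratic approximation of \<open>\<phi> g\<close> at \<open>x\<close> makes
  the bias of the \<open>k\<close>-th summand \<open>O (h k)\<close>, and \<open>s n\<close> times the average of these biases vanishes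
  because \<open>\<alpha> > 1/5\<close>. For \<open>j = 1\<close> the deviation from the limit, multiplied by \<open>s n\<close>, tends to \<open>0\<close> in
  \<open>L\<^sup>2\<close>. For \<open>j = 2\<close> Lindeberg's theorem applies because the normalized summands are bounded by a null
  sequence times \<open>1 + \<bar>e k\<bar>\<close>; the factor \<open>1 / (1 + 3\<alpha>)\<close> is the limit of
  \<open>\<Sum> k powr (3\<alpha>) / n powr (1 + 3\<alpha>)\<close>.

  The theorem follows by Slutsky-type arguments. For the Nadaraya-Watson estimator, let \<open>B\<close>, \<open>D\<close> be
  the estimators of \<open>g x\<close>, \<open>g' x\<close>, let \<open>W\<close> be the statistic with \<open>L = K'\<close>, \<open>\<phi> = f - f x\<close>, \<open>\<psi> = 1\<close>
  and \<open>E\<close> the one with \<open>L = K\<close>, \<open>\<phi> = f x - f\<close>, \<open>\<psi> = -1\<close>. Its derivative is \<open>W / B + E D / B\<^sup>2\<close>,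
  and \<open>s n E\<close> is negligible while \<open>D\<close> stays bounded in probability, so that only \<open>W\<close> contributes to
  the limit law.
\<close>

section \<open>Characteristic functions and independence\<close>

text \<open>The limits are proved on characteristic functions. There a Slutsky argument is one
  Lipschitz estimate for \<open>iexp\<close>: it tolerates an error that is small in
  \<open>L^1\<close> off an event of small probability, and so covers both the random denominator
  \<open>B\<close> and summands that are only integrable. The exponents explain the range of
  \<alpha>. For \<open>j = 2\<close> a summand has second moment of order
  \<open>k powr (3 * \<alpha>)\<close>, which the factor \<open>s n / n\<close> normalises to a
  total variance of order one; the averaged bias is of order \<open>n powr (- \<alpha>)\<close> and
  acquires the exponent \<open>(1 - 5 * \<alpha>) / 2\<close> when multiplied by \<open>s n\<close>.
  The bound 1/3 makes \<open>s n\<close> diverge, so that an error that is merely bounded in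
  \<open>L^2\<close> after scaling still vanishes before scaling. The obstacle in the
  Nadaraya-Watson case is that the derivative of the numerator and \<open>D\<close> fluctuate at the
  same rate. Centring \<open>f\<close> at \<open>x\<close> removes it: the multiples of
  \<open>f x\<close> cancel exactly in the quotient rule, \<open>D\<close> is left with the small
  factor \<open>E\<close>, and the limiting second moment of \<open>W\<close> contains no
  \<open>f x\<close>. This is why \<open>\<sigma>\<^sup>2\<close> stands alone in the first
  limit.\<close>

lemma real_distribution_centered_normal:
  assumes "0 \<le> v"
  shows "real_distribution (centered_normal v)"
proof (cases "v = 0")
  case True
  then show ?thesis
    unfolding centered_normal_def real_distribution_def real_distribution_axioms_def
    by (auto intro: prob_space_return)
next
  case False
  with assms have "0 < sqrt v" by simp
  then show ?thesis
    using False prob_space_normal_density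
    unfolding centered_normal_def real_distribution_def real_distribution_axioms_def by auto
qed

text \<open>Both branches of \<open>centered_normal\<close> obey one formula, so a vanishing limit
  variance needs no separate treatment later. For positive variance the law is the standard normal
  one scaled by \<open>sqrt v\<close>.\<close>

lemma char_centered_normal:
  assumes "0 \<le> v"
  shows "char (centered_normal v) t = complex_of_real (exp (- (t\<^sup>2 * v) / 2))"
proof (cases "v = 0")
  case True
  then show ?thesis
    unfolding centered_normal_def char_def by (simp add: integral_return)
next
  case False
  with assms have v: "0 < sqrt v" by simp
  interpret prob_space std_normal_distribution
    by (rule prob_space_normal_density) simp
  have "distributed std_normal_distribution lborel (\<lambda>y. y) (\<lambda>y. ennreal (normal_density 0 1 y))"
    unfolding distributed_def by (auto simp: distr_id2)
  from normal_density_affine[OF this zero_less_one less_imp_neq[OF v, symmetric], of 0]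
  have eq: "distr std_normal_distribution borel (\<lambda>y. sqrt v * y) = centered_normal v"
    using False assms by (auto simp: distributed_def centered_normal_def cong: distr_cong)
  have "char (centered_normal v) t = char std_normal_distribution (t * sqrt v)"
    unfolding char_def eq[symmetric] by (subst integral_distr) (simp_all add: mult.assoc)
  also have "\<dots> = complex_of_real (exp (- (t\<^sup>2 * v) / 2))"
    unfolding char_std_normal_distribution using assms by (simp add: power_mult_distrib)
  finally show ?thesis .
qed

text \<open>This translates events of a whole sequence into events of its members. \<open>J\<close>
  is nonempty because the empty intersection is \<open>UNIV\<close> and not
  \<open>space M\<close>.\<close>

lemma vimage_restrict_prod_emb:
  assumes "\<And>i. i \<in> I \<Longrightarrow> X i \<in> measurable M (N i)" "J \<noteq> {}" "J \<subseteq> I"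
  shows "(\<lambda>\<omega>. \<lambda>i\<in>I. X i \<omega>) -` prod_emb I N J (Pi\<^sub>E J A) \<inter> space M
    = (\<Inter>j\<in>J. X j -` A j \<inter> space M)"
proof (rule set_eqI)
  fix \<omega>
  have "restrict (\<lambda>i\<in>I. X i \<omega>) J = (\<lambda>i\<in>J. X i \<omega>)"
    using assms(3) by (auto simp: restrict_def fun_eq_iff)
  then have "\<omega> \<in> (\<lambda>\<omega>. \<lambda>i\<in>I. X i \<omega>) -` prod_emb I N J (Pi\<^sub>E J A)
      \<longleftrightarrow> (\<forall>j\<in>J. X j \<omega> \<in> A j)" if "\<omega> \<in> space M"
    using measurable_space[OF assms(1) that] by (auto simp: prod_emb_iff PiE_iff)
  with assms(2) show "\<omega> \<in> (\<lambda>\<omega>. \<lambda>i\<in>I. X i \<omega>) -` prod_emb I N J (Pi\<^sub>E J A) \<inter> space M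
      \<longleftrightarrow> \<omega> \<in> (\<Inter>j\<in>J. X j -` A j \<inter> space M)"
    by auto
qed

text \<open>Factoring out \<open>iexp b\<close>, of modulus 1, leaves a Taylor remainder of
  \<open>iexp\<close> at 0. The bound \<open>2\<close> serves on exceptional events, the Lipschitz
  bound elsewhere.\<close>

lemma norm_iexp_diff_le: "norm (iexp a - iexp b) \<le> min 2 \<bar>a - b\<bar>"
proof -
  have "iexp a - iexp b = iexp b * (iexp (a - b) - 1)"
    by (simp add: algebra_simps flip: exp_add)
  then have "norm (iexp a - iexp b) = norm (iexp (a - b) - 1)"
    by (simp add: norm_mult)
  moreover have "norm (iexp (a - b) - 1) \<le> \<bar>a - b\<bar>"
    using iexp_approx1[of "a - b" 0] by simp
  moreover have "norm (iexp (a - b) - 1) \<le> 2"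
    using iexp_approx2[of "a - b" 0] by simp
  ultimately show ?thesis by simp
qed

context prob_space
begin

section \<open>Convergence of characteristic functions: perturbation and triangular arrays\<close>

lemma converges_in_distribution_centered_normalI:
  assumes [measurable]: "\<And>n. Z n \<in> borel_measurable M" and "0 \<le> v"
    and "\<And>t. (\<lambda>n. \<integral>\<omega>. iexp (t * Z n \<omega>) \<partial>M) \<longlonglongrightarrow> exp (- (t\<^sup>2 * v) / 2)"
  shows "converges_in_distribution M Z (centered_normal v)"
  unfolding converges_in_distribution_def
proof (rule levy_continuity)
  fix t show "(\<lambda>n. char (distr M borel (Z n)) t) \<longlonglongrightarrow> char (centered_normal v) t"
    unfolding char_centered_normal[OF \<open>0 \<le> v\<close>] using assms(3)[of t]
    by (simp add: char_def integral_distr exp_of_real)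
qed (auto intro!: real_distribution_distr real_distribution_centered_normal assms)

text \<open>Slutsky's lemma for one fixed \<open>t\<close>. The event \<open>A n\<close> absorbs
  what is controlled only in probability, such as a denominator close to 0; the majorant
  \<open>U n\<close> absorbs what is controlled in \<open>L^1\<close>.\<close>

lemma integral_iexp_tendsto_perturb:
  assumes [measurable]: "\<And>n. Z n \<in> borel_measurable M" "\<And>n. Z' n \<in> borel_measurable M"
    "\<And>n. A n \<in> events"
    and U: "\<And>n. integrable M (U n)" "\<And>n \<omega>. 0 \<le> U n \<omega>"
    and le: "\<forall>\<^sub>F n in sequentially. \<forall>\<omega>\<in>space M - A n. \<bar>Z' n \<omega> - Z n \<omega>\<bar> \<le> U n \<omega>"
    and A: "(\<lambda>n. prob (A n)) \<longlonglongrightarrow> 0"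
    and EU: "(\<lambda>n. expectation (U n)) \<longlonglongrightarrow> 0"
    and lim: "(\<lambda>n. \<integral>\<omega>. iexp (t * Z n \<omega>) \<partial>M) \<longlonglongrightarrow> c"
  shows "(\<lambda>n. \<integral>\<omega>. iexp (t * Z' n \<omega>) \<partial>M) \<longlonglongrightarrow> c"
proof -
  have int: "integrable M (\<lambda>\<omega>. iexp (t * Z n \<omega>))" "integrable M (\<lambda>\<omega>. iexp (t * Z' n \<omega>))" for n
    by (auto intro!: integrable_iexp)
  have "\<forall>\<^sub>F n in sequentially.
      norm ((\<integral>\<omega>. iexp (t * Z' n \<omega>) \<partial>M) - (\<integral>\<omega>. iexp (t * Z n \<omega>) \<partial>M))
        \<le> \<bar>t\<bar> * expectation (U n) + 2 * prob (A n)"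
    using le
  proof eventually_elim
    case (elim n)
    have "norm ((\<integral>\<omega>. iexp (t * Z' n \<omega>) \<partial>M) - (\<integral>\<omega>. iexp (t * Z n \<omega>) \<partial>M))
        = norm (\<integral>\<omega>. iexp (t * Z' n \<omega>) - iexp (t * Z n \<omega>) \<partial>M)"
      using int by (subst Bochner_Integration.integral_diff) auto
    also have "\<dots> \<le> (\<integral>\<omega>. norm (iexp (t * Z' n \<omega>) - iexp (t * Z n \<omega>)) \<partial>M)"
      by (rule integral_norm_bound)
    also have "\<dots> \<le> (\<integral>\<omega>. \<bar>t\<bar> * U n \<omega> + 2 * indicator (A n) \<omega> \<partial>M)"
    proof (rule integral_mono)
      show "integrable M (\<lambda>\<omega>. norm (iexp (t * Z' n \<omega>) - iexp (t * Z n \<omega>)))"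
        using int by (intro integrable_norm Bochner_Integration.integrable_diff)
      show "integrable M (\<lambda>\<omega>. \<bar>t\<bar> * U n \<omega> + 2 * indicator (A n) \<omega>)"
        using U by (auto intro!: integrable_real_indicator simp: emeasure_eq_measure)
      fix \<omega> assume \<omega>: "\<omega> \<in> space M"
      note * = norm_iexp_diff_le[of "t * Z' n \<omega>" "t * Z n \<omega>"]
      show "norm (iexp (t * Z' n \<omega>) - iexp (t * Z n \<omega>)) \<le> \<bar>t\<bar> * U n \<omega> + 2 * indicator (A n) \<omega>"
      proof (cases "\<omega> \<in> A n")
        case True
        then show ?thesis using * mult_nonneg_nonneg[OF abs_ge_zero U(2), of t n \<omega>] by (auto simp del: of_real_mult)
      next
        case False
        with elim \<omega> have "\<bar>Z' n \<omega> - Z n \<omega>\<bar> \<le> U n \<omega>" by auto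
        then have "\<bar>t\<bar> * \<bar>Z' n \<omega> - Z n \<omega>\<bar> \<le> \<bar>t\<bar> * U n \<omega>" by (rule mult_left_mono) simp
        then show ?thesis using * False by (simp add: right_diff_distrib flip: abs_mult)
      qed
    qed
    also have "\<dots> = \<bar>t\<bar> * expectation (U n) + 2 * prob (A n)"
      using U(1) by (simp add: emeasure_eq_measure)
    finally show ?case .
  qed
  moreover have "(\<lambda>n. \<bar>t\<bar> * expectation (U n) + 2 * prob (A n)) \<longlonglongrightarrow> 0"
    using tendsto_add[OF tendsto_mult_left[OF EU, of "\<bar>t\<bar>"] tendsto_mult_left[OF A, of 2]]
    by simp
  ultimately have "(\<lambda>n. (\<integral>\<omega>. iexp (t * Z' n \<omega>) \<partial>M) - (\<integral>\<omega>. iexp (t * Z n \<omega>) \<partial>M)) \<longlonglongrightarrow> 0"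
    by (rule Lim_null_comparison)
  from tendsto_add[OF this lim] show ?thesis by simp
qed

text \<open>
  The summands are not centered: keeping the mean in the exponent of the Gaussian approximation
  avoids subtracting it in the array.
\<close>

lemma norm_char_diff_gaussian_le:
  assumes [measurable]: "Z \<in> borel_measurable M" and sq: "integrable M (\<lambda>\<omega>. (Z \<omega>)\<^sup>2)"
  defines "m \<equiv> expectation Z" and "s \<equiv> expectation (\<lambda>\<omega>. (Z \<omega>)\<^sup>2)"
  shows "norm (char (distr M borel Z) t - exp (\<i> * t * m - t\<^sup>2 * s / 2))
    \<le> t\<^sup>2 / 6 * expectation (\<lambda>\<omega>. min (6 * (Z \<omega>)\<^sup>2) (\<bar>t\<bar> * \<bar>Z \<omega>\<bar> ^ 3))
      + exp (t\<^sup>2 * s / 2) * (t\<^sup>2 * m\<^sup>2 + t ^ 4 * s\<^sup>2 / 4)"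
proof -
  have Z: "integrable M Z" using square_integrable_imp_integrable[OF _ sq] by simp
  interpret D: real_distribution "distr M borel Z" by (rule real_distribution_distr) simp
  define z where "z = \<i> * complex_of_real t * complex_of_real m - complex_of_real (t\<^sup>2 * s / 2)"
  have pow: "integrable M (\<lambda>\<omega>. Z \<omega> ^ k)" if "k \<le> 2" for k
    using that sq Z by (cases "k = 0"; cases "k = 1") (auto simp: le_Suc_eq numeral_2_eq_2)
  have ii: "\<i> * complex_of_real t * (\<i> * complex_of_real t) = - (complex_of_real t * complex_of_real t)"
    by (simp add: algebra_simps)
  have "norm (char (distr M borel Z) t
      - (\<Sum>k\<le>2. ((\<i> * t)^k / fact k) * D.expectation (\<lambda>y. y^k)))
    \<le> \<bar>t\<bar>^2 / fact (Suc 2) * D.expectation (\<lambda>y. min (2 * \<bar>y\<bar>^2 * Suc 2) (\<bar>t\<bar> * \<bar>y\<bar>^Suc 2))"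
    by (rule D.char_approx2) (use pow in \<open>auto simp: integrable_distr_eq\<close>)
  also have "(\<Sum>k\<le>2. ((\<i> * t)^k / fact k) * D.expectation (\<lambda>y. y^k)) = 1 + z"
    by (simp add: numeral_2_eq_2 integral_distr z_def m_def s_def prob_space power2_eq_square
        power_mult_distrib ii del: distr_const)
  \<comment> \<open>The 6 in the truncated moment is \<open>2 * Suc 2\<close> from the second-order
    remainder estimate.\<close>
  also have "D.expectation (\<lambda>y. min (2 * \<bar>y\<bar>^2 * Suc 2) (\<bar>t\<bar> * \<bar>y\<bar>^Suc 2))
      = expectation (\<lambda>\<omega>. min (6 * (Z \<omega>)\<^sup>2) (\<bar>t\<bar> * \<bar>Z \<omega>\<bar> ^ 3))"
    by (simp add: integral_distr eval_nat_numeral mult.commute mult.left_commute)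
  finally have 1: "norm (char (distr M borel Z) t - (1 + z))
      \<le> t\<^sup>2 / 6 * expectation (\<lambda>\<omega>. min (6 * (Z \<omega>)\<^sup>2) (\<bar>t\<bar> * \<bar>Z \<omega>\<bar> ^ 3))"
    by (simp add: fact_numeral)
  have s: "0 \<le> s" unfolding s_def by (rule integral_nonneg_AE) simp
  have Re: "Re z = - (t\<^sup>2 * s / 2)" and Im: "Im z = t * m" by (simp_all add: z_def)
  \<comment> \<open>The square of \<open>norm z\<close> splits into a mean part and a variance part.
    Hence an array only has to control the sums of squared means and of squared second
    moments.\<close>
  have nz: "(norm z)\<^sup>2 = t\<^sup>2 * m\<^sup>2 + t ^ 4 * s\<^sup>2 / 4"
    unfolding cmod_power2 Re Im by (simp add: power_mult_distrib power_divide flip: power_mult)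
  have "norm (exp z - (\<Sum>k\<le>1. z ^ k / fact k)) \<le> exp \<bar>Re z\<bar> * (norm z) ^ Suc 1 / fact 1"
    by (rule Taylor_exp)
  then have "norm (exp z - (1 + z)) \<le> exp (t\<^sup>2 * s / 2) * (t\<^sup>2 * m\<^sup>2 + t ^ 4 * s\<^sup>2 / 4)"
    using s by (simp add: Re nz[symmetric] numeral_2_eq_2[symmetric])
  with 1 have "norm (char (distr M borel Z) t - exp z)
      \<le> t\<^sup>2 / 6 * expectation (\<lambda>\<omega>. min (6 * (Z \<omega>)\<^sup>2) (\<bar>t\<bar> * \<bar>Z \<omega>\<bar> ^ 3))
      + exp (t\<^sup>2 * s / 2) * (t\<^sup>2 * m\<^sup>2 + t ^ 4 * s\<^sup>2 / 4)"
    using norm_triangle_ineq4[of "char (distr M borel Z) t - (1 + z)" "exp z - (1 + z)"] by simp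
  then show ?thesis by (simp add: z_def)
qed

text \<open>Lindeberg's method: characteristic functions and Gaussian factors lie in the unit disc,
  so the products differ by at most the sum of the differences of their factors. Uncentered second
  moments may replace variances because the squared means sum to a null sequence, and
  \<open>var_sq\<close> expresses that no single summand dominates. The deterministic
  \<open>b n\<close> contributes a factor of modulus 1, so the means have to match it in the sum and
  not term by term.\<close>

lemma integral_iexp_triangular_array:
  fixes Z :: "nat \<Rightarrow> nat \<Rightarrow> 'a \<Rightarrow> real"
  assumes indep: "\<And>n. indep_vars (\<lambda>_. borel) (Z n) {1..n}"
    and sq: "\<And>n k. k \<in> {1..n} \<Longrightarrow> integrable M (\<lambda>\<omega>. (Z n k \<omega>)\<^sup>2)"
    and mean: "(\<lambda>n. (\<Sum>k=1..n. expectation (Z n k)) - b n) \<longlonglongrightarrow> 0"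
    and var: "(\<lambda>n. \<Sum>k=1..n. expectation (\<lambda>\<omega>. (Z n k \<omega>)\<^sup>2)) \<longlonglongrightarrow> v"
    and mean_sq: "(\<lambda>n. \<Sum>k=1..n. (expectation (Z n k))\<^sup>2) \<longlonglongrightarrow> 0"
    and var_sq: "(\<lambda>n. \<Sum>k=1..n. (expectation (\<lambda>\<omega>. (Z n k \<omega>)\<^sup>2))\<^sup>2) \<longlonglongrightarrow> 0"
    and lindeberg: "(\<lambda>n. \<Sum>k=1..n. expectation (\<lambda>\<omega>. min (6 * (Z n k \<omega>)\<^sup>2) (\<bar>t\<bar> * \<bar>Z n k \<omega>\<bar> ^ 3)))
      \<longlonglongrightarrow> 0"
  shows "(\<lambda>n. \<integral>\<omega>. iexp (t * ((\<Sum>k=1..n. Z n k \<omega>) - b n)) \<partial>M) \<longlonglongrightarrow> exp (- (t\<^sup>2 * v) / 2)"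
proof -
  define m where "m n k = expectation (Z n k)" for n k
  define s where "s n k = expectation (\<lambda>\<omega>. (Z n k \<omega>)\<^sup>2)" for n k
  define r where "r n k = expectation (\<lambda>\<omega>. min (6 * (Z n k \<omega>)\<^sup>2) (\<bar>t\<bar> * \<bar>Z n k \<omega>\<bar> ^ 3))" for n k
  define G where "G n k = exp (\<i> * t * m n k - t\<^sup>2 * s n k / 2)" for n k
  have rv: "Z n k \<in> borel_measurable M" if "k \<in> {1..n}" for n k
    using indep[of n] that unfolding indep_vars_def by auto
  have s_nonneg: "0 \<le> s n k" for n k unfolding s_def by (rule integral_nonneg_AE) simp
  \<comment> \<open>The row sums converge, hence are bounded; as their terms are nonnegative,
    \<open>B\<close> bounds each term and makes the exponential prefactor uniform in
    \<open>n\<close> and \<open>k\<close>.\<close>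
  obtain B where B: "\<And>n. norm (\<Sum>k=1..n. s n k) \<le> B"
    using convergent_imp_Bseq[OF convergentI[OF var]] unfolding s_def Bseq_def by auto
  have s_le: "s n k \<le> B" if "k \<in> {1..n}" for n k
  proof -
    have "s n k \<le> (\<Sum>k=1..n. s n k)" using that s_nonneg by (intro member_le_sum) auto
    with B[of n] show ?thesis by simp
  qed
  have char: "char (distr M borel (\<lambda>\<omega>. \<Sum>k=1..n. Z n k \<omega>)) t
      = (\<Prod>k=1..n. char (distr M borel (Z n k)) t)" for n
    by (rule char_distr_sum[OF indep])
  have le: "norm ((\<Prod>k=1..n. char (distr M borel (Z n k)) t) - (\<Prod>k=1..n. G n k))
     \<le> t\<^sup>2 / 6 * (\<Sum>k=1..n. r n k)
      + exp (t\<^sup>2 * B / 2) * (t\<^sup>2 * (\<Sum>k=1..n. (m n k)\<^sup>2) + t ^ 4 / 4 * (\<Sum>k=1..n. (s n k)\<^sup>2))" for n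
  proof -
    have "norm ((\<Prod>k=1..n. char (distr M borel (Z n k)) t) - (\<Prod>k=1..n. G n k))
      \<le> (\<Sum>k=1..n. norm (char (distr M borel (Z n k)) t - G n k))"
    proof (rule norm_prod_diff)
      show "norm (char (distr M borel (Z n k)) t) \<le> 1" if "k \<in> {1..n}" for k
        by (rule real_distribution.cmod_char_le_1[OF real_distribution_distr[OF rv[OF that]]])
      show "norm (G n k) \<le> 1" if "k \<in> {1..n}" for k
        using s_nonneg[of n k] by (simp add: G_def norm_exp_eq_Re)
    qed
    also have "\<dots> \<le> (\<Sum>k=1..n. t\<^sup>2 / 6 * r n k
        + exp (t\<^sup>2 * B / 2) * (t\<^sup>2 * (m n k)\<^sup>2 + t ^ 4 / 4 * (s n k)\<^sup>2))"
    proof (rule sum_mono)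
      fix k assume k: "k \<in> {1..n}"
      have "norm (char (distr M borel (Z n k)) t - G n k) \<le> t\<^sup>2 / 6 * r n k
        + exp (t\<^sup>2 * s n k / 2) * (t\<^sup>2 * (m n k)\<^sup>2 + t ^ 4 * (s n k)\<^sup>2 / 4)"
        unfolding G_def m_def s_def r_def by (rule norm_char_diff_gaussian_le[OF rv[OF k] sq[OF k]])
      also have "exp (t\<^sup>2 * s n k / 2) * (t\<^sup>2 * (m n k)\<^sup>2 + t ^ 4 * (s n k)\<^sup>2 / 4)
          \<le> exp (t\<^sup>2 * B / 2) * (t\<^sup>2 * (m n k)\<^sup>2 + t ^ 4 * (s n k)\<^sup>2 / 4)"
        using s_le[OF k] by (intro mult_right_mono) (auto intro!: mult_left_mono)
      finally show "norm (char (distr M borel (Z n k)) t - G n k) \<le> t\<^sup>2 / 6 * r n k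
        + exp (t\<^sup>2 * B / 2) * (t\<^sup>2 * (m n k)\<^sup>2 + t ^ 4 / 4 * (s n k)\<^sup>2)" by simp
    qed
    also have "\<dots> = t\<^sup>2 / 6 * (\<Sum>k=1..n. r n k)
      + exp (t\<^sup>2 * B / 2) * (t\<^sup>2 * (\<Sum>k=1..n. (m n k)\<^sup>2) + t ^ 4 / 4 * (\<Sum>k=1..n. (s n k)\<^sup>2))"
      by (simp add: sum.distrib sum_distrib_left algebra_simps)
    finally show ?thesis .
  qed
  have "(\<lambda>n. t\<^sup>2 / 6 * (\<Sum>k=1..n. r n k)
      + exp (t\<^sup>2 * B / 2) * (t\<^sup>2 * (\<Sum>k=1..n. (m n k)\<^sup>2) + t ^ 4 / 4 * (\<Sum>k=1..n. (s n k)\<^sup>2)))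
    \<longlonglongrightarrow> t\<^sup>2 / 6 * 0 + exp (t\<^sup>2 * B / 2) * (t\<^sup>2 * 0 + t ^ 4 / 4 * 0)"
    unfolding r_def m_def s_def by (intro tendsto_intros lindeberg mean_sq var_sq)
  then have diff: "(\<lambda>n. (\<Prod>k=1..n. char (distr M borel (Z n k)) t) - (\<Prod>k=1..n. G n k)) \<longlonglongrightarrow> 0"
    unfolding mult_zero_right add_0_right by (rule Lim_null_comparison[OF always_eventually[OF allI[OF le]]])
  have shift: "(\<integral>\<omega>. iexp (t * ((\<Sum>k=1..n. Z n k \<omega>) - b n)) \<partial>M)
      = iexp (- (t * b n)) * (\<Prod>k=1..n. char (distr M borel (Z n k)) t)" for n
  proof -
    have S: "(\<lambda>\<omega>. \<Sum>k=1..n. Z n k \<omega>) \<in> borel_measurable M"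
      using rv by (intro borel_measurable_sum) auto
    have split: "iexp (t * (a - b n)) = iexp (- (t * b n)) * iexp (t * a)" for a
    proof -
      have "\<i> * complex_of_real (t * (a - b n))
          = \<i> * complex_of_real (- (t * b n)) + \<i> * complex_of_real (t * a)"
        by (simp add: algebra_simps)
      then show ?thesis by (simp only: exp_add)
    qed
    have "(\<integral>\<omega>. iexp (t * ((\<Sum>k=1..n. Z n k \<omega>) - b n)) \<partial>M)
        = (\<integral>\<omega>. iexp (- (t * b n)) * iexp (t * (\<Sum>k=1..n. Z n k \<omega>)) \<partial>M)"
      by (simp only: split)
    also have "\<dots> = iexp (- (t * b n)) * char (distr M borel (\<lambda>\<omega>. \<Sum>k=1..n. Z n k \<omega>)) t"
      unfolding char_def by (subst integral_distr[OF S]) simp_all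
    finally show ?thesis using char[of n] by simp
  qed
  have gauss: "iexp (- (t * b n)) * (\<Prod>k=1..n. G n k)
      = exp (\<i> * t * ((\<Sum>k=1..n. m n k) - b n) - t\<^sup>2 * (\<Sum>k=1..n. s n k) / 2)" for n
  proof -
    have "(\<Prod>k=1..n. G n k) = exp (\<Sum>k=1..n. \<i> * t * m n k - t\<^sup>2 * s n k / 2)"
      unfolding G_def by (rule exp_sum[symmetric]) simp
    also have "(\<Sum>k=1..n. \<i> * t * m n k - t\<^sup>2 * s n k / 2)
        = \<i> * t * (\<Sum>k=1..n. m n k) - t\<^sup>2 * (\<Sum>k=1..n. s n k) / 2"
      by (simp add: sum_subtractf sum_distrib_left sum_divide_distrib)
    finally show ?thesis
      by (simp only: exp_add[symmetric]) (simp add: algebra_simps)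
  qed
  have "(\<lambda>n. exp (\<i> * t * complex_of_real ((\<Sum>k=1..n. m n k) - b n)
        - complex_of_real (t\<^sup>2 * (\<Sum>k=1..n. s n k) / 2)))
      \<longlonglongrightarrow> exp (\<i> * t * complex_of_real 0 - complex_of_real (t\<^sup>2 * v / 2))"
    unfolding m_def s_def by (intro tendsto_intros mean var) auto
  then have lim: "(\<lambda>n. iexp (- (t * b n)) * (\<Prod>k=1..n. G n k)) \<longlonglongrightarrow> exp (- (t\<^sup>2 * v) / 2)"
    unfolding gauss by (simp add: exp_of_real[symmetric])
  have "(\<lambda>n. iexp (- (t * b n)) * ((\<Prod>k=1..n. char (distr M borel (Z n k)) t) - (\<Prod>k=1..n. G n k)))
      \<longlonglongrightarrow> 0"
    by (rule tendsto_norm_zero_cancel) (use tendsto_norm_zero[OF diff] in \<open>simp add: norm_mult\<close>)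
  from tendsto_add[OF this lim] show ?thesis unfolding shift by (simp add: algebra_simps)
qed

section \<open>Second moments of independent sums and independence of pairs\<close>

text \<open>Bias-variance decomposition: variances of independent variables add, and each is at most
  the second moment, which is the quantity that a kernel substitution computes.\<close>

lemma expectation_sum_square_le:
  fixes Z :: "'i \<Rightarrow> 'a \<Rightarrow> real"
  assumes "finite I" and indep: "indep_vars (\<lambda>_. borel) Z I"
    and sq: "\<And>k. k \<in> I \<Longrightarrow> integrable M (\<lambda>\<omega>. (Z k \<omega>)\<^sup>2)"
  shows "integrable M (\<lambda>\<omega>. ((\<Sum>k\<in>I. Z k \<omega>) - b)\<^sup>2)"
    and "expectation (\<lambda>\<omega>. ((\<Sum>k\<in>I. Z k \<omega>) - b)\<^sup>2)
      \<le> (\<Sum>k\<in>I. expectation (\<lambda>\<omega>. (Z k \<omega>)\<^sup>2)) + ((\<Sum>k\<in>I. expectation (Z k)) - b)\<^sup>2"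
proof -
  have rv: "Z k \<in> borel_measurable M" if "k \<in> I" for k
    using indep that unfolding indep_vars_def by auto
  have int: "integrable M (Z k)" if "k \<in> I" for k
    using square_integrable_imp_integrable[OF rv[OF that] sq[OF that]] .
  \<comment> \<open>With the squared means subtracted this is the additivity of the variance; they
    are discarded only in the final estimate.\<close>
  have main: "integrable M (\<lambda>\<omega>. (\<Sum>k\<in>J. Z k \<omega>)\<^sup>2) \<and>
      expectation (\<lambda>\<omega>. (\<Sum>k\<in>J. Z k \<omega>)\<^sup>2) \<le>
      (\<Sum>k\<in>J. expectation (\<lambda>\<omega>. (Z k \<omega>)\<^sup>2)) + (\<Sum>k\<in>J. expectation (Z k))\<^sup>2 - (\<Sum>k\<in>J. (expectation (Z k))\<^sup>2)"
    if "finite J" "J \<subseteq> I" for J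
    using that
  proof (induction J rule: finite_induct)
    case (insert j J)
    define S where "S \<omega> = (\<Sum>k\<in>J. Z k \<omega>)" for \<omega>
    from insert have IH: "integrable M (\<lambda>\<omega>. (S \<omega>)\<^sup>2)"
      "expectation (\<lambda>\<omega>. (S \<omega>)\<^sup>2) \<le> (\<Sum>k\<in>J. expectation (\<lambda>\<omega>. (Z k \<omega>)\<^sup>2))
        + (\<Sum>k\<in>J. expectation (Z k))\<^sup>2 - (\<Sum>k\<in>J. (expectation (Z k))\<^sup>2)"
      by (auto simp: S_def)
    have iv: "indep_var borel (Z j) borel S"
      unfolding S_def using insert by (intro indep_vars_sum) (auto intro: indep_vars_subset[OF indep])
    have S: "integrable M S" "expectation S = (\<Sum>k\<in>J. expectation (Z k))"
      unfolding S_def using insert int by (auto intro!: Bochner_Integration.integral_sum)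
    have j: "integrable M (Z j)" "integrable M (\<lambda>\<omega>. (Z j \<omega>)\<^sup>2)" using insert int sq by auto
    note p = indep_var_integrable[OF iv j(1) S(1)] indep_var_lebesgue_integral[OF iv j(1) S(1)]
    have eq: "(\<Sum>k\<in>insert j J. Z k \<omega>)\<^sup>2 = (Z j \<omega>)\<^sup>2 + (2 * (Z j \<omega> * S \<omega>) + (S \<omega>)\<^sup>2)" for \<omega>
      using insert by (simp add: S_def power2_eq_square algebra_simps)
    have "expectation (\<lambda>\<omega>. (\<Sum>k\<in>insert j J. Z k \<omega>)\<^sup>2) = expectation (\<lambda>\<omega>. (Z j \<omega>)\<^sup>2)
        + (2 * (expectation (Z j) * expectation S) + expectation (\<lambda>\<omega>. (S \<omega>)\<^sup>2))"
      unfolding eq using j IH p by (simp add: Bochner_Integration.integral_add)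
    moreover have "integrable M (\<lambda>\<omega>. (\<Sum>k\<in>insert j J. Z k \<omega>)\<^sup>2)"
      unfolding eq using j IH p by auto
    ultimately show ?case
      using IH(2) insert by (simp add: S(2) power2_eq_square algebra_simps)
  qed simp
  note main = main[OF assms(1) order_refl]
  have S: "integrable M (\<lambda>\<omega>. \<Sum>k\<in>I. Z k \<omega>)"
    "expectation (\<lambda>\<omega>. \<Sum>k\<in>I. Z k \<omega>) = (\<Sum>k\<in>I. expectation (Z k))"
    using int by (auto intro!: Bochner_Integration.integral_sum)
  have eq: "((\<Sum>k\<in>I. Z k \<omega>) - b)\<^sup>2 = (\<Sum>k\<in>I. Z k \<omega>)\<^sup>2 + (b\<^sup>2 - (2 * b) * (\<Sum>k\<in>I. Z k \<omega>))" for \<omega>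
    by (simp add: power2_eq_square algebra_simps)
  show "integrable M (\<lambda>\<omega>. ((\<Sum>k\<in>I. Z k \<omega>) - b)\<^sup>2)"
    unfolding eq using main S by auto
  have "expectation (\<lambda>\<omega>. ((\<Sum>k\<in>I. Z k \<omega>) - b)\<^sup>2)
      = expectation (\<lambda>\<omega>. (\<Sum>k\<in>I. Z k \<omega>)\<^sup>2) + (b\<^sup>2 - (2 * b) * (\<Sum>k\<in>I. expectation (Z k)))"
    unfolding eq using main S by (simp add: Bochner_Integration.integral_add prob_space)
  also have "\<dots> \<le> (\<Sum>k\<in>I. expectation (\<lambda>\<omega>. (Z k \<omega>)\<^sup>2)) + ((\<Sum>k\<in>I. expectation (Z k)) - b)\<^sup>2"
    using main sum_nonneg[of I "\<lambda>k. (expectation (Z k))\<^sup>2"]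
    by (simp add: power2_eq_square algebra_simps)
  finally show "expectation (\<lambda>\<omega>. ((\<Sum>k\<in>I. Z k \<omega>) - b)\<^sup>2)
      \<le> (\<Sum>k\<in>I. expectation (\<lambda>\<omega>. (Z k \<omega>)\<^sup>2)) + ((\<Sum>k\<in>I. expectation (Z k)) - b)\<^sup>2" .
qed

text \<open>Independence is known within each sequence and between the two sequences as wholes,
  while the sums need independent pairs. On rectangles the product formula follows by separating the
  \<open>Y\<close> events from the \<open>X\<close> events and then factoring each group over the
  indices. Rectangles are stable under intersection and generate the product sigma-algebra.\<close>

lemma indep_vars_Pair:
  assumes X: "indep_vars N X I" and Y: "indep_vars N' Y I"
    and XY: "indep_var (PiM I N') (\<lambda>\<omega>. \<lambda>i\<in>I. Y i \<omega>) (PiM I N) (\<lambda>\<omega>. \<lambda>i\<in>I. X i \<omega>)"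
  shows "indep_vars (\<lambda>i. N i \<Otimes>\<^sub>M N' i) (\<lambda>i \<omega>. (X i \<omega>, Y i \<omega>)) I"
proof -
  have rvX[measurable]: "X i \<in> measurable M (N i)" if "i \<in> I" for i
    using X that by (auto simp: indep_vars_def)
  have rvY[measurable]: "Y i \<in> measurable M (N' i)" if "i \<in> I" for i
    using Y that by (auto simp: indep_vars_def)
  define E where "E i = {(X i -` A \<inter> space M) \<inter> (Y i -` B \<inter> space M) | A B. A \<in> sets (N i) \<and> B \<in> sets (N' i)}"
    for i
  have "indep_sets E I"
  proof (rule indep_setsI)
    show "E i \<subseteq> events" if "i \<in> I" for i
      using that by (auto simp: E_def intro!: sets.Int measurable_sets[OF rvX] measurable_sets[OF rvY])
  next
    fix C J assume J: "J \<noteq> {}" "J \<subseteq> I" "finite J" and C: "\<forall>j\<in>J. C j \<in> E j"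
    have "\<exists>A B. A \<in> sets (N j) \<and> B \<in> sets (N' j) \<and> C j = (X j -` A \<inter> space M) \<inter> (Y j -` B \<inter> space M)"
      if "j \<in> J" for j
      using C[rule_format, OF that] unfolding E_def by blast
    then obtain A B where AB: "\<And>j. j \<in> J \<Longrightarrow> A j \<in> sets (N j)" "\<And>j. j \<in> J \<Longrightarrow> B j \<in> sets (N' j)"
      "\<And>j. j \<in> J \<Longrightarrow> C j = (X j -` A j \<inter> space M) \<inter> (Y j -` B j \<inter> space M)"
      by metis
    define PA where "PA = prod_emb I N J (Pi\<^sub>E J A)"
    define PB where "PB = prod_emb I N' J (Pi\<^sub>E J B)"
    have PA: "PA \<in> sets (PiM I N)" and PB: "PB \<in> sets (PiM I N')"
      unfolding PA_def PB_def using J AB by (auto intro!: sets_PiM_I)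
    have vA: "(\<lambda>\<omega>. \<lambda>i\<in>I. X i \<omega>) -` PA \<inter> space M = (\<Inter>j\<in>J. X j -` A j \<inter> space M)"
      unfolding PA_def by (rule vimage_restrict_prod_emb[OF rvX J(1,2)])
    have vB: "(\<lambda>\<omega>. \<lambda>i\<in>I. Y i \<omega>) -` PB \<inter> space M = (\<Inter>j\<in>J. Y j -` B j \<inter> space M)"
      unfolding PB_def by (rule vimage_restrict_prod_emb[OF rvY J(1,2)])
    have "(\<Inter>j\<in>J. C j) = (\<lambda>\<omega>. (\<lambda>i\<in>I. Y i \<omega>, \<lambda>i\<in>I. X i \<omega>)) -` (PB \<times> PA) \<inter> space M"
    proof -
      have "(\<Inter>j\<in>J. C j) = (\<Inter>j\<in>J. Y j -` B j \<inter> space M) \<inter> (\<Inter>j\<in>J. X j -` A j \<inter> space M)"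
        using AB(3) by auto
      then show ?thesis unfolding vA[symmetric] vB[symmetric] by auto
    qed
    then have "prob (\<Inter>j\<in>J. C j) = prob (\<Inter>j\<in>J. Y j -` B j \<inter> space M) * prob (\<Inter>j\<in>J. X j -` A j \<inter> space M)"
      using indep_varD[OF XY PB PA] by (simp add: vA vB)
    also have "\<dots> = (\<Prod>j\<in>J. prob (Y j -` B j \<inter> space M) * prob (X j -` A j \<inter> space M))"
      using indep_varsD[OF X J(1,3,2) AB(1)] indep_varsD[OF Y J(1,3,2) AB(2)]
      by (simp add: prod.distrib)
    also have "\<dots> = (\<Prod>j\<in>J. prob (C j))"
    proof (rule prod.cong[OF refl])
      fix j assume j: "j \<in> J"
      with J have jI: "j \<in> I" by auto
      \<comment> \<open>Projecting both sequences to the coordinate \<open>j\<close> gives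
        independence of \<open>Y j\<close> and \<open>X j\<close>, which reassembles the two
        probabilities into that of \<open>C j\<close>.\<close>
      have "indep_var (N' j) ((\<lambda>f. f j) \<circ> (\<lambda>\<omega>. \<lambda>i\<in>I. Y i \<omega>)) (N j) ((\<lambda>f. f j) \<circ> (\<lambda>\<omega>. \<lambda>i\<in>I. X i \<omega>))"
        using jI by (intro indep_var_compose[OF XY]) auto
      then have "indep_var (N' j) (Y j) (N j) (X j)" using jI by (simp add: comp_def)
      from indep_varD[OF this AB(2)[OF j] AB(1)[OF j]]
      have "prob (Y j -` B j \<inter> space M) * prob (X j -` A j \<inter> space M)
          = prob ((\<lambda>\<omega>. (Y j \<omega>, X j \<omega>)) -` (B j \<times> A j) \<inter> space M)" by simp
      also have "(\<lambda>\<omega>. (Y j \<omega>, X j \<omega>)) -` (B j \<times> A j) \<inter> space M = C j"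
        using AB(3)[OF j] by auto
      finally show "prob (Y j -` B j \<inter> space M) * prob (X j -` A j \<inter> space M) = prob (C j)" .
    qed
    finally show "prob (\<Inter>j\<in>J. C j) = (\<Prod>j\<in>J. prob (C j))" .
  qed
  moreover have "Int_stable (E i)" if "i \<in> I" for i
  proof (rule Int_stableI)
    fix a b assume "a \<in> E i" "b \<in> E i"
    then obtain A B A' B' where
      "A \<in> sets (N i)" "B \<in> sets (N' i)" "a = (X i -` A \<inter> space M) \<inter> (Y i -` B \<inter> space M)"
      "A' \<in> sets (N i)" "B' \<in> sets (N' i)" "b = (X i -` A' \<inter> space M) \<inter> (Y i -` B' \<inter> space M)"
      unfolding E_def by auto
    then show "a \<inter> b \<in> E i"
      unfolding E_def by (intro CollectI exI[of _ "A \<inter> A'"] exI[of _ "B \<inter> B'"]) auto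
  qed
  ultimately have "indep_sets (\<lambda>i. sigma_sets (space M) (E i)) I" by (rule indep_sets_sigma)
  then have "indep_sets (\<lambda>i. {(\<lambda>\<omega>. (X i \<omega>, Y i \<omega>)) -` A \<inter> space M |A. A \<in> sets (N i \<Otimes>\<^sub>M N' i)}) I"
  proof (rule indep_sets_mono_sets)
    fix i assume i: "i \<in> I"
    let ?P = "{a \<times> b | a b. a \<in> sets (N i) \<and> b \<in> sets (N' i)}"
    have "{(\<lambda>\<omega>. (X i \<omega>, Y i \<omega>)) -` A \<inter> space M |A. A \<in> sets (N i \<Otimes>\<^sub>M N' i)}
        = sigma_sets (space M) {(\<lambda>\<omega>. (X i \<omega>, Y i \<omega>)) -` A \<inter> space M |A. A \<in> ?P}"
      unfolding sets_pair_measure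
      using measurable_space[OF rvX[OF i]] measurable_space[OF rvY[OF i]]
      by (intro sigma_sets_vimage_commute) auto
    also have "\<dots> \<subseteq> sigma_sets (space M) (E i)"
    proof (rule sigma_sets_mono')
      show "{(\<lambda>\<omega>. (X i \<omega>, Y i \<omega>)) -` A \<inter> space M |A. A \<in> ?P} \<subseteq> E i"
        unfolding E_def by fastforce
    qed
    finally show "{(\<lambda>\<omega>. (X i \<omega>, Y i \<omega>)) -` A \<inter> space M |A. A \<in> sets (N i \<Otimes>\<^sub>M N' i)}
        \<subseteq> sigma_sets (space M) (E i)" .
  qed
  then show ?thesis
    unfolding indep_vars_def2 using rvX rvY by (auto intro!: measurable_Pair)
qed

end

section \<open>Power sums and kernel smoothing\<close>

text \<open>The mean value theorem for one increment. Comparing \<open>z\<close> with an endpoint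
  gives the induction step for power sums, in place of a comparison with an integral.\<close>

lemma powr_succ_diff:
  fixes n :: nat and \<gamma> :: real
  assumes "1 \<le> n"
  obtains z where "real n < z" "z < real n + 1"
    "(real n + 1) powr \<gamma> - real n powr \<gamma> = \<gamma> * z powr (\<gamma> - 1)"
proof -
  have "\<exists>z. real n < z \<and> z < real n + 1 \<and>
      (real n + 1) powr \<gamma> - real n powr \<gamma> = (real n + 1 - real n) * (\<gamma> * z powr (\<gamma> - 1))"
    using assms by (intro MVT2) (auto intro!: has_real_derivative_powr)
  with that show thesis by auto
qed

lemma sum_powr_lower:
  fixes \<beta> :: real
  assumes "0 \<le> \<beta>"
  shows "real n powr (1 + \<beta>) \<le> (1 + \<beta>) * (\<Sum>k=1..n. real k powr \<beta>)"
proof (induction n)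
  case (Suc n)
  show ?case
  proof (cases "n = 0")
    case True
    then show ?thesis using assms by simp
  next
    case False
    then have "1 \<le> n" by simp
    then obtain z where z: "real n < z" "z < real n + 1"
      "(real n + 1) powr (1 + \<beta>) - real n powr (1 + \<beta>) = (1 + \<beta>) * z powr (1 + \<beta> - 1)"
      by (rule powr_succ_diff)
    have "z powr \<beta> \<le> (real n + 1) powr \<beta>" using z assms by (intro powr_mono2) auto
    then have "(1 + \<beta>) * z powr \<beta> \<le> (1 + \<beta>) * (real n + 1) powr \<beta>"
      using assms by (intro mult_left_mono) auto
    with z Suc show ?thesis by (simp add: algebra_simps)
  qed
qed simp

lemma sum_powr_upper:
  fixes \<beta> :: real
  assumes "0 \<le> \<beta>"
  shows "(1 + \<beta>) * (\<Sum>k=1..n. real k powr \<beta>) \<le> (real n + 1) powr (1 + \<beta>)"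
proof (induction n)
  case (Suc n)
  have "1 \<le> Suc n" by simp
  then obtain z where z: "real (Suc n) < z" "z < real (Suc n) + 1"
    "(real (Suc n) + 1) powr (1 + \<beta>) - real (Suc n) powr (1 + \<beta>) = (1 + \<beta>) * z powr (1 + \<beta> - 1)"
    by (rule powr_succ_diff)
  have "real (Suc n) powr \<beta> \<le> z powr \<beta>" using z assms by (intro powr_mono2) auto
  then have "(1 + \<beta>) * real (Suc n) powr \<beta> \<le> (1 + \<beta>) * z powr \<beta>"
    using assms by (intro mult_left_mono) auto
  with z Suc show ?case by (simp add: algebra_simps)
qed simp

text \<open>The terms decrease, so \<open>z\<close> is compared with its right endpoint. The sum is
  that of the bandwidths, which governs the bias.\<close>

lemma sum_powr_minus_le:
  fixes \<alpha> :: real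
  assumes "0 \<le> \<alpha>" "\<alpha> < 1"
  shows "(\<Sum>k=1..n. real k powr (- \<alpha>)) \<le> real n powr (1 - \<alpha>) / (1 - \<alpha>)"
proof -
  have "(1 - \<alpha>) * (\<Sum>k=1..n. real k powr (- \<alpha>)) \<le> real n powr (1 - \<alpha>)"
  proof (induction n)
    case (Suc n)
    show ?case
    proof (cases "n = 0")
      case True
      then show ?thesis using assms by simp
    next
      case False
      then have "1 \<le> n" by simp
      then obtain z where z: "real n < z" "z < real n + 1"
        "(real n + 1) powr (1 - \<alpha>) - real n powr (1 - \<alpha>) = (1 - \<alpha>) * z powr (1 - \<alpha> - 1)"
        by (rule powr_succ_diff)
      have "(real n + 1) powr (- \<alpha>) \<le> z powr (- \<alpha>)" using z assms False by (intro powr_mono2') auto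
      then have "(1 - \<alpha>) * (real n + 1) powr (- \<alpha>) \<le> (1 - \<alpha>) * z powr (- \<alpha>)"
        using assms by (intro mult_left_mono) auto
      with z Suc show ?thesis by (simp add: algebra_simps)
    qed
  qed simp
  with assms show ?thesis by (simp add: field_simps)
qed

lemma sum_powr_asymp:
  fixes \<beta> :: real
  assumes "0 \<le> \<beta>"
  shows "(\<lambda>n. (\<Sum>k=1..n. real k powr \<beta>) / real n powr (1 + \<beta>)) \<longlonglongrightarrow> 1 / (1 + \<beta>)"
proof (rule tendsto_sandwich)
  have ev: "\<forall>\<^sub>F n::nat in sequentially. 1 \<le> n" by (rule eventually_ge_at_top)
  show "\<forall>\<^sub>F n in sequentially. 1 / (1 + \<beta>) \<le> (\<Sum>k=1..n. real k powr \<beta>) / real n powr (1 + \<beta>)"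
    using ev
  proof eventually_elim
    case (elim n)
    then show ?case using sum_powr_lower[OF assms, of n] assms by (simp add: field_simps)
  qed
  show "\<forall>\<^sub>F n in sequentially. (\<Sum>k=1..n. real k powr \<beta>) / real n powr (1 + \<beta>)
      \<le> ((real n + 1) / real n) powr (1 + \<beta>) / (1 + \<beta>)"
    using ev
  proof eventually_elim
    case (elim n)
    have "(\<Sum>k=1..n. real k powr \<beta>) \<le> (real n + 1) powr (1 + \<beta>) / (1 + \<beta>)"
      using sum_powr_upper[OF assms, of n] assms by (simp add: field_simps)
    from divide_right_mono[OF this, of "real n powr (1 + \<beta>)"] show ?case
      using elim by (simp add: powr_divide mult.commute)
  qed
  have "(\<lambda>n. (real n + 1) / real n) \<longlonglongrightarrow> 1" by real_asymp
  then have "(\<lambda>n. ((real n + 1) / real n) powr (1 + \<beta>) / (1 + \<beta>)) \<longlonglongrightarrow> 1 powr (1 + \<beta>) / (1 + \<beta>)"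
    using assms by (intro tendsto_intros) auto
  then show "(\<lambda>n. ((real n + 1) / real n) powr (1 + \<beta>) / (1 + \<beta>)) \<longlonglongrightarrow> 1 / (1 + \<beta>)" by simp
qed simp

lemma cesaro_null:
  fixes d :: "nat \<Rightarrow> real"
  assumes "d \<longlonglongrightarrow> 0"
  shows "(\<lambda>n. (\<Sum>k=1..n. \<bar>d k\<bar>) / real n) \<longlonglongrightarrow> 0"
proof (rule LIMSEQ_I)
  fix e :: real assume "0 < e"
  then obtain N where N: "\<And>k. N \<le> k \<Longrightarrow> \<bar>d k\<bar> < e / 2"
    using LIMSEQ_D[OF assms, of "e / 2"] by auto
  define C where "C = (\<Sum>k=1..N. \<bar>d k\<bar>)"
  obtain m where m: "2 * C / e < real m" using reals_Archimedean2 by blast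
  have "norm ((\<Sum>k=1..n. \<bar>d k\<bar>) / real n - 0) < e" if "n \<ge> max (max N m) 1" for n
  proof -
    have "(\<Sum>k=1..n. \<bar>d k\<bar>) = C + (\<Sum>k\<in>{N<..n}. \<bar>d k\<bar>)"
      unfolding C_def using that by (subst sum.union_disjoint[symmetric]) (auto intro!: sum.cong)
    also have "(\<Sum>k\<in>{N<..n}. \<bar>d k\<bar>) \<le> (\<Sum>k\<in>{N<..n}. e / 2)"
      by (intro sum_mono) (use N in \<open>auto intro: less_imp_le\<close>)
    also have "\<dots> \<le> real n * (e / 2)" using \<open>0 < e\<close> by simp
    finally have "(\<Sum>k=1..n. \<bar>d k\<bar>) \<le> C + real n * (e / 2)" by simp
    moreover have "C < real n * (e / 2)"
    proof -
      have "2 * C / e < real n" using m that by simp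
      then show ?thesis using \<open>0 < e\<close> by (simp add: field_simps)
    qed
    ultimately show ?thesis using that by (simp add: field_simps sum_nonneg)
  qed
  then show "\<exists>no. \<forall>n\<ge>no. norm ((\<Sum>k=1..n. \<bar>d k\<bar>) / real n - 0) < e" by blast
qed

text \<open>All weights are at most \<open>real n powr \<beta>\<close>, so the weighted mean of
  \<open>c k - l\<close> is dominated by the unweighted Cesaro mean of its absolute values; the
  constant part \<open>l\<close> is a pure power sum.\<close>

lemma powr_weighted_cesaro:
  fixes \<beta> :: real
  assumes "0 \<le> \<beta>" "c \<longlonglongrightarrow> l"
  shows "(\<lambda>n. (\<Sum>k=1..n. real k powr \<beta> * c k) / real n powr (1 + \<beta>)) \<longlonglongrightarrow> l / (1 + \<beta>)"
proof -
  have d: "(\<lambda>n. c n - l) \<longlonglongrightarrow> 0" using assms(2) by (simp add: LIM_zero)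
  have "(\<lambda>n. (\<Sum>k=1..n. real k powr \<beta> * (c k - l)) / real n powr (1 + \<beta>)) \<longlonglongrightarrow> 0"
  proof (rule Lim_null_comparison[OF _ cesaro_null[OF d]])
    have "\<forall>\<^sub>F n::nat in sequentially. 1 \<le> n" by (rule eventually_ge_at_top)
    then show "\<forall>\<^sub>F n in sequentially. norm ((\<Sum>k=1..n. real k powr \<beta> * (c k - l)) / real n powr (1 + \<beta>))
        \<le> (\<Sum>k=1..n. \<bar>c k - l\<bar>) / real n"
    proof eventually_elim
      case (elim n)
      have "\<bar>\<Sum>k=1..n. real k powr \<beta> * (c k - l)\<bar> \<le> (\<Sum>k=1..n. \<bar>real k powr \<beta> * (c k - l)\<bar>)"
        by (rule sum_abs)
      also have "\<dots> \<le> (\<Sum>k=1..n. real n powr \<beta> * \<bar>c k - l\<bar>)"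
        unfolding abs_mult by (intro sum_mono mult_right_mono) (use assms in \<open>auto intro: powr_mono2\<close>)
      finally have "\<bar>\<Sum>k=1..n. real k powr \<beta> * (c k - l)\<bar> \<le> real n powr \<beta> * (\<Sum>k=1..n. \<bar>c k - l\<bar>)"
        by (simp add: sum_distrib_left)
      then show ?case using elim by (simp add: powr_add field_simps)
    qed
  qed
  moreover have "(\<lambda>n. l * ((\<Sum>k=1..n. real k powr \<beta>) / real n powr (1 + \<beta>))) \<longlonglongrightarrow> l * (1 / (1 + \<beta>))"
    by (intro tendsto_mult_left sum_powr_asymp assms)
  ultimately have "(\<lambda>n. (\<Sum>k=1..n. real k powr \<beta> * (c k - l)) / real n powr (1 + \<beta>)
      + l * ((\<Sum>k=1..n. real k powr \<beta>) / real n powr (1 + \<beta>))) \<longlonglongrightarrow> 0 + l * (1 / (1 + \<beta>))"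
    by (rule tendsto_add)
  moreover have "(\<Sum>k=1..n. real k powr \<beta> * (c k - l)) / real n powr (1 + \<beta>)
      + l * ((\<Sum>k=1..n. real k powr \<beta>) / real n powr (1 + \<beta>))
      = (\<Sum>k=1..n. real k powr \<beta> * c k) / real n powr (1 + \<beta>)" for n
    by (simp add: sum_subtractf sum_distrib_left algebra_simps flip: add_divide_distrib)
  ultimately show ?thesis by simp
qed

section \<open>Expansions at a point with global error bounds\<close>

text \<open>The bound is required on the whole line, not only near \<open>x\<close>: it is
  integrated against a kernel whose support may be unbounded, and then yields an error rate without
  splitting the integral.\<close>

definition second_order_at :: "(real \<Rightarrow> real) \<Rightarrow> real \<Rightarrow> real \<Rightarrow> real \<Rightarrow> bool" where
  "second_order_at q x a b \<longleftrightarrow> (\<exists>C\<ge>0. \<forall>y. \<bar>q y - a - b * (y - x)\<bar> \<le> C * (y - x)\<^sup>2)"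

definition first_order_at :: "(real \<Rightarrow> real) \<Rightarrow> real \<Rightarrow> real \<Rightarrow> bool" where
  "first_order_at q x a \<longleftrightarrow> (\<exists>C\<ge>0. \<forall>y. \<bar>q y - a\<bar> \<le> C * \<bar>y - x\<bar>)"

lemma bounded_deriv_lipschitz:
  fixes f :: "real \<Rightarrow> real"
  assumes "\<And>x. f differentiable (at x)" "bounded (range (deriv f))"
  shows "\<exists>C\<ge>0. \<forall>x y. \<bar>f y - f x\<bar> \<le> C * \<bar>y - x\<bar>"
proof -
  obtain C where C: "\<And>x. norm (deriv f x) \<le> C"
    using assms(2) by (auto simp: bounded_iff)
  have "norm (f y - f x) \<le> C * norm (y - x)" for x y
    by (rule field_differentiable_bound[OF convex_UNIV, where f' = "deriv f"])
      (use assms(1) C in \<open>auto simp: DERIV_deriv_iff_real_differentiable\<close>)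
  moreover have "0 \<le> C" using C[of 0] norm_ge_zero order_trans by blast
  ultimately show ?thesis by auto
qed

lemma bounded_twice_differentiable_first_order:
  assumes "bounded_twice_differentiable f"
  shows "first_order_at f x (f x)"
  using bounded_deriv_lipschitz[of f] assms
  unfolding bounded_twice_differentiable_def first_order_at_def by blast

text \<open>The derivative is Lipschitz because the second derivative is bounded. On the segment
  from \<open>x\<close> to \<open>y\<close> the function \<open>f z - deriv f x * z\<close>
  therefore has slope at most \<open>C * \<bar>y - x\<bar>\<close>, which gives the quadratic error;
  the sharper constant \<open>C / 2\<close> would bring nothing.\<close>

lemma bounded_twice_differentiable_second_order:
  assumes "bounded_twice_differentiable f"
  shows "second_order_at f x (f x) (deriv f x)"
proof -
  have f: "\<And>x. (f has_real_derivative deriv f x) (at x)"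
    using assms by (auto simp: bounded_twice_differentiable_def DERIV_deriv_iff_real_differentiable)
  obtain C where C: "0 \<le> C" "\<And>x y. \<bar>deriv f y - deriv f x\<bar> \<le> C * \<bar>y - x\<bar>"
    using bounded_deriv_lipschitz[of "deriv f"] assms unfolding bounded_twice_differentiable_def by blast
  have "\<bar>f y - f x - deriv f x * (y - x)\<bar> \<le> C * (y - x)\<^sup>2" for y
  proof -
    have "norm ((f y - deriv f x * y) - (f x - deriv f x * x)) \<le> C * \<bar>y - x\<bar> * norm (y - x)"
    proof (rule field_differentiable_bound[OF convex_closed_segment[of x y],
          where f = "\<lambda>z. f z - deriv f x * z" and f' = "\<lambda>z. deriv f z - deriv f x"])
      fix z assume z: "z \<in> closed_segment x y"
      show "((\<lambda>z. f z - deriv f x * z) has_real_derivative deriv f z - deriv f x)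
          (at z within closed_segment x y)"
        by (rule has_field_derivative_at_within) (auto intro!: derivative_eq_intros f)
      have "\<bar>z - x\<bar> \<le> \<bar>y - x\<bar>" using z by (auto simp: closed_segment_eq_real_ivl split: if_splits)
      then show "norm (deriv f z - deriv f x) \<le> C * \<bar>y - x\<bar>"
        using C(2)[of z x] mult_left_mono[OF _ C(1), of "\<bar>z - x\<bar>" "\<bar>y - x\<bar>"] by simp
    qed auto
    then show ?thesis by (simp add: algebra_simps power2_eq_square flip: abs_mult)
  qed
  with C(1) show ?thesis unfolding second_order_at_def by blast
qed

lemma second_order_at_const: "second_order_at (\<lambda>_. c) x c 0"
  unfolding second_order_at_def by auto

lemma second_order_at_mult:
  assumes f: "second_order_at f x a b" and g: "second_order_at g x a' b'" "first_order_at g x a'"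
    and bdd: "bounded (range g)"
  shows "second_order_at (\<lambda>y. f y * g y) x (a * a') (a * b' + b * a')"
proof -
  obtain C where C: "0 \<le> C" "\<And>y. \<bar>f y - a - b * (y - x)\<bar> \<le> C * (y - x)\<^sup>2"
    using f unfolding second_order_at_def by blast
  obtain C' where C': "0 \<le> C'" "\<And>y. \<bar>g y - a' - b' * (y - x)\<bar> \<le> C' * (y - x)\<^sup>2"
    using g unfolding second_order_at_def by blast
  obtain D where D: "0 \<le> D" "\<And>y. \<bar>g y - a'\<bar> \<le> D * \<bar>y - x\<bar>"
    using g unfolding first_order_at_def by blast
  obtain B where B: "\<And>y. \<bar>g y\<bar> \<le> B" using bdd by (auto simp: bounded_iff)
  have B0: "0 \<le> B" using B[of 0] by linarith
  have "\<bar>f y * g y - a * a' - (a * b' + b * a') * (y - x)\<bar>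
      \<le> (C * B + \<bar>a\<bar> * C' + \<bar>b\<bar> * D) * (y - x)\<^sup>2" for y
  proof -
    \<comment> \<open>In this splitting \<open>f\<close> enters only through its remainder, so
      boundedness is asked of \<open>g\<close> alone. The last term is quadratic because
      \<open>g y - a'\<close> supplies a second factor \<open>y - x\<close>.\<close>
    have "f y * g y - a * a' - (a * b' + b * a') * (y - x)
        = (f y - a - b * (y - x)) * g y + a * (g y - a' - b' * (y - x)) + b * (y - x) * (g y - a')"
      by (simp add: algebra_simps)
    also have "\<bar>\<dots>\<bar> \<le> \<bar>(f y - a - b * (y - x)) * g y\<bar> + \<bar>a * (g y - a' - b' * (y - x))\<bar>
        + \<bar>b * (y - x) * (g y - a')\<bar>" by linarith
    also have "\<dots> \<le> (C * (y - x)\<^sup>2) * B + \<bar>a\<bar> * (C' * (y - x)\<^sup>2) + (\<bar>b\<bar> * \<bar>y - x\<bar>) * (D * \<bar>y - x\<bar>)"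
      unfolding abs_mult by (intro add_mono mult_mono mult_left_mono C B C' D) (use C in auto)
    also have "(\<bar>b\<bar> * \<bar>y - x\<bar>) * (D * \<bar>y - x\<bar>) = \<bar>b\<bar> * D * (y - x)\<^sup>2"
      unfolding power2_abs[of "y - x", symmetric] by (simp add: power2_eq_square)
    also have "(C * (y - x)\<^sup>2) * B + \<bar>a\<bar> * (C' * (y - x)\<^sup>2) + \<bar>b\<bar> * D * (y - x)\<^sup>2
        = (C * B + \<bar>a\<bar> * C' + \<bar>b\<bar> * D) * (y - x)\<^sup>2"
      by (simp add: algebra_simps)
    finally show ?thesis .
  qed
  moreover have "0 \<le> C * B + \<bar>a\<bar> * C' + \<bar>b\<bar> * D" using C C' D B0 by simp
  ultimately show ?thesis unfolding second_order_at_def by blast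
qed

lemma second_order_at_diff:
  assumes "second_order_at f x a b" "second_order_at g x a' b'"
  shows "second_order_at (\<lambda>y. f y - g y) x (a - a') (b - b')"
proof -
  obtain C where C: "0 \<le> C" "\<And>y. \<bar>f y - a - b * (y - x)\<bar> \<le> C * (y - x)\<^sup>2"
    using assms(1) unfolding second_order_at_def by blast
  obtain C' where C': "0 \<le> C'" "\<And>y. \<bar>g y - a' - b' * (y - x)\<bar> \<le> C' * (y - x)\<^sup>2"
    using assms(2) unfolding second_order_at_def by blast
  have "\<bar>f y - g y - (a - a') - (b - b') * (y - x)\<bar> \<le> (C + C') * (y - x)\<^sup>2" for y
    using C(2)[of y] C'(2)[of y] by (simp add: algebra_simps)
  with C C' show ?thesis unfolding second_order_at_def by (intro exI[of _ "C + C'"]) auto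
qed

text \<open>Away from \<open>x\<close> a bounded function satisfies any quadratic bound with a large
  enough constant, so a local identity suffices. This is what makes the cut-off in the third
  estimator harmless for its bias.\<close>

lemma second_order_at_local:
  assumes f: "second_order_at f x a b" and "0 < \<delta>"
    and eq: "\<And>y. \<bar>y - x\<bar> < \<delta> \<Longrightarrow> q y = f y" and bdd: "bounded (range q)"
  shows "second_order_at q x a b"
proof -
  obtain C where C: "0 \<le> C" "\<And>y. \<bar>f y - a - b * (y - x)\<bar> \<le> C * (y - x)\<^sup>2"
    using f unfolding second_order_at_def by blast
  obtain B where B: "\<And>y. \<bar>q y\<bar> \<le> B" using bdd by (auto simp: bounded_iff)
  have B0: "0 \<le> B" using B[of 0] by linarith
  \<comment> \<open>Where \<open>\<bar>y - x\<bar> / \<delta>\<close> is at least 1, constants are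
    multiplied by its square and the linear term by its first power; these are the two parts of
    \<open>D\<close>.\<close>
  define D where "D = (B + \<bar>a\<bar>) / \<delta>\<^sup>2 + \<bar>b\<bar> / \<delta>"
  have D0: "0 \<le> D" unfolding D_def using B0 \<open>0 < \<delta>\<close> by simp
  have "\<bar>q y - a - b * (y - x)\<bar> \<le> (C + D) * (y - x)\<^sup>2" for y
  proof (cases "\<bar>y - x\<bar> < \<delta>")
    case True
    then show ?thesis using eq[OF True] C(2)[of y] D0 by (simp add: algebra_simps add_increasing2)
  next
    case False
    then have d: "1 \<le> \<bar>y - x\<bar> / \<delta>" using \<open>0 < \<delta>\<close> by simp
    have "\<bar>q y - a - b * (y - x)\<bar> \<le> \<bar>q y\<bar> + \<bar>a\<bar> + \<bar>b * (y - x)\<bar>" by linarith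
    also have "\<dots> \<le> (B + \<bar>a\<bar>) * 1 + \<bar>b\<bar> * \<bar>y - x\<bar> * 1"
      using B[of y] by (simp add: abs_mult)
    also have "\<dots> \<le> (B + \<bar>a\<bar>) * (\<bar>y - x\<bar> / \<delta>)\<^sup>2 + \<bar>b\<bar> * \<bar>y - x\<bar> * (\<bar>y - x\<bar> / \<delta>)"
      using d B0 by (intro add_mono mult_left_mono one_le_power) auto
    also have "\<dots> = D * (y - x)\<^sup>2"
      unfolding D_def power_divide power2_abs[of "y - x", symmetric]
      by (simp add: distrib_right power2_eq_square)
    finally show ?thesis using C(1) by (simp add: algebra_simps add_increasing)
  qed
  with C D0 show ?thesis unfolding second_order_at_def by (intro exI[of _ "C + D"]) auto
qed

lemma first_order_at_mult:
  assumes f: "first_order_at f x a" and g: "first_order_at g x a'" and bdd: "bounded (range g)"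
  shows "first_order_at (\<lambda>y. f y * g y) x (a * a')"
proof -
  obtain C where C: "0 \<le> C" "\<And>y. \<bar>f y - a\<bar> \<le> C * \<bar>y - x\<bar>"
    using f unfolding first_order_at_def by blast
  obtain C' where C': "0 \<le> C'" "\<And>y. \<bar>g y - a'\<bar> \<le> C' * \<bar>y - x\<bar>"
    using g unfolding first_order_at_def by blast
  obtain B where B: "\<And>y. \<bar>g y\<bar> \<le> B" using bdd by (auto simp: bounded_iff)
  have B0: "0 \<le> B" using B[of 0] by linarith
  have "\<bar>f y * g y - a * a'\<bar> \<le> (C * B + \<bar>a\<bar> * C') * \<bar>y - x\<bar>" for y
  proof -
    have "f y * g y - a * a' = (f y - a) * g y + a * (g y - a')" by (simp add: algebra_simps)
    moreover have "\<bar>(f y - a) * g y\<bar> \<le> (C * \<bar>y - x\<bar>) * B"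
      unfolding abs_mult by (intro mult_mono C B) (use C in auto)
    moreover have "\<bar>a * (g y - a')\<bar> \<le> \<bar>a\<bar> * (C' * \<bar>y - x\<bar>)"
      unfolding abs_mult by (intro mult_left_mono C') auto
    ultimately show ?thesis by (simp add: algebra_simps)
  qed
  moreover have "0 \<le> C * B + \<bar>a\<bar> * C'" using C C' B0 by simp
  ultimately show ?thesis unfolding first_order_at_def by blast
qed

lemma first_order_at_diff:
  assumes "first_order_at f x a" "first_order_at g x a'"
  shows "first_order_at (\<lambda>y. f y - g y) x (a - a')"
proof -
  obtain C where C: "0 \<le> C" "\<And>y. \<bar>f y - a\<bar> \<le> C * \<bar>y - x\<bar>"
    using assms(1) unfolding first_order_at_def by blast
  obtain C' where C': "0 \<le> C'" "\<And>y. \<bar>g y - a'\<bar> \<le> C' * \<bar>y - x\<bar>"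
    using assms(2) unfolding first_order_at_def by blast
  have "\<bar>f y - g y - (a - a')\<bar> \<le> (C + C') * \<bar>y - x\<bar>" for y
    using C(2)[of y] C'(2)[of y] by (simp add: algebra_simps)
  with C C' show ?thesis unfolding first_order_at_def by (intro exI[of _ "C + C'"]) auto
qed

lemma first_order_at_const: "first_order_at (\<lambda>_. c) x c"
  unfolding first_order_at_def by auto

section \<open>Kernel smoothing with error rates\<close>

lemma integrable_kernel_mult:
  fixes L q :: "real \<Rightarrow> real"
  assumes L: "integrable lborel L" and [measurable]: "q \<in> borel_measurable borel"
    and "\<And>y. \<bar>q y\<bar> \<le> B"
  shows "integrable lborel (\<lambda>u. L u * q (x - h * u))"
proof (rule Bochner_Integration.integrable_bound)
  show "integrable lborel (\<lambda>u. B * L u)" using L by simp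
  have [measurable]: "L \<in> borel_measurable borel" using L by auto
  show "(\<lambda>u. L u * q (x - h * u)) \<in> borel_measurable lborel" by simp
  have "\<bar>L u\<bar> * \<bar>q (x - h * u)\<bar> \<le> \<bar>L u\<bar> * \<bar>B\<bar>" for u
    using assms(3)[of "x - h * u"] by (intro mult_left_mono) auto
  then show "AE u in lborel. norm (L u * q (x - h * u)) \<le> norm (B * L u)"
    by (simp add: abs_mult mult.commute)
qed

text \<open>Since \<open>L\<close> has mass 1, \<open>a\<close> is the integral of
  \<open>a * L u\<close>, and the Lipschitz bound at \<open>x - h * u\<close> produces the factor
  \<open>h * \<bar>u\<bar>\<close>.\<close>

lemma kernel_smoothing_first_order:
  fixes L q :: "real \<Rightarrow> real"
  assumes L: "has_bochner_integral lborel L 1" and uL: "integrable lborel (\<lambda>u. \<bar>u\<bar> * \<bar>L u\<bar>)"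
    and [measurable]: "q \<in> borel_measurable borel" and bdd: "bounded (range q)"
    and q: "first_order_at q x a"
  shows "\<exists>C. \<forall>h>0. \<bar>(\<integral>u. L u * q (x - h * u) \<partial>lborel) - a\<bar> \<le> C * h"
proof -
  obtain C where C: "0 \<le> C" "\<And>y. \<bar>q y - a\<bar> \<le> C * \<bar>y - x\<bar>"
    using q unfolding first_order_at_def by blast
  obtain B where B: "\<And>y. \<bar>q y\<bar> \<le> B" using bdd by (auto simp: bounded_iff)
  have intL: "integrable lborel L" "(\<integral>u. L u \<partial>lborel) = 1"
    using L by (auto simp: has_bochner_integral_iff)
  define J where "J = (\<integral>u. \<bar>u\<bar> * \<bar>L u\<bar> \<partial>lborel)"
  have "\<bar>(\<integral>u. L u * q (x - h * u) \<partial>lborel) - a\<bar> \<le> (C * J) * h" if "0 < h" for h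
  proof -
    note int = integrable_kernel_mult[OF intL(1) \<open>q \<in> _\<close> B, of x h]
    have "(\<integral>u. L u * q (x - h * u) \<partial>lborel) - a = (\<integral>u. L u * q (x - h * u) - a * L u \<partial>lborel)"
      using int intL by (subst Bochner_Integration.integral_diff) auto
    also have "\<bar>\<dots>\<bar> \<le> (\<integral>u. \<bar>L u * q (x - h * u) - a * L u\<bar> \<partial>lborel)"
      by (rule integral_abs_bound)
    also have "\<dots> \<le> (\<integral>u. (C * h) * (\<bar>u\<bar> * \<bar>L u\<bar>) \<partial>lborel)"
    proof (rule integral_mono)
      show "integrable lborel (\<lambda>u. \<bar>L u * q (x - h * u) - a * L u\<bar>)"
        using int intL by (intro integrable_abs Bochner_Integration.integrable_diff) auto
      show "integrable lborel (\<lambda>u. (C * h) * (\<bar>u\<bar> * \<bar>L u\<bar>))" using uL by simp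
      fix u
      have "\<bar>L u * q (x - h * u) - a * L u\<bar> = \<bar>L u\<bar> * \<bar>q (x - h * u) - a\<bar>"
        by (simp add: algebra_simps flip: abs_mult)
      also have "\<dots> \<le> \<bar>L u\<bar> * (C * \<bar>x - h * u - x\<bar>)" by (intro mult_left_mono C) simp
      finally show "\<bar>L u * q (x - h * u) - a * L u\<bar> \<le> (C * h) * (\<bar>u\<bar> * \<bar>L u\<bar>)"
        using that by (simp add: abs_mult mult_ac)
    qed
    also have "\<dots> = (C * J) * h" by (simp add: J_def)
    finally show ?thesis .
  qed
  then show ?thesis by blast
qed

text \<open>Mass 0 removes the constant term of the expansion, and the first moment -1 turns the
  linear term \<open>- b * h * u\<close> into \<open>h * b\<close>. The remainder is of order
  \<open>h^2\<close>, one order better than the main term, which leaves a bias of order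
  \<open>h\<close> after division by \<open>h\<close>.\<close>

lemma kernel_smoothing_second_order:
  fixes L q :: "real \<Rightarrow> real"
  assumes L: "has_bochner_integral lborel L 0" and uL: "has_bochner_integral lborel (\<lambda>u. u * L u) (- 1)"
    and u2L: "integrable lborel (\<lambda>u. u\<^sup>2 * \<bar>L u\<bar>)"
    and [measurable]: "q \<in> borel_measurable borel" and bdd: "bounded (range q)"
    and q: "second_order_at q x a b"
  shows "\<exists>C. \<forall>h>0. \<bar>(\<integral>u. L u * q (x - h * u) \<partial>lborel) - h * b\<bar> \<le> C * h\<^sup>2"
proof -
  obtain C where C: "0 \<le> C" "\<And>y. \<bar>q y - a - b * (y - x)\<bar> \<le> C * (y - x)\<^sup>2"
    using q unfolding second_order_at_def by blast
  obtain B where B: "\<And>y. \<bar>q y\<bar> \<le> B" using bdd by (auto simp: bounded_iff)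
  have intL: "integrable lborel L" "(\<integral>u. L u \<partial>lborel) = 0"
    "integrable lborel (\<lambda>u. u * L u)" "(\<integral>u. u * L u \<partial>lborel) = - 1"
    using L uL by (auto simp: has_bochner_integral_iff)
  define J where "J = (\<integral>u. u\<^sup>2 * \<bar>L u\<bar> \<partial>lborel)"
  have "\<bar>(\<integral>u. L u * q (x - h * u) \<partial>lborel) - h * b\<bar> \<le> (C * J) * h\<^sup>2" if "0 < h" for h
  proof -
    note int = integrable_kernel_mult[OF intL(1) \<open>q \<in> _\<close> B, of x h]
    have lin: "integrable lborel (\<lambda>u. a * L u - (b * h) * (u * L u))"
      by (intro Bochner_Integration.integrable_diff integrable_mult_right intL)
    have "(\<integral>u. a * L u - (b * h) * (u * L u) \<partial>lborel) = h * b"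
      by (subst Bochner_Integration.integral_diff)
        (simp_all only: integrable_mult_right intL integral_mult_right_zero mult_zero_right
          mult_minus_right mult_1_right diff_0 minus_minus mult.commute)
    then have eq: "(\<integral>u. L u * q (x - h * u) \<partial>lborel) - h * b
        = (\<integral>u. L u * q (x - h * u) - (a * L u - (b * h) * (u * L u)) \<partial>lborel)"
      by (subst Bochner_Integration.integral_diff[OF int lin]) simp
    have "\<bar>(\<integral>u. L u * q (x - h * u) \<partial>lborel) - h * b\<bar> \<le> (\<integral>u. \<bar>L u * q (x - h * u) - (a * L u - (b * h) * (u * L u))\<bar> \<partial>lborel)"
      unfolding eq by (rule integral_abs_bound)
    also have "\<dots> \<le> (\<integral>u. (C * h\<^sup>2) * (u\<^sup>2 * \<bar>L u\<bar>) \<partial>lborel)"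
    proof (rule integral_mono)
      show "integrable lborel (\<lambda>u. \<bar>L u * q (x - h * u) - (a * L u - (b * h) * (u * L u))\<bar>)"
        by (rule integrable_abs[OF Bochner_Integration.integrable_diff[OF int lin]])
      show "integrable lborel (\<lambda>u. (C * h\<^sup>2) * (u\<^sup>2 * \<bar>L u\<bar>))"
        by (rule integrable_mult_right) (rule u2L)
      fix u
      have "\<bar>L u * q (x - h * u) - (a * L u - (b * h) * (u * L u))\<bar>
          = \<bar>L u\<bar> * \<bar>q (x - h * u) - a - b * ((x - h * u) - x)\<bar>"
        by (simp add: algebra_simps flip: abs_mult)
      also have "\<dots> \<le> \<bar>L u\<bar> * (C * ((x - h * u) - x)\<^sup>2)" by (intro mult_left_mono C) simp
      finally show "\<bar>L u * q (x - h * u) - (a * L u - (b * h) * (u * L u))\<bar> \<le> (C * h\<^sup>2) * (u\<^sup>2 * \<bar>L u\<bar>)"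
        by (simp add: power_mult_distrib mult_ac)
    qed
    also have "\<dots> = (C * J) * h\<^sup>2" by (simp add: J_def)
    finally show ?thesis .
  qed
  then show ?thesis by blast
qed

text \<open>Variances need a limit but no rate, so continuity at \<open>x\<close> and dominated
  convergence are enough here.\<close>

lemma kernel_smoothing_tendsto:
  fixes L q :: "real \<Rightarrow> real"
  assumes L: "integrable lborel L" and [measurable]: "q \<in> borel_measurable borel"
    and bdd: "bounded (range q)" and q: "isCont q x" and h: "h \<longlonglongrightarrow> 0"
  shows "(\<lambda>n. \<integral>u. L u * q (x - h n * u) \<partial>lborel) \<longlonglongrightarrow> (\<integral>u. L u \<partial>lborel) * q x"
proof -
  obtain B where B: "\<And>y. \<bar>q y\<bar> \<le> B" using bdd by (auto simp: bounded_iff)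
  have [measurable]: "L \<in> borel_measurable borel" using L by auto
  have "(\<lambda>n. \<integral>u. L u * q (x - h n * u) \<partial>lborel) \<longlonglongrightarrow> (\<integral>u. L u * q x \<partial>lborel)"
  proof (rule integral_dominated_convergence)
    show "integrable lborel (\<lambda>u. B * \<bar>L u\<bar>)" using L by simp
    show "AE u in lborel. (\<lambda>n. L u * q (x - h n * u)) \<longlonglongrightarrow> L u * q x"
    proof (rule AE_I2)
      fix u
      have "(\<lambda>n. x - h n * u) \<longlonglongrightarrow> x - 0 * u" by (intro tendsto_intros h)
      then show "(\<lambda>n. L u * q (x - h n * u)) \<longlonglongrightarrow> L u * q x"
        by (intro tendsto_mult_left isCont_tendsto_compose[OF q]) simp
    qed
    show "AE u in lborel. norm (L u * q (x - h n * u)) \<le> B * \<bar>L u\<bar>" for n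
      using mult_left_mono[OF B abs_ge_zero] by (auto simp: abs_mult mult.commute)
  qed simp_all
  then show ?thesis by simp
qed

section \<open>Kernel statistics\<close>

text \<open>Independence is kept in two forms: across the pairs, because each summand is a function
  of one pair, and between the members of a pair, because expectations of products of
  \<open>X\<close> and noise terms have to factor.\<close>

locale kernel_regression = prob_space M for M :: "'a measure" +
  fixes X e :: "nat \<Rightarrow> 'a \<Rightarrow> real" and g :: "real \<Rightarrow> real" and h :: "nat \<Rightarrow> real"
    and \<sigma> \<alpha> x :: real
  assumes X_distributed: "\<And>n. 1 \<le> n \<Longrightarrow> distributed M lborel (X n) (\<lambda>y. ennreal (g y))"
    and g_nonneg: "\<And>y. 0 \<le> g y"
    and g_measurable[measurable]: "g \<in> borel_measurable borel"
    and g_bounded: "bounded (range g)"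
    and pairs_indep: "indep_vars (\<lambda>_. borel \<Otimes>\<^sub>M borel) (\<lambda>n \<omega>. (X n \<omega>, e n \<omega>)) {1..}"
    and e_X_indep: "\<And>n. 1 \<le> n \<Longrightarrow> indep_var borel (e n) borel (X n)"
    and e_distr: "\<And>n. 1 \<le> n \<Longrightarrow> distr M borel (e n) = distr M borel (e 1)"
    and e_square_integrable: "\<And>n. 1 \<le> n \<Longrightarrow> integrable M (\<lambda>\<omega>. (e n \<omega>)\<^sup>2)"
    and e_mean: "\<And>n. 1 \<le> n \<Longrightarrow> expectation (e n) = 0"
    and e_variance: "\<And>n. 1 \<le> n \<Longrightarrow> expectation (\<lambda>\<omega>. (e n \<omega>)\<^sup>2) = \<sigma>\<^sup>2"
    and \<alpha>: "1 / 5 < \<alpha>" "\<alpha> < 1 / 3"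
    and h: "\<And>n. 1 \<le> n \<Longrightarrow> h n = real n powr (- \<alpha>)"
begin

section \<open>Bandwidth, scale and elementary expectations\<close>

lemma X_measurable: "1 \<le> n \<Longrightarrow> X n \<in> borel_measurable M"
  using e_X_indep by (rule indep_var_rv2)

lemma e_measurable: "1 \<le> n \<Longrightarrow> e n \<in> borel_measurable M"
  using e_X_indep by (rule indep_var_rv1)

lemma e_integrable: "1 \<le> n \<Longrightarrow> integrable M (e n)"
  by (rule square_integrable_imp_integrable[OF e_measurable e_square_integrable])

lemma h_pos: "1 \<le> n \<Longrightarrow> 0 < h n"
  by (simp add: h)

lemma h_le_1: "1 \<le> n \<Longrightarrow> h n \<le> 1"
  using \<alpha> powr_mono[of "- \<alpha>" 0 "real n"] by (simp add: h)

lemma h_antimono: "1 \<le> k \<Longrightarrow> k \<le> n \<Longrightarrow> h n \<le> h k"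
  using \<alpha> by (auto simp: h intro!: powr_mono2')

lemma tendsto_powr_neg_nat: "a < 0 \<Longrightarrow> (\<lambda>n. real n powr a) \<longlonglongrightarrow> 0"
  by (rule tendsto_neg_powr[OF _ filterlim_real_sequentially])

lemma eventually_ge_1: "\<forall>\<^sub>F n::nat in sequentially. 1 \<le> n"
  by (rule eventually_ge_at_top)

lemma h_tendsto: "h \<longlonglongrightarrow> 0"
  using \<alpha> tendsto_powr_neg_nat[of "- \<alpha>"]
  by (rule_tac Lim_transform_eventually) (auto intro: eventually_mono[OF eventually_ge_1] simp: h)

definition scale :: "nat \<Rightarrow> real" where
  "scale n = sqrt (real n * h n ^ 3)"

lemma scale_eq: "1 \<le> n \<Longrightarrow> scale n = real n powr ((1 - 3 * \<alpha>) / 2)"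
proof -
  assume n: "1 \<le> n"
  have "real n * h n ^ 3 = real n powr (1 - 3 * \<alpha>)"
    using n by (simp add: h powr_power powr_diff powr_minus field_simps)
  then show ?thesis
    using n by (simp add: scale_def powr_half_sqrt[symmetric] powr_powr)
qed

text \<open>The exponent \<open>(1 - 3 * \<alpha>) / 2\<close> is positive because \<alpha> is below
  1/3.\<close>

lemma scale_tendsto: "filterlim scale at_top sequentially"
proof -
  have "filterlim (\<lambda>n. real n powr ((1 - 3 * \<alpha>) / 2)) at_top sequentially"
    using \<alpha> by real_asymp
  then show ?thesis
    by (rule filterlim_mono_eventually[OF _ order_refl order_refl])
      (auto intro: eventually_mono[OF eventually_ge_1] simp: scale_eq)
qed

lemma scale_nonneg: "0 \<le> scale n"
  by (cases "n = 0") (auto simp: scale_def intro!: mult_nonneg_nonneg less_imp_le[OF h_pos])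

lemma scale_div_square: "1 \<le> n \<Longrightarrow> (scale n / real n)\<^sup>2 = real n powr - (1 + 3 * \<alpha>)"
proof -
  assume n: "1 \<le> n"
  then have "(scale n)\<^sup>2 = real n powr (1 - 3 * \<alpha>)"
    by (simp add: scale_eq power2_eq_square flip: powr_add)
  then have "(scale n / real n)\<^sup>2 = real n powr (1 - 3 * \<alpha>) / (real n powr 2)"
    using n by (simp add: power_divide)
  also have "\<dots> = real n powr - (1 + 3 * \<alpha>)"
    by (simp only: powr_diff[symmetric]) simp
  finally show ?thesis .
qed

text \<open>The exponent \<open>(1 - 5 * \<alpha>) / 2\<close> is negative because \<alpha> exceeds
  1/5. The limit disposes of every bias of order \<open>h k\<close>, and later also of the part of
  the third estimator that lies away from \<open>x\<close>.\<close>

lemma scale_mean_bandwidth_tendsto: "(\<lambda>n. scale n / real n * (\<Sum>k=1..n. h k)) \<longlonglongrightarrow> 0"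
proof (rule tendsto_sandwich[OF always_eventually])
  show "\<forall>n. 0 \<le> scale n / real n * (\<Sum>k=1..n. h k)"
    by (intro allI mult_nonneg_nonneg divide_nonneg_nonneg scale_nonneg sum_nonneg less_imp_le[OF h_pos]) auto
  show "\<forall>\<^sub>F n in sequentially. scale n / real n * (\<Sum>k=1..n. h k)
      \<le> 1 / (1 - \<alpha>) * real n powr ((1 - 5 * \<alpha>) / 2)"
    using eventually_ge_1
  proof eventually_elim
    case (elim n)
    have "(\<Sum>k=1..n. h k) = (\<Sum>k=1..n. real k powr (- \<alpha>))" by (simp add: h)
    also have "\<dots> \<le> real n powr (1 - \<alpha>) / (1 - \<alpha>)"
      using \<alpha> by (intro sum_powr_minus_le) auto
    finally have "scale n / real n * (\<Sum>k=1..n. h k)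
        \<le> scale n / real n * (real n powr (1 - \<alpha>) / (1 - \<alpha>))"
      by (rule mult_left_mono) (simp add: scale_nonneg)
    also have "\<dots> = 1 / (1 - \<alpha>) * (real n powr ((1 - 3 * \<alpha>) / 2) / real n powr 1 * real n powr (1 - \<alpha>))"
      using elim by (simp add: scale_eq mult_ac)
    also have "real n powr ((1 - 3 * \<alpha>) / 2) / real n powr 1 * real n powr (1 - \<alpha>)
        = real n powr ((1 - 5 * \<alpha>) / 2)"
      unfolding powr_diff[symmetric] powr_add[symmetric] by (rule arg_cong) (simp add: field_simps)
    finally show ?case .
  qed
  show "(\<lambda>n. 1 / (1 - \<alpha>) * real n powr ((1 - 5 * \<alpha>) / 2)) \<longlonglongrightarrow> 0"
    using \<alpha> by (intro tendsto_mult_right_zero tendsto_powr_neg_nat) auto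
qed simp

text \<open>Substitution \<open>y = x - h k * u\<close>. The Jacobian \<open>h k\<close> is the
  power of the bandwidth that is regained in first and in second moments.\<close>

lemma expectation_kernel:
  assumes k: "1 \<le> k" and [measurable]: "L \<in> borel_measurable borel" "q \<in> borel_measurable borel"
  shows "expectation (\<lambda>\<omega>. L ((x - X k \<omega>) / h k) * q (X k \<omega>))
    = h k * (\<integral>u. L u * (q (x - h k * u) * g (x - h k * u)) \<partial>lborel)"
proof -
  have hk: "0 < h k" by (rule h_pos[OF k])
  have "expectation (\<lambda>\<omega>. L ((x - X k \<omega>) / h k) * q (X k \<omega>))
      = (\<integral>y. g y * (L ((x - y) / h k) * q y) \<partial>lborel)"
    using g_nonneg by (subst distributed_integral[OF X_distributed[OF k]]) auto
  also have "\<dots> = h k * (\<integral>u. g (x + - h k * u) * (L ((x - (x + - h k * u)) / h k) * q (x + - h k * u)) \<partial>lborel)"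
    using hk by (subst lborel_integral_real_affine[where t = x and c = "- h k"]) auto
  also have "\<dots> = h k * (\<integral>u. L u * (q (x - h k * u) * g (x - h k * u)) \<partial>lborel)"
    using hk by (simp add: mult_ac)
  finally show ?thesis .
qed

lemma expectation_X_times_e:
  fixes q r :: "real \<Rightarrow> real"
  assumes k: "1 \<le> k" and [measurable]: "q \<in> borel_measurable borel" "r \<in> borel_measurable borel"
    and q: "integrable M (\<lambda>\<omega>. q (X k \<omega>))" and r: "integrable M (\<lambda>\<omega>. r (e k \<omega>))"
  shows "integrable M (\<lambda>\<omega>. q (X k \<omega>) * r (e k \<omega>))"
    and "expectation (\<lambda>\<omega>. q (X k \<omega>) * r (e k \<omega>))
      = expectation (\<lambda>\<omega>. q (X k \<omega>)) * expectation (\<lambda>\<omega>. r (e k \<omega>))"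
proof -
  have "indep_var borel (\<lambda>\<omega>. r (e k \<omega>)) borel (\<lambda>\<omega>. q (X k \<omega>))"
    using indep_var_compose[OF e_X_indep[OF k], of r borel q borel] by (simp add: comp_def)
  note indep_var_integrable[OF this r q] indep_var_lebesgue_integral[OF this r q]
  then show "integrable M (\<lambda>\<omega>. q (X k \<omega>) * r (e k \<omega>))"
    "expectation (\<lambda>\<omega>. q (X k \<omega>) * r (e k \<omega>))
      = expectation (\<lambda>\<omega>. q (X k \<omega>)) * expectation (\<lambda>\<omega>. r (e k \<omega>))"
    by (simp_all only: mult.commute)
qed

lemma integrable_bounded_X:
  fixes q :: "real \<Rightarrow> real"
  assumes k: "1 \<le> k" and [measurable]: "q \<in> borel_measurable borel" and q: "\<And>y. \<bar>q y\<bar> \<le> B"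
  shows "integrable M (\<lambda>\<omega>. q (X k \<omega>))"
  using X_measurable[OF k] by (intro integrable_const_bound[where B = B]) (use q in auto)

text \<open>It moves noise expectations to \<open>e 1\<close>, so that a single dominated
  convergence argument serves every summand.\<close>

lemma expectation_e_eq:
  fixes r :: "real \<Rightarrow> real"
  assumes "1 \<le> k" and [measurable]: "r \<in> borel_measurable borel"
  shows "expectation (\<lambda>\<omega>. r (e k \<omega>)) = expectation (\<lambda>\<omega>. r (e 1 \<omega>))"
proof -
  have "expectation (\<lambda>\<omega>. r (e k \<omega>)) = (\<integral>z. r z \<partial>distr M borel (e k))"
    using integral_distr[OF e_measurable[OF assms(1)] assms(2)] by simp
  also have "\<dots> = expectation (\<lambda>\<omega>. r (e 1 \<omega>))"
    unfolding e_distr[OF assms(1)] using integral_distr[OF e_measurable[of 1] assms(2)] by simp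
  finally show ?thesis .
qed

end

section \<open>A general kernel statistic and the moments of its summands\<close>

locale kernel_statistic = kernel_regression +
  fixes L :: "real \<Rightarrow> real" and j :: nat and \<phi> \<psi> :: "real \<Rightarrow> real"
  assumes L_integrable: "integrable lborel L" and L_bounded: "bounded (range L)"
    and \<phi>_measurable[measurable]: "\<phi> \<in> borel_measurable borel" and \<phi>_bounded: "bounded (range \<phi>)"
    and \<psi>_measurable[measurable]: "\<psi> \<in> borel_measurable borel" and \<psi>_bounded: "bounded (range \<psi>)"
begin

lemma L_measurable[measurable]: "L \<in> borel_measurable borel"
  using L_integrable by auto

definition summand :: "nat \<Rightarrow> 'a \<Rightarrow> real" where
  "summand k \<omega> = L ((x - X k \<omega>) / h k) * (\<phi> (X k \<omega>) + \<psi> (X k \<omega>) * e k \<omega>) / h k ^ j"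

definition statistic :: "nat \<Rightarrow> 'a \<Rightarrow> real" where
  "statistic n \<omega> = 1 / real n * (\<Sum>k=1..n. summand k \<omega>)"

text \<open>The conditional second moment of \<open>\<phi> (X k) + \<psi> (X k) * e k\<close> given
  \<open>X k = y\<close>, multiplied by the density of \<open>X k\<close>.\<close>

definition intensity :: "real \<Rightarrow> real" where
  "intensity y = ((\<phi> y)\<^sup>2 + \<sigma>\<^sup>2 * (\<psi> y)\<^sup>2) * g y"

definition smoothed :: "nat \<Rightarrow> real" where
  "smoothed k = (\<integral>u. (L u)\<^sup>2 * intensity (x - h k * u) \<partial>lborel)"

lemma bounds:
  obtains D where "0 \<le> D" "\<And>y. \<bar>L y\<bar> \<le> D" "\<And>y. \<bar>\<phi> y\<bar> \<le> D" "\<And>y. \<bar>\<psi> y\<bar> \<le> D" "\<And>y. \<bar>g y\<bar> \<le> D"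
proof -
  obtain A B C E where *: "\<And>y. \<bar>L y\<bar> \<le> A" "\<And>y. \<bar>\<phi> y\<bar> \<le> B" "\<And>y. \<bar>\<psi> y\<bar> \<le> C" "\<And>y. \<bar>g y\<bar> \<le> E"
    using L_bounded \<phi>_bounded \<psi>_bounded g_bounded by (fastforce simp: bounded_iff)
  show thesis
  proof (rule that[of "\<bar>A\<bar> + \<bar>B\<bar> + \<bar>C\<bar> + \<bar>E\<bar>"])
    show "\<bar>L y\<bar> \<le> \<bar>A\<bar> + \<bar>B\<bar> + \<bar>C\<bar> + \<bar>E\<bar>" for y using *(1)[of y] by linarith
    show "\<bar>\<phi> y\<bar> \<le> \<bar>A\<bar> + \<bar>B\<bar> + \<bar>C\<bar> + \<bar>E\<bar>" for y using *(2)[of y] by linarith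
    show "\<bar>\<psi> y\<bar> \<le> \<bar>A\<bar> + \<bar>B\<bar> + \<bar>C\<bar> + \<bar>E\<bar>" for y using *(3)[of y] by linarith
    show "\<bar>g y\<bar> \<le> \<bar>A\<bar> + \<bar>B\<bar> + \<bar>C\<bar> + \<bar>E\<bar>" for y using *(4)[of y] by linarith
  qed simp
qed

lemma L_square_integrable: "integrable lborel (\<lambda>u. (L u)\<^sup>2)"
proof -
  obtain D where D: "\<And>y. \<bar>L y\<bar> \<le> D" using L_bounded by (auto simp: bounded_iff)
  have "\<bar>L u\<bar> * \<bar>L u\<bar> \<le> \<bar>D\<bar> * \<bar>L u\<bar>" for u using D[of u] by (intro mult_right_mono) auto
  then show ?thesis
    by (intro Bochner_Integration.integrable_bound[OF integrable_mult_right[OF L_integrable, of D]])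
      (auto simp: power2_eq_square abs_mult)
qed

lemma intensity_measurable[measurable]: "intensity \<in> borel_measurable borel"
  unfolding intensity_def[abs_def] by simp

lemma intensity_nonneg: "0 \<le> intensity y"
  unfolding intensity_def using g_nonneg by simp

lemma intensity_bounded: "bounded (range intensity)"
proof -
  obtain D where D: "0 \<le> D" "\<And>y. \<bar>\<phi> y\<bar> \<le> D" "\<And>y. \<bar>\<psi> y\<bar> \<le> D" "\<And>y. \<bar>g y\<bar> \<le> D" using bounds by metis
  have sq: "(\<phi> y)\<^sup>2 \<le> D\<^sup>2" "(\<psi> y)\<^sup>2 \<le> D\<^sup>2" for y
    using D(2,3)[of y] D(1) by (simp_all add: abs_le_square_iff[symmetric])
  have "\<bar>intensity y\<bar> \<le> (D\<^sup>2 + \<sigma>\<^sup>2 * D\<^sup>2) * D" for y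
    unfolding intensity_def abs_mult
    using D sq[of y] by (intro mult_mono) (auto intro!: add_mono mult_left_mono)
  then show ?thesis by (auto simp: bounded_iff intro!: exI)
qed

lemma smoothed_nonneg: "0 \<le> smoothed k"
  unfolding smoothed_def by (rule integral_nonneg_AE) (simp add: intensity_nonneg)

lemma smoothed_bounded: "\<exists>B. \<forall>k. smoothed k \<le> B"
proof -
  obtain B where B: "\<And>y. \<bar>intensity y\<bar> \<le> B" using intensity_bounded by (auto simp: bounded_iff)
  have "smoothed k \<le> (\<integral>u. (L u)\<^sup>2 * B \<partial>lborel)" for k
    unfolding smoothed_def
  proof (rule integral_mono)
    show "integrable lborel (\<lambda>u. (L u)\<^sup>2 * intensity (x - h k * u))"
      by (rule integrable_kernel_mult[OF L_square_integrable _ B]) simp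
    show "integrable lborel (\<lambda>u. (L u)\<^sup>2 * B)" using L_square_integrable by simp
    show "(L u)\<^sup>2 * intensity (x - h k * u) \<le> (L u)\<^sup>2 * B" for u
      using B[of "x - h k * u"] by (intro mult_left_mono) auto
  qed
  then show ?thesis by blast
qed

lemma summand_measurable[measurable]: "1 \<le> k \<Longrightarrow> summand k \<in> borel_measurable M"
proof -
  assume k: "1 \<le> k"
  note X_measurable[OF k, measurable] e_measurable[OF k, measurable]
  show ?thesis unfolding summand_def[abs_def] by simp
qed

lemma statistic_measurable[measurable]: "statistic n \<in> borel_measurable M"
  unfolding statistic_def[abs_def] by (auto intro!: borel_measurable_times borel_measurable_sum)

lemma summand_indep: "indep_vars (\<lambda>_. borel) (\<lambda>k \<omega>. c * summand k \<omega>) {1..n}"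
proof -
  have "indep_vars (\<lambda>_. borel \<Otimes>\<^sub>M borel) (\<lambda>n \<omega>. (X n \<omega>, e n \<omega>)) {1..n}"
    by (rule indep_vars_subset[OF pairs_indep]) auto
  from indep_vars_compose2[OF this, where
      Y = "\<lambda>k p. c * (L ((x - fst p) / h k) * (\<phi> (fst p) + \<psi> (fst p) * snd p) / h k ^ j)" and N = "\<lambda>_. borel"]
  show ?thesis unfolding summand_def by simp
qed

lemma expectation_summand:
  assumes k: "1 \<le> k"
  shows "integrable M (summand k)"
    and "expectation (summand k) = h k * (\<integral>u. L u * (\<phi> (x - h k * u) * g (x - h k * u)) \<partial>lborel) / h k ^ j"
proof -
  note X_measurable[OF k, measurable] e_measurable[OF k, measurable]
  obtain D where D: "0 \<le> D" "\<And>y. \<bar>L y\<bar> \<le> D" "\<And>y. \<bar>\<phi> y\<bar> \<le> D" "\<And>y. \<bar>\<psi> y\<bar> \<le> D" using bounds by metis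
  define A where "A y = L ((x - y) / h k) * \<phi> y" for y
  define B where "B y = L ((x - y) / h k) * \<psi> y" for y
  have A_meas[measurable]: "A \<in> borel_measurable borel" and B_meas[measurable]: "B \<in> borel_measurable borel"
    unfolding A_def[abs_def] B_def[abs_def] by simp_all
  have A: "\<bar>A y\<bar> \<le> D * D" and B: "\<bar>B y\<bar> \<le> D * D" for y
    unfolding A_def B_def abs_mult using D by (auto intro!: mult_mono)
  have id_meas: "(\<lambda>z::real. z) \<in> borel_measurable borel" by simp
  note Be = expectation_X_times_e[OF k B_meas id_meas integrable_bounded_X[OF k B_meas B] e_integrable[OF k]]
  have intA: "integrable M (\<lambda>\<omega>. A (X k \<omega>))"
    by (rule integrable_const_bound[where B = "D * D"]) (use A in auto)
  have eq: "summand k \<omega> = (A (X k \<omega>) + B (X k \<omega>) * e k \<omega>) / h k ^ j" for \<omega>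
    unfolding summand_def A_def B_def by (simp add: algebra_simps)
  have eq': "summand k = (\<lambda>\<omega>. (A (X k \<omega>) + B (X k \<omega>) * e k \<omega>) / h k ^ j)"
    using eq by blast
  have Be1: "integrable M (\<lambda>\<omega>. B (X k \<omega>) * e k \<omega>)" by (rule Be(1))
  have Be2: "expectation (\<lambda>\<omega>. B (X k \<omega>) * e k \<omega>) = 0"
    unfolding Be(2) e_mean[OF k] by simp
  show "integrable M (summand k)"
    unfolding eq' by (intro integrable_divide Bochner_Integration.integrable_add intA Be1)
  have "expectation (summand k) = expectation (\<lambda>\<omega>. A (X k \<omega>)) / h k ^ j"
    unfolding eq' using Bochner_Integration.integral_add[OF intA Be1] Be2 by simp
  also have "expectation (\<lambda>\<omega>. A (X k \<omega>)) = h k * (\<integral>u. L u * (\<phi> (x - h k * u) * g (x - h k * u)) \<partial>lborel)"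
    unfolding A_def by (rule expectation_kernel[OF k]) simp_all
  finally show "expectation (summand k)
      = h k * (\<integral>u. L u * (\<phi> (x - h k * u) * g (x - h k * u)) \<partial>lborel) / h k ^ j" .
qed

lemma expectation_summand_square:
  assumes k: "1 \<le> k"
  shows "integrable M (\<lambda>\<omega>. (summand k \<omega>)\<^sup>2)"
    and "expectation (\<lambda>\<omega>. (summand k \<omega>)\<^sup>2) = h k / (h k ^ j)\<^sup>2 * smoothed k"
proof -
  note X_measurable[OF k, measurable] e_measurable[OF k, measurable]
  obtain D where D: "0 \<le> D" "\<And>y. \<bar>L y\<bar> \<le> D" "\<And>y. \<bar>\<phi> y\<bar> \<le> D" "\<And>y. \<bar>\<psi> y\<bar> \<le> D" using bounds by metis
  define A where "A y = L ((x - y) / h k) * \<phi> y" for y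
  define B where "B y = L ((x - y) / h k) * \<psi> y" for y
  have [measurable]: "A \<in> borel_measurable borel" "B \<in> borel_measurable borel"
    unfolding A_def[abs_def] B_def[abs_def] by simp_all
  have A: "\<bar>A y\<bar> \<le> D * D" and B: "\<bar>B y\<bar> \<le> D * D" for y
    unfolding A_def B_def abs_mult using D by (auto intro!: mult_mono)
  have AA: "\<bar>(A y)\<^sup>2\<bar> \<le> (D * D) * (D * D)" for y
    unfolding power2_eq_square abs_mult by (rule mult_mono[OF A A]) (use D(1) in simp_all)
  have BB: "\<bar>(B y)\<^sup>2\<bar> \<le> (D * D) * (D * D)" for y
    unfolding power2_eq_square abs_mult by (rule mult_mono[OF B B]) (use D(1) in simp_all)
  have AB: "\<bar>2 * (A y * B y)\<bar> \<le> 2 * ((D * D) * (D * D))" for y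
    using mult_mono[OF A B, of y y] D(1) by (simp add: abs_mult)
  have meas: "(\<lambda>z::real. z) \<in> borel_measurable borel" "(\<lambda>z::real. z\<^sup>2) \<in> borel_measurable borel"
    "(\<lambda>y. 2 * (A y * B y)) \<in> borel_measurable borel" "(\<lambda>y. (B y)\<^sup>2) \<in> borel_measurable borel"
    by simp_all
  note ABe = expectation_X_times_e[OF k meas(3) meas(1) integrable_bounded_X[OF k meas(3) AB] e_integrable[OF k]]
  note BBe = expectation_X_times_e[OF k meas(4) meas(2) integrable_bounded_X[OF k meas(4) BB] e_square_integrable[OF k]]
  have i1: "integrable M (\<lambda>\<omega>. (A (X k \<omega>))\<^sup>2)"
    by (rule integrable_const_bound[where B = "(D * D) * (D * D)"]) (use AA in auto)
  have i2: "integrable M (\<lambda>\<omega>. 2 * (A (X k \<omega>) * B (X k \<omega>)) * e k \<omega>)"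
    by (rule ABe(1))
  \<comment> \<open>The noise is centered and independent of \<open>X k\<close>, so the mixed term
    drops out; \<phi> and \<psi> contribute separately to \<open>intensity\<close>.\<close>
  have e2: "expectation (\<lambda>\<omega>. 2 * (A (X k \<omega>) * B (X k \<omega>)) * e k \<omega>) = 0"
    unfolding ABe(2) e_mean[OF k] by simp
  have i3: "integrable M (\<lambda>\<omega>. (B (X k \<omega>))\<^sup>2 * (e k \<omega>)\<^sup>2)"
    by (rule BBe(1))
  have e3: "expectation (\<lambda>\<omega>. (B (X k \<omega>))\<^sup>2 * (e k \<omega>)\<^sup>2) = expectation (\<lambda>\<omega>. (B (X k \<omega>))\<^sup>2) * \<sigma>\<^sup>2"
    unfolding BBe(2) e_variance[OF k] ..
  have i4: "integrable M (\<lambda>\<omega>. (B (X k \<omega>))\<^sup>2)"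
    by (rule integrable_const_bound[where B = "(D * D) * (D * D)"]) (use BB in auto)
  have eq: "(\<lambda>\<omega>. (summand k \<omega>)\<^sup>2) = (\<lambda>\<omega>. ((A (X k \<omega>))\<^sup>2 + (2 * (A (X k \<omega>) * B (X k \<omega>)) * e k \<omega>
      + (B (X k \<omega>))\<^sup>2 * (e k \<omega>)\<^sup>2)) / (h k ^ j)\<^sup>2)"
  proof
    fix \<omega>
    have "summand k \<omega> = (A (X k \<omega>) + B (X k \<omega>) * e k \<omega>) / h k ^ j"
      unfolding summand_def A_def B_def by (simp add: algebra_simps)
    then show "(summand k \<omega>)\<^sup>2 = ((A (X k \<omega>))\<^sup>2 + (2 * (A (X k \<omega>) * B (X k \<omega>)) * e k \<omega>
      + (B (X k \<omega>))\<^sup>2 * (e k \<omega>)\<^sup>2)) / (h k ^ j)\<^sup>2"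
      by (simp add: power_divide power2_sum power_mult_distrib mult_ac)
  qed
  show "integrable M (\<lambda>\<omega>. (summand k \<omega>)\<^sup>2)"
    unfolding eq by (intro integrable_divide Bochner_Integration.integrable_add i1 i2 i3)
  have "expectation (\<lambda>\<omega>. (summand k \<omega>)\<^sup>2)
      = (expectation (\<lambda>\<omega>. (A (X k \<omega>))\<^sup>2) + expectation (\<lambda>\<omega>. (B (X k \<omega>))\<^sup>2) * \<sigma>\<^sup>2) / (h k ^ j)\<^sup>2"
    unfolding eq using Bochner_Integration.integral_add[OF i1 Bochner_Integration.integrable_add[OF i2 i3]]
      Bochner_Integration.integral_add[OF i2 i3] e2 e3 by simp
  also have "expectation (\<lambda>\<omega>. (A (X k \<omega>))\<^sup>2) + expectation (\<lambda>\<omega>. (B (X k \<omega>))\<^sup>2) * \<sigma>\<^sup>2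
      = expectation (\<lambda>\<omega>. (L ((x - X k \<omega>) / h k))\<^sup>2 * ((\<phi> (X k \<omega>))\<^sup>2 + \<sigma>\<^sup>2 * (\<psi> (X k \<omega>))\<^sup>2))"
  proof -
    have "expectation (\<lambda>\<omega>. (A (X k \<omega>))\<^sup>2) + expectation (\<lambda>\<omega>. (B (X k \<omega>))\<^sup>2) * \<sigma>\<^sup>2
        = expectation (\<lambda>\<omega>. (A (X k \<omega>))\<^sup>2 + (B (X k \<omega>))\<^sup>2 * \<sigma>\<^sup>2)"
      using Bochner_Integration.integral_add[OF i1 integrable_mult_left[OF i4, of "\<sigma>\<^sup>2"]] by simp
    then show ?thesis unfolding A_def B_def by (simp add: power_mult_distrib algebra_simps)
  qed
  also have "\<dots> = h k * smoothed k"
    unfolding smoothed_def intensity_def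
    by (rule expectation_kernel[OF k, of "\<lambda>u. (L u)\<^sup>2" "\<lambda>y. (\<phi> y)\<^sup>2 + \<sigma>\<^sup>2 * (\<psi> y)\<^sup>2"]) simp_all
  finally show "expectation (\<lambda>\<omega>. (summand k \<omega>)\<^sup>2) = h k / (h k ^ j)\<^sup>2 * smoothed k" by simp
qed

section \<open>Asymptotics of the scaled statistic\<close>

lemma scaled_statistic:
  "scale n * (statistic n \<omega> - \<tau>) = (\<Sum>k=1..n. scale n / real n * summand k \<omega>) - scale n * \<tau>"
  by (simp add: statistic_def sum_distrib_left right_diff_distrib)

lemma expectation_scaled_statistic_square:
  shows "integrable M (\<lambda>\<omega>. (scale n * (statistic n \<omega> - \<tau>))\<^sup>2)"
    and "expectation (\<lambda>\<omega>. (scale n * (statistic n \<omega> - \<tau>))\<^sup>2)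
      \<le> (\<Sum>k=1..n. expectation (\<lambda>\<omega>. (scale n / real n * summand k \<omega>)\<^sup>2))
        + ((\<Sum>k=1..n. expectation (\<lambda>\<omega>. scale n / real n * summand k \<omega>)) - scale n * \<tau>)\<^sup>2"
proof -
  have "integrable M (\<lambda>\<omega>. (scale n / real n * summand k \<omega>)\<^sup>2)" if "k \<in> {1..n}" for k
    using that expectation_summand_square(1)[of k] by (simp only: power_mult_distrib) simp
  note * = expectation_sum_square_le[OF finite_atLeastAtMost summand_indep this, where b = "scale n * \<tau>"]
  show "integrable M (\<lambda>\<omega>. (scale n * (statistic n \<omega> - \<tau>))\<^sup>2)"
    unfolding scaled_statistic by (rule *)
  show "expectation (\<lambda>\<omega>. (scale n * (statistic n \<omega> - \<tau>))\<^sup>2)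
      \<le> (\<Sum>k=1..n. expectation (\<lambda>\<omega>. (scale n / real n * summand k \<omega>)\<^sup>2))
        + ((\<Sum>k=1..n. expectation (\<lambda>\<omega>. scale n / real n * summand k \<omega>)) - scale n * \<tau>)\<^sup>2"
    unfolding scaled_statistic by (rule *)
qed

lemma bias_tendsto:
  assumes "\<And>k. 1 \<le> k \<Longrightarrow> \<bar>expectation (summand k) - \<tau>\<bar> \<le> C * h k"
  shows "(\<lambda>n. (\<Sum>k=1..n. expectation (\<lambda>\<omega>. scale n / real n * summand k \<omega>)) - scale n * \<tau>) \<longlonglongrightarrow> 0"
proof (rule Lim_null_comparison)
  show "\<forall>\<^sub>F n in sequentially.
      norm ((\<Sum>k=1..n. expectation (\<lambda>\<omega>. scale n / real n * summand k \<omega>)) - scale n * \<tau>)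
        \<le> C * (scale n / real n * (\<Sum>k=1..n. h k))"
    using eventually_ge_1
  proof eventually_elim
    case (elim n)
    have "(\<Sum>k=1..n. expectation (\<lambda>\<omega>. scale n / real n * summand k \<omega>))
        = scale n / real n * (\<Sum>k=1..n. expectation (summand k))"
      by (simp only: integral_mult_right_zero sum_distrib_left)
    then have "(\<Sum>k=1..n. expectation (\<lambda>\<omega>. scale n / real n * summand k \<omega>)) - scale n * \<tau>
        = scale n / real n * (\<Sum>k=1..n. expectation (summand k) - \<tau>)"
      using elim by (simp add: sum_subtractf field_simps)
    then have eq: "norm ((\<Sum>k=1..n. expectation (\<lambda>\<omega>. scale n / real n * summand k \<omega>)) - scale n * \<tau>)
        = scale n / real n * \<bar>\<Sum>k=1..n. expectation (summand k) - \<tau>\<bar>"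
      using scale_nonneg by (simp add: abs_mult)
    have "\<bar>\<Sum>k=1..n. expectation (summand k) - \<tau>\<bar> \<le> (\<Sum>k=1..n. C * h k)"
      by (rule order_trans[OF sum_abs sum_mono]) (use assms in auto)
    then have "scale n / real n * \<bar>\<Sum>k=1..n. expectation (summand k) - \<tau>\<bar>
        \<le> scale n / real n * (\<Sum>k=1..n. C * h k)"
      by (rule mult_left_mono) (simp add: scale_nonneg)
    then show ?case unfolding eq by (simp add: sum_distrib_left[symmetric] mult_ac)
  qed
  show "(\<lambda>n. C * (scale n / real n * (\<Sum>k=1..n. h k))) \<longlonglongrightarrow> 0"
    by (rule tendsto_mult_right_zero[OF scale_mean_bandwidth_tendsto])
qed

lemma expectation_scaled_summand_square:
  assumes k: "1 \<le> k" "k \<le> n"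
  shows "expectation (\<lambda>\<omega>. (scale n / real n * summand k \<omega>)\<^sup>2)
    = real n powr - (1 + 3 * \<alpha>) * (h k / (h k ^ j)\<^sup>2 * smoothed k)"
  using expectation_summand_square(2)[OF k(1)] scale_div_square[of n] k
  by (simp only: power_mult_distrib) simp

text \<open>For \<open>j = 1\<close> the second moments grow only like
  \<open>k powr \<alpha>\<close>, while the normalisation is made for
  \<open>k powr (3 * \<alpha>)\<close>; the total is of order
  \<open>n powr - (2 * \<alpha>)\<close>.\<close>

lemma null_statistic:
  assumes j: "j = 1" and bias: "\<And>k. 1 \<le> k \<Longrightarrow> \<bar>expectation (summand k) - \<tau>\<bar> \<le> C * h k"
  shows "(\<lambda>n. expectation (\<lambda>\<omega>. (scale n * (statistic n \<omega> - \<tau>))\<^sup>2)) \<longlonglongrightarrow> 0"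
proof (rule tendsto_sandwich[OF always_eventually always_eventually])
  show "\<forall>n. 0 \<le> expectation (\<lambda>\<omega>. (scale n * (statistic n \<omega> - \<tau>))\<^sup>2)" by simp
  show "\<forall>n. expectation (\<lambda>\<omega>. (scale n * (statistic n \<omega> - \<tau>))\<^sup>2)
      \<le> (\<Sum>k=1..n. expectation (\<lambda>\<omega>. (scale n / real n * summand k \<omega>)\<^sup>2))
        + ((\<Sum>k=1..n. expectation (\<lambda>\<omega>. scale n / real n * summand k \<omega>)) - scale n * \<tau>)\<^sup>2"
    using expectation_scaled_statistic_square(2) by blast
  obtain B where B: "\<And>k. smoothed k \<le> B" using smoothed_bounded by blast
  have "(\<lambda>n. \<Sum>k=1..n. expectation (\<lambda>\<omega>. (scale n / real n * summand k \<omega>)\<^sup>2)) \<longlonglongrightarrow> 0"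
  proof (rule tendsto_sandwich[OF always_eventually])
    show "\<forall>n. 0 \<le> (\<Sum>k=1..n. expectation (\<lambda>\<omega>. (scale n / real n * summand k \<omega>)\<^sup>2))"
      by (auto intro!: sum_nonneg integral_nonneg_AE)
    show "\<forall>\<^sub>F n in sequentially. (\<Sum>k=1..n. expectation (\<lambda>\<omega>. (scale n / real n * summand k \<omega>)\<^sup>2))
        \<le> B * real n powr - (2 * \<alpha>)"
      using eventually_ge_1
    proof eventually_elim
      case (elim n)
      have "(\<Sum>k=1..n. expectation (\<lambda>\<omega>. (scale n / real n * summand k \<omega>)\<^sup>2))
          \<le> (\<Sum>k=1..n. real n powr - (1 + 3 * \<alpha>) * (real n powr \<alpha> * B))"
      proof (rule sum_mono)
        fix k assume k: "k \<in> {1..n}"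
        then have "h k / (h k ^ j)\<^sup>2 = real k powr \<alpha>"
          unfolding j by (simp add: h power2_eq_square powr_minus field_simps)
        also have "\<dots> \<le> real n powr \<alpha>" using k \<alpha> by (intro powr_mono2) auto
        finally have "h k / (h k ^ j)\<^sup>2 * smoothed k \<le> real n powr \<alpha> * B"
          by (intro mult_mono B smoothed_nonneg) auto
        from mult_left_mono[OF this, of "real n powr - (1 + 3 * \<alpha>)"]
        show "expectation (\<lambda>\<omega>. (scale n / real n * summand k \<omega>)\<^sup>2)
            \<le> real n powr - (1 + 3 * \<alpha>) * (real n powr \<alpha> * B)"
          using expectation_scaled_summand_square[of k n] k by simp
      qed
      also have "\<dots> = B * (real n powr 1 * real n powr - (1 + 3 * \<alpha>) * real n powr \<alpha>)"
        using elim by simp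
      also have "real n powr 1 * real n powr - (1 + 3 * \<alpha>) * real n powr \<alpha> = real n powr - (2 * \<alpha>)"
        unfolding powr_add[symmetric] by (rule arg_cong) simp
      finally show ?case .
    qed
    show "(\<lambda>n. B * real n powr - (2 * \<alpha>)) \<longlonglongrightarrow> 0"
      using \<alpha> by (intro tendsto_mult_right_zero tendsto_powr_neg_nat) auto
  qed simp
  from tendsto_add[OF this tendsto_power[OF bias_tendsto[OF bias], of 2]]
  show "(\<lambda>n. (\<Sum>k=1..n. expectation (\<lambda>\<omega>. (scale n / real n * summand k \<omega>)\<^sup>2))
        + ((\<Sum>k=1..n. expectation (\<lambda>\<omega>. scale n / real n * summand k \<omega>)) - scale n * \<tau>)\<^sup>2) \<longlonglongrightarrow> 0"
    by simp
qed simp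

lemma bandwidth_ratio:
  assumes j: "j = 2" and k: "1 \<le> k"
  shows "h k / (h k ^ j)\<^sup>2 = real k powr (3 * \<alpha>)"
proof -
  have "h k / (h k ^ j)\<^sup>2 = real k powr (- \<alpha>) / real k powr (- (4 * \<alpha>))"
    using k unfolding j by (simp add: h powr_power flip: power_mult)
  then show ?thesis by (simp flip: powr_diff)
qed

lemma variance_tendsto:
  assumes j: "j = 2" and "isCont intensity x"
  shows "(\<lambda>n. \<Sum>k=1..n. expectation (\<lambda>\<omega>. (scale n / real n * summand k \<omega>)\<^sup>2))
    \<longlonglongrightarrow> (\<integral>u. (L u)\<^sup>2 \<partial>lborel) * intensity x / (1 + 3 * \<alpha>)"
proof -
  have "smoothed \<longlonglongrightarrow> (\<integral>u. (L u)\<^sup>2 \<partial>lborel) * intensity x"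
    unfolding smoothed_def
    by (rule kernel_smoothing_tendsto[OF L_square_integrable _ intensity_bounded assms(2) h_tendsto]) simp
  then have "(\<lambda>n. (\<Sum>k=1..n. real k powr (3 * \<alpha>) * smoothed k) / real n powr (1 + 3 * \<alpha>))
      \<longlonglongrightarrow> (\<integral>u. (L u)\<^sup>2 \<partial>lborel) * intensity x / (1 + 3 * \<alpha>)"
    using \<alpha> by (intro powr_weighted_cesaro) auto
  moreover have "(\<Sum>k=1..n. real k powr (3 * \<alpha>) * smoothed k) / real n powr (1 + 3 * \<alpha>)
      = (\<Sum>k=1..n. expectation (\<lambda>\<omega>. (scale n / real n * summand k \<omega>)\<^sup>2))" for n
    unfolding sum_divide_distrib
  proof (rule sum.cong[OF refl])
    fix k assume "k \<in> {1..n}"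
    then have k: "1 \<le> k" "k \<le> n" by auto
    show "real k powr (3 * \<alpha>) * smoothed k / real n powr (1 + 3 * \<alpha>)
        = expectation (\<lambda>\<omega>. (scale n / real n * summand k \<omega>)\<^sup>2)"
      unfolding expectation_scaled_summand_square[OF k] bandwidth_ratio[OF j k(1)] powr_minus_divide
      by simp
  qed
  ultimately show ?thesis by simp
qed

text \<open>Uniform negligibility: up to a bounded factor, no summand carries more than the share
  \<open>1 / n\<close> of the variance.\<close>

lemma scaled_square_le:
  assumes j: "j = 2" and k: "k \<in> {1..n}"
  shows "(scale n / real n)\<^sup>2 * (h k / (h k ^ j)\<^sup>2) \<le> 1 / real n"
proof -
  have "(scale n / real n)\<^sup>2 * (h k / (h k ^ j)\<^sup>2) = real n powr - (1 + 3 * \<alpha>) * real k powr (3 * \<alpha>)"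
    using k scale_div_square[of n] bandwidth_ratio[OF j, of k] by simp
  also have "\<dots> \<le> real n powr - (1 + 3 * \<alpha>) * real n powr (3 * \<alpha>)"
    using k \<alpha> by (intro mult_left_mono powr_mono2) auto
  also have "\<dots> = real n powr - 1" by (simp flip: powr_add)
  also have "\<dots> = 1 / real n" using k by (simp add: powr_minus_divide)
  finally show ?thesis .
qed

lemma variance_square_tendsto:
  assumes j: "j = 2"
  shows "(\<lambda>n. \<Sum>k=1..n. (expectation (\<lambda>\<omega>. (scale n / real n * summand k \<omega>)\<^sup>2))\<^sup>2) \<longlonglongrightarrow> 0"
proof -
  obtain B where B: "\<And>k. smoothed k \<le> B" using smoothed_bounded by blast
  show ?thesis
  proof (rule tendsto_sandwich[OF always_eventually always_eventually])
    show "\<forall>n. 0 \<le> (\<Sum>k=1..n. (expectation (\<lambda>\<omega>. (scale n / real n * summand k \<omega>)\<^sup>2))\<^sup>2)"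
      by (auto intro!: sum_nonneg)
    show "\<forall>n. (\<Sum>k=1..n. (expectation (\<lambda>\<omega>. (scale n / real n * summand k \<omega>)\<^sup>2))\<^sup>2) \<le> B\<^sup>2 / real n"
    proof
      fix n
      have "(\<Sum>k=1..n. (expectation (\<lambda>\<omega>. (scale n / real n * summand k \<omega>)\<^sup>2))\<^sup>2)
          \<le> (\<Sum>k=1..n. (1 / real n * B)\<^sup>2)"
      proof (rule sum_mono)
        fix k assume k: "k \<in> {1..n}"
        have "expectation (\<lambda>\<omega>. (scale n / real n * summand k \<omega>)\<^sup>2)
            = ((scale n / real n)\<^sup>2 * (h k / (h k ^ j)\<^sup>2)) * smoothed k"
          using k expectation_scaled_summand_square[of k n] scale_div_square[of n] by simp
        also have "\<dots> \<le> 1 / real n * B"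
          by (intro mult_mono scaled_square_le[OF j k] B smoothed_nonneg) simp
        finally show "(expectation (\<lambda>\<omega>. (scale n / real n * summand k \<omega>)\<^sup>2))\<^sup>2 \<le> (1 / real n * B)\<^sup>2"
          by (rule power_mono) simp
      qed
      also have "\<dots> = B\<^sup>2 / real n" by (simp add: power2_eq_square)
      finally show "(\<Sum>k=1..n. (expectation (\<lambda>\<omega>. (scale n / real n * summand k \<omega>)\<^sup>2))\<^sup>2) \<le> B\<^sup>2 / real n" .
    qed
    show "(\<lambda>n. B\<^sup>2 / real n) \<longlonglongrightarrow> 0" by real_asymp
  qed simp
qed

text \<open>The means are bounded, since they differ from \<tau> by at most \<open>C * h k\<close>;
  \<open>n\<close> terms with the factor \<open>(scale n / real n)\<^sup>2\<close> leave
  \<open>n powr - (3 * \<alpha>)\<close>.\<close>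

lemma mean_square_tendsto:
  assumes bias: "\<And>k. 1 \<le> k \<Longrightarrow> \<bar>expectation (summand k) - \<tau>\<bar> \<le> C * h k"
  shows "(\<lambda>n. \<Sum>k=1..n. (expectation (\<lambda>\<omega>. scale n / real n * summand k \<omega>))\<^sup>2) \<longlonglongrightarrow> 0"
proof (rule tendsto_sandwich[OF always_eventually])
  have C: "0 \<le> C" using bias[of 1] h_pos[of 1] by (simp add: h)
  define D where "D = \<bar>\<tau>\<bar> + C"
  have D: "\<bar>expectation (summand k)\<bar> \<le> D" if "1 \<le> k" for k
  proof -
    have "C * h k \<le> C" using C h_le_1[OF that] by (simp add: mult_left_le)
    with bias[OF that] show ?thesis unfolding D_def by linarith
  qed
  show "\<forall>n. 0 \<le> (\<Sum>k=1..n. (expectation (\<lambda>\<omega>. scale n / real n * summand k \<omega>))\<^sup>2)"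
    by (auto intro!: sum_nonneg)
  show "\<forall>\<^sub>F n in sequentially. (\<Sum>k=1..n. (expectation (\<lambda>\<omega>. scale n / real n * summand k \<omega>))\<^sup>2)
      \<le> D\<^sup>2 * real n powr - (3 * \<alpha>)"
    using eventually_ge_1
  proof eventually_elim
    case (elim n)
    have "(\<Sum>k=1..n. (expectation (\<lambda>\<omega>. scale n / real n * summand k \<omega>))\<^sup>2)
        \<le> (\<Sum>k=1..n. real n powr - (1 + 3 * \<alpha>) * D\<^sup>2)"
    proof (rule sum_mono)
      fix k assume k: "k \<in> {1..n}"
      have "(expectation (\<lambda>\<omega>. scale n / real n * summand k \<omega>))\<^sup>2
          = real n powr - (1 + 3 * \<alpha>) * (expectation (summand k))\<^sup>2"
        using scale_div_square[OF elim]
        by (simp only: integral_mult_right_zero power_mult_distrib)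
      moreover have "(expectation (summand k))\<^sup>2 \<le> D\<^sup>2"
        using D[of k] k by (simp add: abs_le_square_iff[symmetric])
      ultimately show "(expectation (\<lambda>\<omega>. scale n / real n * summand k \<omega>))\<^sup>2
          \<le> real n powr - (1 + 3 * \<alpha>) * D\<^sup>2"
        by (simp add: mult_left_mono)
    qed
    also have "\<dots> = D\<^sup>2 * (real n powr 1 * real n powr - (1 + 3 * \<alpha>))" by simp
    also have "real n powr 1 * real n powr - (1 + 3 * \<alpha>) = real n powr - (3 * \<alpha>)"
      unfolding powr_add[symmetric] by simp
    finally show ?case .
  qed
  show "(\<lambda>n. D\<^sup>2 * real n powr - (3 * \<alpha>)) \<longlonglongrightarrow> 0"
    using \<alpha> by (intro tendsto_mult_right_zero tendsto_powr_neg_nat) auto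
qed simp

text \<open>For \<open>j = 2\<close> the bound on the second moment converges to the limit variance
  rather than to 0. Boundedness is enough wherever such an error is divided by the scale.\<close>

lemma statistic_L2_bounded:
  assumes "j = 2" "isCont intensity x"
    and bias: "\<And>k. 1 \<le> k \<Longrightarrow> \<bar>expectation (summand k) - \<tau>\<bar> \<le> C * h k"
  shows "\<exists>B. \<forall>n. expectation (\<lambda>\<omega>. (scale n * (statistic n \<omega> - \<tau>))\<^sup>2) \<le> B"
proof -
  define F where "F n = (\<Sum>k=1..n. expectation (\<lambda>\<omega>. (scale n / real n * summand k \<omega>)\<^sup>2))
    + ((\<Sum>k=1..n. expectation (\<lambda>\<omega>. scale n / real n * summand k \<omega>)) - scale n * \<tau>)\<^sup>2" for n
  have "convergent F"
    unfolding F_def[abs_def]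
    by (rule convergentI[OF tendsto_add[OF variance_tendsto[OF assms(1,2)]
          tendsto_power[OF bias_tendsto[OF bias]]]])
  then have "Bseq F" by (rule convergent_imp_Bseq)
  then obtain B where B: "\<And>n. norm (F n) \<le> B" unfolding Bseq_def by blast
  have "expectation (\<lambda>\<omega>. (scale n * (statistic n \<omega> - \<tau>))\<^sup>2) \<le> B" for n
  proof -
    have "expectation (\<lambda>\<omega>. (scale n * (statistic n \<omega> - \<tau>))\<^sup>2) \<le> F n"
      unfolding F_def by (rule expectation_scaled_statistic_square(2))
    also have "F n \<le> B" using B[of n] by (simp only: real_norm_def abs_le_iff)
    finally show ?thesis .
  qed
  then show ?thesis by blast
qed

text \<open>The truncated moment is \<open>y\<^sup>2 * min 6 (\<bar>t\<bar> * y)\<close>. Only the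
  second factor receives the crude uniform bound of \<open>y\<close>; the first keeps the square of
  the kernel, whose expectation supplies the Jacobian \<open>h k\<close>. The majorant is then a
  function of \<open>X k\<close> times a function of \<open>e k\<close>, and its expectation
  factors.\<close>

lemma lindeberg_tendsto:
  assumes j: "j = 2"
  shows "(\<lambda>n. \<Sum>k=1..n. expectation (\<lambda>\<omega>. min (6 * (scale n / real n * summand k \<omega>)\<^sup>2)
    (\<bar>t\<bar> * \<bar>scale n / real n * summand k \<omega>\<bar> ^ 3))) \<longlonglongrightarrow> 0"
proof -
  obtain D where D: "0 \<le> D" "\<And>y. \<bar>L y\<bar> \<le> D" "\<And>y. \<bar>\<phi> y\<bar> \<le> D" "\<And>y. \<bar>\<psi> y\<bar> \<le> D" "\<And>y. \<bar>g y\<bar> \<le> D"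
    using bounds by metis
  \<comment> \<open>The largest normalisation of a summand, with \<open>h n\<close> as the smallest
    bandwidth. Its order is \<open>n powr ((\<alpha> - 1) / 2)\<close>, so it vanishes.\<close>
  define \<eta> where "\<eta> n = scale n / real n / (h n ^ 2) * (D * D)" for n
  define R where "R n z = (1 + \<bar>z\<bar>)\<^sup>2 * min 6 (\<bar>t\<bar> * (\<eta> n * (1 + \<bar>z\<bar>)))" for n z
  define \<rho> where "\<rho> n = expectation (\<lambda>\<omega>. R n (e 1 \<omega>))" for n
  define G where "G = (\<integral>u. (L u)\<^sup>2 * D \<partial>lborel)"
  have R_meas[measurable]: "R n \<in> borel_measurable borel" for n
    unfolding R_def[abs_def] by simp
  have \<eta>_nonneg: "0 \<le> \<eta> n" for n
    unfolding \<eta>_def using D(1) scale_nonneg by simp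
  have \<eta>: "\<eta> \<longlonglongrightarrow> 0"
  proof -
    have "(\<lambda>n. D * D * real n powr ((\<alpha> - 1) / 2)) \<longlonglongrightarrow> 0"
      using \<alpha> by (intro tendsto_mult_right_zero tendsto_powr_neg_nat) auto
    moreover have "\<forall>\<^sub>F n in sequentially. D * D * real n powr ((\<alpha> - 1) / 2) = \<eta> n"
      using eventually_ge_1
    proof eventually_elim
      case (elim n)
      have "\<eta> n = D * D * (real n powr ((1 - 3 * \<alpha>) / 2) / real n powr 1 / real n powr (- (2 * \<alpha>)))"
        unfolding \<eta>_def using elim by (simp add: scale_eq h powr_power)
      also have "real n powr ((1 - 3 * \<alpha>) / 2) / real n powr 1 / real n powr (- (2 * \<alpha>))
          = real n powr ((\<alpha> - 1) / 2)"
        unfolding powr_diff[symmetric] by (rule arg_cong) (simp add: field_simps)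
      finally show ?case by simp
    qed
    ultimately show ?thesis by (rule Lim_transform_eventually)
  qed
  have R_nonneg: "0 \<le> R n z" for n z
    unfolding R_def using \<eta>_nonneg[of n] by simp
  have R_le: "R n z \<le> 6 * (1 + \<bar>z\<bar>)\<^sup>2" for n z
    unfolding R_def mult.commute[of 6] by (rule mult_left_mono) simp_all
  have dom: "integrable M (\<lambda>\<omega>. 6 * (1 + \<bar>e k \<omega>\<bar>)\<^sup>2)" if "1 \<le> k" for k
  proof -
    have "(\<lambda>\<omega>. 6 * (1 + \<bar>e k \<omega>\<bar>)\<^sup>2) = (\<lambda>\<omega>. 6 * (1 + (2 * \<bar>e k \<omega>\<bar> + (e k \<omega>)\<^sup>2)))"
      by (simp add: power2_sum fun_eq_iff)
    then show ?thesis
      using e_integrable[OF that] e_square_integrable[OF that] by simp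
  qed
  have R_int: "integrable M (\<lambda>\<omega>. R n (e k \<omega>))" if "1 \<le> k" for n k
    using e_measurable[OF that] R_nonneg R_le
    by (intro Bochner_Integration.integrable_bound[OF dom[OF that]]) auto
  \<comment> \<open>The cap 6 gives a majorant with finite expectation by the second moment of the
    noise, while the other branch of the minimum tends to 0 pointwise.\<close>
  have "(\<lambda>n. expectation (\<lambda>\<omega>. R n (e 1 \<omega>))) \<longlonglongrightarrow> expectation (\<lambda>\<omega>. 0)"
  proof (rule integral_dominated_convergence)
    show "integrable M (\<lambda>\<omega>. 6 * (1 + \<bar>e 1 \<omega>\<bar>)\<^sup>2)" by (rule dom) simp
    show "AE \<omega> in M. norm (R n (e 1 \<omega>)) \<le> 6 * (1 + \<bar>e 1 \<omega>\<bar>)\<^sup>2" for n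
      using R_nonneg R_le by simp
    have "(\<lambda>n. R n z) \<longlonglongrightarrow> (1 + \<bar>z\<bar>)\<^sup>2 * min 6 (\<bar>t\<bar> * (0 * (1 + \<bar>z\<bar>)))" for z
      unfolding R_def by (intro tendsto_intros \<eta>)
    then show "AE \<omega> in M. (\<lambda>n. R n (e 1 \<omega>)) \<longlonglongrightarrow> 0" by simp
  qed (use e_measurable[of 1] in simp_all)
  then have \<rho>: "\<rho> \<longlonglongrightarrow> 0" by (simp add: \<rho>_def[abs_def])
  have \<rho>_nonneg: "0 \<le> \<rho> n" for n unfolding \<rho>_def using R_nonneg by (simp add: integral_nonneg_AE)
  have term_le: "expectation (\<lambda>\<omega>. min (6 * (scale n / real n * summand k \<omega>)\<^sup>2)
      (\<bar>t\<bar> * \<bar>scale n / real n * summand k \<omega>\<bar> ^ 3)) \<le> 1 / real n * (G * D\<^sup>2 * \<rho> n)"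
    if k: "k \<in> {1..n}" for k n
  proof -
    have k1: "1 \<le> k" and n1: "1 \<le> n" using k by auto
    note X_measurable[OF k1, measurable] e_measurable[OF k1, measurable] summand_measurable[OF k1, measurable]
    define c where "c = scale n / real n"
    have c: "0 \<le> c" unfolding c_def using scale_nonneg by simp
    define Q where "Q y = (L ((x - y) / h k))\<^sup>2" for y
    have Q_meas[measurable]: "Q \<in> borel_measurable borel" unfolding Q_def[abs_def] by simp
    have Q: "\<bar>Q y\<bar> \<le> D\<^sup>2" for y
      unfolding Q_def using D(1,2) by (simp add: abs_le_square_iff[symmetric])
    have hk: "0 < h k" "0 < h n" using h_pos k by auto
    have pointwise: "min (6 * (c * summand k \<omega>)\<^sup>2) (\<bar>t\<bar> * \<bar>c * summand k \<omega>\<bar> ^ 3)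
        \<le> (c\<^sup>2 / (h k ^ 2)\<^sup>2 * D\<^sup>2) * (Q (X k \<omega>) * R n (e k \<omega>))" for \<omega>
    proof -
      define l where "l = \<bar>L ((x - X k \<omega>) / h k)\<bar>"
      define z where "z = 1 + \<bar>e k \<omega>\<bar>"
      define y where "y = \<bar>c * summand k \<omega>\<bar>"
      have z: "0 \<le> z" unfolding z_def by simp
      have "\<bar>\<phi> (X k \<omega>) + \<psi> (X k \<omega>) * e k \<omega>\<bar> \<le> D + D * \<bar>e k \<omega>\<bar>"
        using D(3)[of "X k \<omega>"] mult_right_mono[OF D(4)[of "X k \<omega>"], of "\<bar>e k \<omega>\<bar>"]
        by (auto simp: abs_mult intro: order_trans[OF abs_triangle_ineq])
      then have "\<bar>\<phi> (X k \<omega>) + \<psi> (X k \<omega>) * e k \<omega>\<bar> \<le> D * z" by (simp add: z_def distrib_left)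
      then have "l * \<bar>\<phi> (X k \<omega>) + \<psi> (X k \<omega>) * e k \<omega>\<bar> \<le> l * (D * z)"
        by (rule mult_left_mono) (simp add: l_def)
      then have "c / h k ^ 2 * (l * \<bar>\<phi> (X k \<omega>) + \<psi> (X k \<omega>) * e k \<omega>\<bar>) \<le> c / h k ^ 2 * (l * (D * z))"
        by (rule mult_left_mono) (use c in simp)
      moreover have "y = c / h k ^ 2 * (l * \<bar>\<phi> (X k \<omega>) + \<psi> (X k \<omega>) * e k \<omega>\<bar>)"
        unfolding y_def summand_def l_def using c hk by (simp add: abs_mult j)
      ultimately have y_le: "y \<le> c / h k ^ 2 * (l * (D * z))" by simp
      have "c / h k ^ 2 * (l * (D * z)) \<le> c / h n ^ 2 * (D * (D * z))"
        using c hk D z h_antimono[of k n] k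
        by (intro mult_mono divide_left_mono power_mono) (auto simp: l_def intro!: mult_nonneg_nonneg)
      with y_le have y_le': "y \<le> \<eta> n * z" by (simp add: \<eta>_def c_def mult_ac)
      have y0: "0 \<le> y" unfolding y_def by simp
      have "min (6 * (c * summand k \<omega>)\<^sup>2) (\<bar>t\<bar> * \<bar>c * summand k \<omega>\<bar> ^ 3) = y\<^sup>2 * min 6 (\<bar>t\<bar> * y)"
        unfolding mult_min_right[OF zero_le_power2] by (simp add: y_def eval_nat_numeral mult_ac)
      \<comment> \<open>The two factors are estimated differently: the square with the actual kernel
        value \<open>l\<close> and bandwidth \<open>h k\<close>, the minimum with the uniform bound
        through \<open>\<eta> n\<close>.\<close>
      also have "\<dots> \<le> (c / h k ^ 2 * (l * (D * z)))\<^sup>2 * min 6 (\<bar>t\<bar> * (\<eta> n * z))"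
      proof (rule mult_mono)
        show "y\<^sup>2 \<le> (c / h k ^ 2 * (l * (D * z)))\<^sup>2" using y_le y0 by (rule power_mono)
        show "min 6 (\<bar>t\<bar> * y) \<le> min 6 (\<bar>t\<bar> * (\<eta> n * z))"
          by (intro min.mono mult_left_mono y_le') auto
      qed (use y0 in auto)
      also have "\<dots> = (c\<^sup>2 / (h k ^ 2)\<^sup>2 * D\<^sup>2) * (Q (X k \<omega>) * R n (e k \<omega>))"
        by (simp add: Q_def R_def l_def z_def power_mult_distrib power_divide mult_ac)
      finally show ?thesis .
    qed
    note QR = expectation_X_times_e[OF k1 Q_meas R_meas integrable_bounded_X[OF k1 Q_meas Q] R_int[OF k1]]
    have "expectation (\<lambda>\<omega>. min (6 * (c * summand k \<omega>)\<^sup>2) (\<bar>t\<bar> * \<bar>c * summand k \<omega>\<bar> ^ 3))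
        \<le> expectation (\<lambda>\<omega>. (c\<^sup>2 / (h k ^ 2)\<^sup>2 * D\<^sup>2) * (Q (X k \<omega>) * R n (e k \<omega>)))"
    proof (rule integral_mono[OF _ _ pointwise])
      show int: "integrable M (\<lambda>\<omega>. (c\<^sup>2 / (h k ^ 2)\<^sup>2 * D\<^sup>2) * (Q (X k \<omega>) * R n (e k \<omega>)))"
        by (intro integrable_mult_right QR(1))
      show "integrable M (\<lambda>\<omega>. min (6 * (c * summand k \<omega>)\<^sup>2) (\<bar>t\<bar> * \<bar>c * summand k \<omega>\<bar> ^ 3))"
      proof (rule Bochner_Integration.integrable_bound[OF int])
        show "AE \<omega> in M. norm (min (6 * (c * summand k \<omega>)\<^sup>2) (\<bar>t\<bar> * \<bar>c * summand k \<omega>\<bar> ^ 3))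
            \<le> norm ((c\<^sup>2 / (h k ^ 2)\<^sup>2 * D\<^sup>2) * (Q (X k \<omega>) * R n (e k \<omega>)))"
        proof (rule AE_I2)
          fix \<omega>
          have "0 \<le> min (6 * (c * summand k \<omega>)\<^sup>2) (\<bar>t\<bar> * \<bar>c * summand k \<omega>\<bar> ^ 3)" by simp
          with pointwise[of \<omega>] show "norm (min (6 * (c * summand k \<omega>)\<^sup>2) (\<bar>t\<bar> * \<bar>c * summand k \<omega>\<bar> ^ 3))
            \<le> norm ((c\<^sup>2 / (h k ^ 2)\<^sup>2 * D\<^sup>2) * (Q (X k \<omega>) * R n (e k \<omega>)))"
            unfolding real_norm_def by linarith
        qed
      qed simp
    qed
    also have "\<dots> = c\<^sup>2 / (h k ^ 2)\<^sup>2 * D\<^sup>2 * (expectation (\<lambda>\<omega>. Q (X k \<omega>)) * \<rho> n)"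
      by (simp only: integral_mult_right_zero QR(2) expectation_e_eq[OF k1 R_meas] \<rho>_def)
    also have "\<dots> \<le> c\<^sup>2 / (h k ^ 2)\<^sup>2 * D\<^sup>2 * ((h k * G) * \<rho> n)"
    proof (intro mult_left_mono mult_right_mono \<rho>_nonneg)
      have "expectation (\<lambda>\<omega>. Q (X k \<omega>)) = h k * (\<integral>u. (L u)\<^sup>2 * g (x - h k * u) \<partial>lborel)"
        using expectation_kernel[OF k1, of "\<lambda>u. (L u)\<^sup>2" "\<lambda>_. 1"] by (simp add: Q_def)
      also have "(\<integral>u. (L u)\<^sup>2 * g (x - h k * u) \<partial>lborel) \<le> G"
        unfolding G_def
      proof (rule integral_mono)
        show "integrable lborel (\<lambda>u. (L u)\<^sup>2 * g (x - h k * u))"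
          by (rule integrable_kernel_mult[OF L_square_integrable _ D(5)]) simp
        show "integrable lborel (\<lambda>u. (L u)\<^sup>2 * D)" using L_square_integrable by simp
        show "(L u)\<^sup>2 * g (x - h k * u) \<le> (L u)\<^sup>2 * D" for u
          using D(5)[of "x - h k * u"] by (intro mult_left_mono) auto
      qed
      finally show "expectation (\<lambda>\<omega>. Q (X k \<omega>)) \<le> h k * G" using hk by simp
    qed simp
    also have "\<dots> = (c\<^sup>2 * (h k / (h k ^ j)\<^sup>2)) * (G * D\<^sup>2 * \<rho> n)" by (simp add: j)
    also have "\<dots> \<le> 1 / real n * (G * D\<^sup>2 * \<rho> n)"
    proof (rule mult_right_mono)
      show "c\<^sup>2 * (h k / (h k ^ j)\<^sup>2) \<le> 1 / real n"
        unfolding c_def by (rule scaled_square_le[OF j k])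
      have "0 \<le> G" unfolding G_def using D(1) by (simp add: integral_nonneg_AE)
      then show "0 \<le> G * D\<^sup>2 * \<rho> n" using \<rho>_nonneg by simp
    qed
    finally show ?thesis unfolding c_def .
  qed
  show ?thesis
  proof (rule tendsto_sandwich[OF always_eventually])
    show "\<forall>n. 0 \<le> (\<Sum>k=1..n. expectation (\<lambda>\<omega>. min (6 * (scale n / real n * summand k \<omega>)\<^sup>2)
        (\<bar>t\<bar> * \<bar>scale n / real n * summand k \<omega>\<bar> ^ 3)))"
      by (intro allI sum_nonneg integral_nonneg_AE AE_I2) simp
    show "\<forall>\<^sub>F n in sequentially. (\<Sum>k=1..n. expectation (\<lambda>\<omega>. min (6 * (scale n / real n * summand k \<omega>)\<^sup>2)
        (\<bar>t\<bar> * \<bar>scale n / real n * summand k \<omega>\<bar> ^ 3))) \<le> G * D\<^sup>2 * \<rho> n"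
      using eventually_ge_1
    proof eventually_elim
      case (elim n)
      have "(\<Sum>k=1..n. expectation (\<lambda>\<omega>. min (6 * (scale n / real n * summand k \<omega>)\<^sup>2)
        (\<bar>t\<bar> * \<bar>scale n / real n * summand k \<omega>\<bar> ^ 3))) \<le> (\<Sum>k=1..n. 1 / real n * (G * D\<^sup>2 * \<rho> n))"
        by (rule sum_mono[OF term_le])
      with elim show ?case by simp
    qed
    show "(\<lambda>n. G * D\<^sup>2 * \<rho> n) \<longlonglongrightarrow> 0" by (intro tendsto_mult_right_zero \<rho>)
  qed simp
qed

lemma bounded_\<phi>_g: "bounded (range (\<lambda>y. \<phi> y * g y))"
proof -
  obtain D where D: "0 \<le> D" "\<And>y. \<bar>\<phi> y\<bar> \<le> D" "\<And>y. \<bar>g y\<bar> \<le> D" using bounds by metis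
  have "\<bar>\<phi> y * g y\<bar> \<le> D * D" for y unfolding abs_mult by (intro mult_mono D) simp
  then show ?thesis by (auto simp: bounded_iff intro!: exI)
qed

lemma bias_first_order:
  assumes j: "j = 1" and "has_bochner_integral lborel L 1" "integrable lborel (\<lambda>u. \<bar>u\<bar> * \<bar>L u\<bar>)"
    and "first_order_at (\<lambda>y. \<phi> y * g y) x \<tau>"
  obtains C where "\<And>k. 1 \<le> k \<Longrightarrow> \<bar>expectation (summand k) - \<tau>\<bar> \<le> C * h k"
proof -
  have "(\<lambda>y. \<phi> y * g y) \<in> borel_measurable borel" by simp
  from kernel_smoothing_first_order[OF assms(2,3) this bounded_\<phi>_g assms(4)]
  obtain C where C: "\<And>h. 0 < h \<Longrightarrow> \<bar>(\<integral>u. L u * (\<phi> (x - h * u) * g (x - h * u)) \<partial>lborel) - \<tau>\<bar> \<le> C * h"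
    by blast
  show thesis
  proof (rule that)
    fix k :: nat assume k: "1 \<le> k"
    show "\<bar>expectation (summand k) - \<tau>\<bar> \<le> C * h k"
      unfolding expectation_summand(2)[OF k] using C[OF h_pos[OF k]] h_pos[OF k] by (simp add: j)
  qed
qed

text \<open>Jacobian and normalisation combine to \<open>1 / h k\<close>, which cancels one power of
  the bandwidth in both the main term \<open>h k * \<tau>\<close> and the quadratic error.\<close>

lemma bias_second_order:
  assumes j: "j = 2" and "has_bochner_integral lborel L 0"
    and "has_bochner_integral lborel (\<lambda>u. u * L u) (- 1)" "integrable lborel (\<lambda>u. u\<^sup>2 * \<bar>L u\<bar>)"
    and "second_order_at (\<lambda>y. \<phi> y * g y) x a \<tau>"
  obtains C where "\<And>k. 1 \<le> k \<Longrightarrow> \<bar>expectation (summand k) - \<tau>\<bar> \<le> C * h k"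
proof -
  have "(\<lambda>y. \<phi> y * g y) \<in> borel_measurable borel" by simp
  from kernel_smoothing_second_order[OF assms(2,3,4) this bounded_\<phi>_g assms(5)]
  obtain C where C: "\<And>h. 0 < h \<Longrightarrow>
      \<bar>(\<integral>u. L u * (\<phi> (x - h * u) * g (x - h * u)) \<partial>lborel) - h * \<tau>\<bar> \<le> C * h\<^sup>2"
    by blast
  show thesis
  proof (rule that)
    fix k :: nat assume k: "1 \<le> k"
    define I where "I = (\<integral>u. L u * (\<phi> (x - h k * u) * g (x - h k * u)) \<partial>lborel)"
    have hk: "0 < h k" by (rule h_pos[OF k])
    have "expectation (summand k) - \<tau> = (I - h k * \<tau>) / h k"
      unfolding expectation_summand(2)[OF k] I_def using hk by (simp add: j field_simps power2_eq_square)
    then have "\<bar>expectation (summand k) - \<tau>\<bar> = \<bar>I - h k * \<tau>\<bar> / h k"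
      using hk by simp
    also have "\<dots> \<le> C * (h k)\<^sup>2 / h k"
      using C[OF hk] hk unfolding I_def by (intro divide_right_mono) auto
    also have "\<dots> = C * h k" using hk by (simp add: power2_eq_square)
    finally show "\<bar>expectation (summand k) - \<tau>\<bar> \<le> C * h k" .
  qed
qed

lemma integral_iexp_statistic:
  assumes j: "j = 2" and "isCont intensity x"
    and bias: "\<And>k. 1 \<le> k \<Longrightarrow> \<bar>expectation (summand k) - \<tau>\<bar> \<le> C * h k"
  shows "(\<lambda>n. \<integral>\<omega>. iexp (t * (scale n * (statistic n \<omega> - \<tau>))) \<partial>M)
    \<longlonglongrightarrow> exp (- (t\<^sup>2 * ((\<integral>u. (L u)\<^sup>2 \<partial>lborel) * intensity x / (1 + 3 * \<alpha>))) / 2)"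
  unfolding scaled_statistic
proof (rule integral_iexp_triangular_array)
  show "integrable M (\<lambda>\<omega>. (scale n / real n * summand k \<omega>)\<^sup>2)" if "k \<in> {1..n}" for n k
    using that expectation_summand_square(1)[of k] by (simp only: power_mult_distrib) simp
qed (intro summand_indep bias_tendsto[OF bias] variance_tendsto[OF assms(1,2)] mean_square_tendsto[OF bias]
    variance_square_tendsto[OF j] lindeberg_tendsto[OF j]; assumption)+

end

section \<open>The three estimators\<close>

lemma converges_in_distribution_cong:
  assumes "\<And>n \<omega>. \<omega> \<in> space M \<Longrightarrow> Z n \<omega> = Z' n \<omega>"
  shows "converges_in_distribution M Z L \<longleftrightarrow> converges_in_distribution M Z' L"
  unfolding converges_in_distribution_def
  by (rule arg_cong[where f = "\<lambda>D. weak_conv_m D L"]) (auto intro!: ext distr_cong simp: assms)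

text \<open>The Cauchy-Schwarz inequality, read off from the nonnegative variance of
  \<open>\<bar>R n \<omega>\<bar>\<close>.\<close>

lemma (in prob_space) expectation_abs_tendsto:
  assumes meas: "\<And>n. R n \<in> borel_measurable M" and int: "\<And>n. integrable M (\<lambda>\<omega>. (R n \<omega> :: real)\<^sup>2)"
    and lim: "(\<lambda>n. expectation (\<lambda>\<omega>. (R n \<omega>)\<^sup>2)) \<longlonglongrightarrow> 0"
  shows "(\<lambda>n. expectation (\<lambda>\<omega>. \<bar>R n \<omega>\<bar>)) \<longlonglongrightarrow> 0"
proof (rule tendsto_sandwich[OF always_eventually always_eventually])
  show "\<forall>n. 0 \<le> expectation (\<lambda>\<omega>. \<bar>R n \<omega>\<bar>)" by simp
  show "\<forall>n. expectation (\<lambda>\<omega>. \<bar>R n \<omega>\<bar>) \<le> sqrt (expectation (\<lambda>\<omega>. (R n \<omega>)\<^sup>2))"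
  proof
    fix n
    have i: "integrable M (\<lambda>\<omega>. \<bar>R n \<omega>\<bar>)"
      by (intro integrable_abs square_integrable_imp_integrable[OF meas int])
    have "integrable M (\<lambda>\<omega>. \<bar>R n \<omega>\<bar>\<^sup>2)" using int[of n] by simp
    note variance_eq[OF i this]
    moreover have "0 \<le> variance (\<lambda>\<omega>. \<bar>R n \<omega>\<bar>)" by (rule variance_positive)
    ultimately have "(expectation (\<lambda>\<omega>. \<bar>R n \<omega>\<bar>))\<^sup>2 \<le> expectation (\<lambda>\<omega>. (R n \<omega>)\<^sup>2)" by simp
    then show "expectation (\<lambda>\<omega>. \<bar>R n \<omega>\<bar>) \<le> sqrt (expectation (\<lambda>\<omega>. (R n \<omega>)\<^sup>2))"
      by (rule real_le_rsqrt)
  qed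
  show "(\<lambda>n. sqrt (expectation (\<lambda>\<omega>. (R n \<omega>)\<^sup>2))) \<longlonglongrightarrow> 0"
    using tendsto_real_sqrt[OF lim] by simp
qed simp

text \<open>Any weight below \<open>1 + u ^ 4\<close> is dominated by the moments of orders 0 and 4,
  which yields the first moment of \<open>K\<close> and the second of its derivative.\<close>

lemma integrable_lower_moment:
  fixes L :: "real \<Rightarrow> real"
  assumes L: "integrable lborel L" "integrable lborel (\<lambda>u. u ^ 4 * \<bar>L u\<bar>)"
    and [measurable]: "w \<in> borel_measurable borel" and w: "\<And>u. 0 \<le> w u" "\<And>u. w u \<le> 1 + u ^ 4"
  shows "integrable lborel (\<lambda>u. w u * \<bar>L u\<bar>)"
proof (rule Bochner_Integration.integrable_bound)
  have [measurable]: "L \<in> borel_measurable borel" using L by auto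
  show "integrable lborel (\<lambda>u. \<bar>L u\<bar> + u ^ 4 * \<bar>L u\<bar>)"
    by (intro Bochner_Integration.integrable_add integrable_abs L)
  show "(\<lambda>u. w u * \<bar>L u\<bar>) \<in> borel_measurable lborel" by simp
  have "w u * \<bar>L u\<bar> \<le> (1 + u ^ 4) * \<bar>L u\<bar>" for u by (intro mult_right_mono w) simp
  then show "AE u in lborel. norm (w u * \<bar>L u\<bar>) \<le> norm (\<bar>L u\<bar> + u ^ 4 * \<bar>L u\<bar>)"
    using w(1) by (simp add: distrib_right abs_mult)
qed

lemma
  fixes u :: real
  shows abs_le_1_plus_power4: "\<bar>u\<bar> \<le> 1 + u ^ 4"
    and square_le_1_plus_power4: "u\<^sup>2 \<le> 1 + u ^ 4"
proof -
  have u4: "u ^ 4 = (u\<^sup>2)\<^sup>2" and "0 \<le> u ^ 4" by simp_all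
  have "0 \<le> (u\<^sup>2 - 1)\<^sup>2" by simp
  then have a: "2 * u\<^sup>2 \<le> 1 + u ^ 4" unfolding u4 by (simp add: power2_diff)
  have "0 \<le> (\<bar>u\<bar> - 1)\<^sup>2" by simp
  then have b: "2 * \<bar>u\<bar> \<le> 1 + u\<^sup>2" by (simp add: power2_diff)
  show "u\<^sup>2 \<le> 1 + u ^ 4" using a zero_le_power2[of u] by linarith
  show "\<bar>u\<bar> \<le> 1 + u ^ 4" using a b \<open>0 \<le> u ^ 4\<close> by linarith
qed

locale regression_estimation = kernel_regression +
  fixes f K :: "real \<Rightarrow> real" and Y :: "nat \<Rightarrow> 'a \<Rightarrow> real" and \<xi> :: real
  assumes model: "\<And>n \<omega>. 1 \<le> n \<Longrightarrow> \<omega> \<in> space M \<Longrightarrow> Y n \<omega> = f (X n \<omega>) + e n \<omega>"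
    and f: "bounded_twice_differentiable f" and g: "bounded_twice_differentiable g"
    and gx: "0 < g x"
    and K_bounded: "bounded (range K)" and K'_bounded: "bounded (range (deriv K))"
    and K: "has_bochner_integral lborel K 1" "integrable lborel (\<lambda>u. u ^ 4 * \<bar>K u\<bar>)"
    and K': "has_bochner_integral lborel (deriv K) 0"
      "has_bochner_integral lborel (\<lambda>u. u * deriv K u) (- 1)"
      "integrable lborel (\<lambda>u. u ^ 4 * \<bar>deriv K u\<bar>)"
    and \<xi>: "\<xi>\<^sup>2 = (\<integral>u. (deriv K u)\<^sup>2 \<partial>lborel)"
begin

lemma f_continuous: "continuous_on UNIV f" and g_continuous: "continuous_on UNIV g"
  using f g by (auto simp: bounded_twice_differentiable_def)

lemma f_isCont: "isCont f y" and g_isCont: "isCont g y"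
  using f_continuous g_continuous by (auto simp: continuous_on_eq_continuous_at)

lemma f_measurable[measurable]: "f \<in> borel_measurable borel"
  by (rule borel_measurable_continuous_onI[OF f_continuous])

lemma f_bounded: "bounded (range f)"
  using f by (simp add: bounded_twice_differentiable_def)

lemma f_shift_bounded: "bounded (range (\<lambda>y. f y - c))" "bounded (range (\<lambda>y. c - f y))"
proof -
  obtain B where B: "\<And>y. \<bar>f y\<bar> \<le> B" using f_bounded by (auto simp: bounded_iff)
  have "\<bar>f y - c\<bar> \<le> B + \<bar>c\<bar>" "\<bar>c - f y\<bar> \<le> B + \<bar>c\<bar>" for y using B[of y] by linarith+
  then show "bounded (range (\<lambda>y. f y - c))" "bounded (range (\<lambda>y. c - f y))"
    by (auto simp: bounded_iff intro!: exI)
qed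

lemma K_integrable: "integrable lborel K" and K'_integrable: "integrable lborel (deriv K)"
  using K K' by (auto simp: has_bochner_integral_iff)

lemma K_first_moment: "integrable lborel (\<lambda>u. \<bar>u\<bar> * \<bar>K u\<bar>)"
  by (rule integrable_lower_moment[OF K_integrable K(2)]) (simp_all add: abs_le_1_plus_power4)

lemma K'_second_moment: "integrable lborel (\<lambda>u. u\<^sup>2 * \<bar>deriv K u\<bar>)"
  by (rule integrable_lower_moment[OF K'_integrable K'(3)]) (simp_all add: square_le_1_plus_power4)

lemma kernel_statistic_K:
  assumes "\<phi> \<in> borel_measurable borel" "bounded (range \<phi>)" "\<psi> \<in> borel_measurable borel" "bounded (range \<psi>)"
  shows "kernel_statistic M X e g h \<sigma> \<alpha> K \<phi> \<psi>"
  by unfold_locales (use assms K_integrable K_bounded in auto)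

lemma kernel_statistic_K':
  assumes "\<phi> \<in> borel_measurable borel" "bounded (range \<phi>)" "\<psi> \<in> borel_measurable borel" "bounded (range \<psi>)"
  shows "kernel_statistic M X e g h \<sigma> \<alpha> (deriv K) \<phi> \<psi>"
  by unfold_locales (use assms K'_integrable K'_bounded in auto)

lemma bounded_range_const: "bounded (range (\<lambda>_. c :: real))"
  by (auto simp: bounded_iff)

section \<open>The statistics behind the estimators, their biases and limits\<close>

interpretation B: kernel_statistic M X e g h \<sigma> \<alpha> x K "Suc 0" "\<lambda>_. 1" "\<lambda>_. 0"
  by (intro kernel_statistic_K bounded_range_const) simp_all

text \<open>\<open>C\<close> and the later \<open>A\<close> are the numerator and its derivative
  under the model, with targets \<open>f x * g x\<close> and the derivative of the product
  \<open>f g\<close> at \<open>x\<close>. \<open>E\<close> and \<open>W\<close> are what remains of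
  them after \<open>f\<close> is centred at \<open>x\<close>.\<close>

interpretation C: kernel_statistic M X e g h \<sigma> \<alpha> x K "Suc 0" f "\<lambda>_. 1"
  by (intro kernel_statistic_K f_bounded bounded_range_const) simp_all

interpretation E: kernel_statistic M X e g h \<sigma> \<alpha> x K "Suc 0" "\<lambda>y. f x - f y" "\<lambda>_. - 1"
  by (intro kernel_statistic_K f_shift_bounded bounded_range_const) simp_all

interpretation A: kernel_statistic M X e g h \<sigma> \<alpha> x "deriv K" 2 f "\<lambda>_. 1"
  by (intro kernel_statistic_K' f_bounded bounded_range_const) simp_all

interpretation D: kernel_statistic M X e g h \<sigma> \<alpha> x "deriv K" 2 "\<lambda>_. 1" "\<lambda>_. 0"
  by (intro kernel_statistic_K' bounded_range_const) simp_all

interpretation W: kernel_statistic M X e g h \<sigma> \<alpha> x "deriv K" 2 "\<lambda>y. f y - f x" "\<lambda>_. 1"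
  by (intro kernel_statistic_K' f_shift_bounded bounded_range_const) simp_all

lemma B_null: "(\<lambda>n. expectation (\<lambda>\<omega>. (scale n * (B.statistic n \<omega> - g x))\<^sup>2)) \<longlonglongrightarrow> 0"
proof -
  have "first_order_at (\<lambda>y. 1 * g y) x (g x)"
    using bounded_twice_differentiable_first_order[OF g] by simp
  from B.bias_first_order[OF One_nat_def[symmetric] K(1) K_first_moment this] B.null_statistic[OF One_nat_def[symmetric]]
  show ?thesis by blast
qed

lemma C_null: "(\<lambda>n. expectation (\<lambda>\<omega>. (scale n * (C.statistic n \<omega> - f x * g x))\<^sup>2)) \<longlonglongrightarrow> 0"
proof -
  have "first_order_at (\<lambda>y. f y * g y) x (f x * g x)"
    by (intro first_order_at_mult bounded_twice_differentiable_first_order f g g_bounded)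
  from C.bias_first_order[OF One_nat_def[symmetric] K(1) K_first_moment this] C.null_statistic[OF One_nat_def[symmetric]]
  show ?thesis by blast
qed

lemma E_null: "(\<lambda>n. expectation (\<lambda>\<omega>. (scale n * (E.statistic n \<omega> - 0))\<^sup>2)) \<longlonglongrightarrow> 0"
proof -
  have "first_order_at (\<lambda>y. (f x - f y) * g y) x ((f x - f x) * g x)"
    by (intro first_order_at_mult first_order_at_diff first_order_at_const
        bounded_twice_differentiable_first_order f g g_bounded)
  then have "first_order_at (\<lambda>y. (f x - f y) * g y) x 0" by simp
  from E.bias_first_order[OF One_nat_def[symmetric] K(1) K_first_moment this] E.null_statistic[OF One_nat_def[symmetric]]
  show ?thesis by blast
qed

lemma bias_A:
  obtains c where "\<And>k. 1 \<le> k \<Longrightarrow>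
    \<bar>expectation (A.summand k) - (f x * deriv g x + deriv f x * g x)\<bar> \<le> c * h k"
proof -
  have "second_order_at (\<lambda>y. f y * g y) x (f x * g x) (f x * deriv g x + deriv f x * g x)"
    by (intro second_order_at_mult bounded_twice_differentiable_second_order
        bounded_twice_differentiable_first_order f g g_bounded)
  from A.bias_second_order[OF refl K'(1,2) K'_second_moment this] that show thesis by blast
qed

lemma bias_D:
  obtains c where "\<And>k. 1 \<le> k \<Longrightarrow> \<bar>expectation (D.summand k) - deriv g x\<bar> \<le> c * h k"
proof -
  have "second_order_at (\<lambda>y. 1 * g y) x (g x) (deriv g x)"
    using bounded_twice_differentiable_second_order[OF g] by simp
  from D.bias_second_order[OF refl K'(1,2) K'_second_moment this] that show thesis by blast
qed

lemma bias_W: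
  obtains c where "\<And>k. 1 \<le> k \<Longrightarrow> \<bar>expectation (W.summand k) - deriv f x * g x\<bar> \<le> c * h k"
proof -
  \<comment> \<open>By the product rule \<open>deriv g x\<close> is multiplied by
    \<open>f x - f x\<close>, so the target is \<open>deriv f x * g x\<close> alone.\<close>
  have "second_order_at (\<lambda>y. (f y - f x) * g y) x ((f x - f x) * g x)
      ((f x - f x) * deriv g x + (deriv f x - 0) * g x)"
    by (intro second_order_at_mult second_order_at_diff second_order_at_const
        bounded_twice_differentiable_second_order bounded_twice_differentiable_first_order f g g_bounded)
  then have "second_order_at (\<lambda>y. (f y - f x) * g y) x 0 (deriv f x * g x)" by simp
  from W.bias_second_order[OF refl K'(1,2) K'_second_moment this] that show thesis by blast
qed

lemma intensity_isCont: "isCont A.intensity x" "isCont D.intensity x" "isCont W.intensity x"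
  unfolding A.intensity_def[abs_def] D.intensity_def[abs_def] W.intensity_def[abs_def]
  by (intro continuous_intros f_isCont g_isCont)+

lemma D_bounded: "\<exists>b. \<forall>n. expectation (\<lambda>\<omega>. (scale n * (D.statistic n \<omega> - deriv g x))\<^sup>2) \<le> b"
  using bias_D D.statistic_L2_bounded[OF refl intensity_isCont(2)] by blast

lemma W_bounded: "\<exists>b. \<forall>n. expectation (\<lambda>\<omega>. (scale n * (W.statistic n \<omega> - deriv f x * g x))\<^sup>2) \<le> b"
  using bias_W W.statistic_L2_bounded[OF refl intensity_isCont(3)] by blast

lemma A_limit:
  "(\<lambda>n. \<integral>\<omega>. iexp (t * (scale n * (A.statistic n \<omega> - (f x * deriv g x + deriv f x * g x)))) \<partial>M)
    \<longlonglongrightarrow> exp (- (t\<^sup>2 * (\<xi>\<^sup>2 * A.intensity x / (1 + 3 * \<alpha>))) / 2)"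
proof (rule bias_A)
  fix c assume "\<And>k. 1 \<le> k \<Longrightarrow> \<bar>expectation (A.summand k) - (f x * deriv g x + deriv f x * g x)\<bar> \<le> c * h k"
  then show ?thesis unfolding \<xi> by (rule A.integral_iexp_statistic[OF refl intensity_isCont(1)])
qed

lemma W_limit:
  "(\<lambda>n. \<integral>\<omega>. iexp (t * (scale n * (W.statistic n \<omega> - deriv f x * g x))) \<partial>M)
    \<longlonglongrightarrow> exp (- (t\<^sup>2 * (\<xi>\<^sup>2 * W.intensity x / (1 + 3 * \<alpha>))) / 2)"
proof (rule bias_W)
  fix c assume "\<And>k. 1 \<le> k \<Longrightarrow> \<bar>expectation (W.summand k) - deriv f x * g x\<bar> \<le> c * h k"
  then show ?thesis unfolding \<xi> by (rule W.integral_iexp_statistic[OF refl intensity_isCont(3)])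
qed

lemma g_hat_eq: "g_hat K h (\<lambda>k. X k \<omega>) n x = B.statistic n \<omega>"
  by (simp add: g_hat_def B.statistic_def B.summand_def)

lemma g_hat'_eq: "g_hat' K h (\<lambda>k. X k \<omega>) n x = D.statistic n \<omega>"
  by (simp add: g_hat'_def D.statistic_def D.summand_def)

lemma h_hat_eq: "\<omega> \<in> space M \<Longrightarrow> h_hat K h (\<lambda>k. X k \<omega>) (\<lambda>k. Y k \<omega>) n x = C.statistic n \<omega>"
  by (auto simp add: h_hat_def C.statistic_def C.summand_def model mult.commute)

lemma h_hat'_eq: "\<omega> \<in> space M \<Longrightarrow> h_hat' K h (\<lambda>k. X k \<omega>) (\<lambda>k. Y k \<omega>) n x = A.statistic n \<omega>"
  by (auto simp add: h_hat'_def A.statistic_def A.summand_def model mult.commute)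

text \<open>Together with \<open>C_eq\<close> this drives the cancellation: in
  \<open>A / B - C * D / B\<^sup>2\<close> the terms \<open>f x * D / B\<close> occur with both
  signs, and \<open>W / B + E * D / B\<^sup>2\<close> remains.\<close>

lemma A_eq: "A.statistic n \<omega> = W.statistic n \<omega> + f x * D.statistic n \<omega>"
proof -
  have eq: "A.summand k \<omega> = W.summand k \<omega> + f x * D.summand k \<omega>" for k
    by (simp add: A.summand_def W.summand_def D.summand_def algebra_simps flip: add_divide_distrib)
  show ?thesis
    unfolding A.statistic_def W.statistic_def D.statistic_def eq sum.distrib sum_distrib_left[symmetric]
    by (simp add: algebra_simps)
qed

lemma C_eq: "C.statistic n \<omega> = f x * B.statistic n \<omega> - E.statistic n \<omega>"
proof -
  have eq: "C.summand k \<omega> = f x * B.summand k \<omega> - E.summand k \<omega>" for k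
    by (simp add: C.summand_def B.summand_def E.summand_def algebra_simps flip: diff_divide_distrib)
  show ?thesis
    unfolding C.statistic_def B.statistic_def E.statistic_def eq sum_subtractf sum_distrib_left[symmetric]
    by (simp add: right_diff_distrib)
qed

lemma centered_variance_nonneg: "0 \<le> w \<Longrightarrow> 0 \<le> \<xi>\<^sup>2 / ((1 + 3 * \<alpha>) * g x) * w"
  using \<alpha> gx by simp

section \<open>The estimator with the true density in the denominator\<close>

text \<open>The denominator is deterministic, so the estimator is linear in \<open>A\<close> and
  \<open>C\<close>; the error of \<open>C\<close> is negligible at this scale, and only
  \<open>A\<close> fluctuates. Its summands are not centred at \<open>f x\<close>, hence the square
  of \<open>f x\<close> in the variance.\<close>

lemma f_tilde_converges:
  "converges_in_distribution M
     (\<lambda>n \<omega>. scale n * (f_tilde' g K h (\<lambda>k. X k \<omega>) (\<lambda>k. Y k \<omega>) n x - deriv f x))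
     (centered_normal (\<xi>\<^sup>2 / ((1 + 3 * \<alpha>) * g x) * ((f x)\<^sup>2 + \<sigma>\<^sup>2)))"
proof -
  define Z where "Z n \<omega> = scale n * (A.statistic n \<omega> / g x - C.statistic n \<omega> * deriv g x / (g x)\<^sup>2 - deriv f x)"
    for n \<omega>
  define a where "a = f x * deriv g x + deriv f x * g x"
  define Z0 where "Z0 n \<omega> = scale n * (A.statistic n \<omega> - a) / g x" for n \<omega>
  define U where "U n \<omega> = \<bar>deriv g x\<bar> / (g x)\<^sup>2 * \<bar>scale n * (C.statistic n \<omega> - f x * g x)\<bar>" for n \<omega>
  have "converges_in_distribution M Z (centered_normal (\<xi>\<^sup>2 / ((1 + 3 * \<alpha>) * g x) * ((f x)\<^sup>2 + \<sigma>\<^sup>2)))"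
  proof (rule converges_in_distribution_centered_normalI)
    show meas: "Z n \<in> borel_measurable M" for n unfolding Z_def[abs_def] by simp
    show "0 \<le> \<xi>\<^sup>2 / ((1 + 3 * \<alpha>) * g x) * ((f x)\<^sup>2 + \<sigma>\<^sup>2)" by (rule centered_variance_nonneg) simp
    fix t
    show "(\<lambda>n. \<integral>\<omega>. iexp (t * Z n \<omega>) \<partial>M)
      \<longlonglongrightarrow> exp (- (t\<^sup>2 * (\<xi>\<^sup>2 / ((1 + 3 * \<alpha>) * g x) * ((f x)\<^sup>2 + \<sigma>\<^sup>2))) / 2)"
    proof (rule integral_iexp_tendsto_perturb[where Z = Z0 and U = U and A = "\<lambda>_. {}", OF _ meas])
      show "Z0 n \<in> borel_measurable M" for n unfolding Z0_def[abs_def] by simp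
      show "integrable M (U n)" for n
        unfolding U_def[abs_def]
        by (rule integrable_mult_right[OF integrable_abs[OF square_integrable_imp_integrable[OF
                _ C.expectation_scaled_statistic_square(1)]]]) simp
      show "0 \<le> U n \<omega>" for n \<omega> unfolding U_def by simp
      show "\<forall>\<^sub>F n in sequentially. \<forall>\<omega>\<in>space M - {}. \<bar>Z n \<omega> - Z0 n \<omega>\<bar> \<le> U n \<omega>"
      proof (rule always_eventually, intro allI ballI)
        fix n \<omega>
        \<comment> \<open>The centring \<open>a\<close> satisfies
          \<open>a / g x - f x * deriv g x / g x = deriv f x\<close>, so that only the error of
          \<open>C\<close> is left.\<close>
        have "Z n \<omega> - Z0 n \<omega> = - (deriv g x / (g x)\<^sup>2 * (scale n * (C.statistic n \<omega> - f x * g x)))"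
          unfolding Z_def Z0_def a_def using gx by (simp add: field_simps power2_eq_square)
        then show "\<bar>Z n \<omega> - Z0 n \<omega>\<bar> \<le> U n \<omega>" unfolding U_def by (simp add: abs_mult)
      qed
      show "(\<lambda>n. expectation (U n)) \<longlonglongrightarrow> 0"
        unfolding U_def[abs_def] integral_mult_right_zero
        by (rule tendsto_mult_right_zero[OF expectation_abs_tendsto[OF
                _ C.expectation_scaled_statistic_square(1) C_null]]) simp
      have "t * Z0 n \<omega> = (t / g x) * (scale n * (A.statistic n \<omega> - a))" for n \<omega>
        by (simp add: Z0_def)
      \<comment> \<open>\<open>A.intensity x\<close> contains one factor \<open>g x\<close>; the
        rescaling of \<open>t\<close> divides by its square, which puts \<open>g x\<close> into the
        denominator of the variance.\<close>
      moreover have "(t / g x)\<^sup>2 * (\<xi>\<^sup>2 * A.intensity x / (1 + 3 * \<alpha>))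
          = t\<^sup>2 * (\<xi>\<^sup>2 / ((1 + 3 * \<alpha>) * g x) * ((f x)\<^sup>2 + \<sigma>\<^sup>2))"
        using gx by (simp add: A.intensity_def power_divide power2_eq_square mult_ac)
      ultimately show "(\<lambda>n. \<integral>\<omega>. iexp (t * Z0 n \<omega>) \<partial>M)
          \<longlonglongrightarrow> exp (- (t\<^sup>2 * (\<xi>\<^sup>2 / ((1 + 3 * \<alpha>) * g x) * ((f x)\<^sup>2 + \<sigma>\<^sup>2))) / 2)"
        using A_limit[of "t / g x", folded a_def] by (simp only:)
    qed simp_all
  qed
  moreover have "scale n * (f_tilde' g K h (\<lambda>k. X k \<omega>) (\<lambda>k. Y k \<omega>) n x - deriv f x) = Z n \<omega>"
    if "\<omega> \<in> space M" for n \<omega>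
    using that by (simp add: Z_def f_tilde'_def h_hat_eq h_hat'_eq)
  ultimately show ?thesis by (subst converges_in_distribution_cong) auto
qed

section \<open>The Nadaraya-Watson estimator\<close>

lemma eventually_scale_ge_1: "\<forall>\<^sub>F n in sequentially. 1 \<le> scale n"
  using scale_tendsto by (simp add: filterlim_at_top)

lemma bounded_div_scale_tendsto:
  assumes "\<exists>b. \<forall>n. q n \<le> b" "\<And>n. 0 \<le> (q n :: real)"
  shows "(\<lambda>n. q n / scale n) \<longlonglongrightarrow> 0"
proof -
  obtain b where b: "\<And>n. q n \<le> b" using assms(1) by blast
  have lim: "(\<lambda>n. b / scale n) \<longlonglongrightarrow> 0"
    by (rule tendsto_divide_0[OF tendsto_const filterlim_at_top_imp_at_infinity[OF scale_tendsto]])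
  have "norm (q n / scale n) \<le> b / scale n" for n
    using b[of n] assms(2)[of n] scale_nonneg[of n] by (simp add: divide_right_mono)
  then show ?thesis by (rule Lim_null_comparison[OF always_eventually[OF allI] lim])
qed

text \<open>The deterministic core of the delta method. \<open>w\<close>, \<open>b\<close>,
  \<open>c\<close>, \<open>d\<close> are scaled errors, so every product of two of them keeps a
  factor \<open>1 / s\<close>. Only \<open>b\<close> and \<open>c\<close> also occur linearly, and
  these are the ones that vanish in mean; \<open>w\<close> and \<open>d\<close> need bounded second
  moments only.\<close>

lemma ratio_perturbation:
  fixes g' f' G w b c d s B :: real
  assumes "0 < G" "1 \<le> s" and b: "b = s * (B - G)" and B: "\<bar>B - G\<bar> \<le> G / 2"
  shows "\<bar>(w / B - f' * b / B + c * (g' + d / s) / B\<^sup>2) - w / G\<bar>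
    \<le> 1 / G\<^sup>2 * ((w\<^sup>2 + b\<^sup>2) / s) + 2 * \<bar>f'\<bar> / G * \<bar>b\<bar> + 4 * \<bar>g'\<bar> / G\<^sup>2 * \<bar>c\<bar> + 2 / G\<^sup>2 * ((c\<^sup>2 + d\<^sup>2) / s)"
proof -
  have BG: "G / 2 \<le> B" using B by linarith
  then have B0: "0 < B" using assms(1) by linarith
  have i1: "1 / B \<le> 2 / G" using BG B0 assms(1) by (simp add: field_simps)
  have i2: "1 / B\<^sup>2 \<le> 4 / G\<^sup>2"
    using mult_mono[OF i1 i1] B0 assms(1) by (simp add: power2_eq_square)
  \<comment> \<open>Products become sums of squares, whose expectations are available although the
    factors are dependent.\<close>
  have amgm: "\<bar>p\<bar> * \<bar>q\<bar> \<le> (p\<^sup>2 + q\<^sup>2) / 2" for p q :: real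
  proof -
    have "0 \<le> (\<bar>p\<bar> - \<bar>q\<bar>)\<^sup>2" by simp
    then show ?thesis by (simp add: power2_diff)
  qed
  \<comment> \<open>This is \<open>w * (G - B) / (B * G)\<close> with
    \<open>G - B = - b / s\<close>.\<close>
  have "w / B - w / G = - (w * b) / s / G * (1 / B)"
    unfolding b using assms B0 by (simp add: field_simps)
  then have "\<bar>w / B - w / G\<bar> = \<bar>w\<bar> * \<bar>b\<bar> / s / G * (1 / B)"
    using assms B0 by (simp add: abs_mult)
  also have "\<dots> \<le> ((w\<^sup>2 + b\<^sup>2) / 2) / s / G * (2 / G)"
    using assms B0 i1 by (intro mult_mono divide_right_mono amgm) auto
  also have "\<dots> = 1 / G\<^sup>2 * ((w\<^sup>2 + b\<^sup>2) / s)"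
  proof -
    have "(p / 2) / s / G * (2 / G) = 1 / G\<^sup>2 * (p / s)" for p :: real
      by (simp add: power2_eq_square)
    then show ?thesis .
  qed
  finally have 1: "\<bar>w / B - w / G\<bar> \<le> 1 / G\<^sup>2 * ((w\<^sup>2 + b\<^sup>2) / s)" .
  have "\<bar>f' * b / B\<bar> = \<bar>f'\<bar> * \<bar>b\<bar> * (1 / B)" using B0 by (simp add: abs_mult)
  also have "\<dots> \<le> \<bar>f'\<bar> * \<bar>b\<bar> * (2 / G)" by (intro mult_left_mono i1) simp
  finally have 2: "\<bar>f' * b / B\<bar> \<le> 2 * \<bar>f'\<bar> / G * \<bar>b\<bar>" by (simp add: mult_ac)
  have "\<bar>g' + d / s\<bar> \<le> \<bar>g'\<bar> + \<bar>d\<bar> / s"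
    using assms abs_triangle_ineq[of g' "d / s"] by simp
  then have "\<bar>c\<bar> * \<bar>g' + d / s\<bar> \<le> \<bar>c\<bar> * (\<bar>g'\<bar> + \<bar>d\<bar> / s)" by (rule mult_left_mono) simp
  also have "\<dots> = \<bar>g'\<bar> * \<bar>c\<bar> + (\<bar>c\<bar> * \<bar>d\<bar>) / s" by (simp add: algebra_simps)
  also have "\<dots> \<le> \<bar>g'\<bar> * \<bar>c\<bar> + ((c\<^sup>2 + d\<^sup>2) / 2) / s"
    using assms by (intro add_left_mono divide_right_mono amgm) auto
  finally have "\<bar>c\<bar> * \<bar>g' + d / s\<bar> * (1 / B\<^sup>2) \<le> (\<bar>g'\<bar> * \<bar>c\<bar> + ((c\<^sup>2 + d\<^sup>2) / 2) / s) * (4 / G\<^sup>2)"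
    using assms by (intro mult_mono i2) auto
  also have "\<dots> = 4 * \<bar>g'\<bar> / G\<^sup>2 * \<bar>c\<bar> + 2 / G\<^sup>2 * ((c\<^sup>2 + d\<^sup>2) / s)"
  proof -
    have "(v * z + (p / 2) / s) * (4 / G\<^sup>2) = 4 * v / G\<^sup>2 * z + 2 / G\<^sup>2 * (p / s)" for v z p :: real
      using assms by (simp add: field_simps)
    then show ?thesis .
  qed
  finally have 3: "\<bar>c * (g' + d / s) / B\<^sup>2\<bar>
      \<le> 4 * \<bar>g'\<bar> / G\<^sup>2 * \<bar>c\<bar> + 2 / G\<^sup>2 * ((c\<^sup>2 + d\<^sup>2) / s)"
    by (simp add: abs_mult)
  show ?thesis using 1 2 3 by linarith
qed

lemma f_hat_converges:
  "converges_in_distribution M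
     (\<lambda>n \<omega>. scale n * (f_hat' K h (\<lambda>k. X k \<omega>) (\<lambda>k. Y k \<omega>) n x - deriv f x))
     (centered_normal (\<xi>\<^sup>2 / ((1 + 3 * \<alpha>) * g x) * \<sigma>\<^sup>2))"
proof -
  define Z where "Z n \<omega> = scale n * (A.statistic n \<omega> / B.statistic n \<omega>
    - C.statistic n \<omega> * D.statistic n \<omega> / (B.statistic n \<omega>)\<^sup>2 - deriv f x)" for n \<omega>
  define w where "w n \<omega> = scale n * (W.statistic n \<omega> - deriv f x * g x)" for n \<omega>
  define b where "b n \<omega> = scale n * (B.statistic n \<omega> - g x)" for n \<omega>
  define c where "c n \<omega> = scale n * (E.statistic n \<omega> - 0)" for n \<omega>
  define d where "d n \<omega> = scale n * (D.statistic n \<omega> - deriv g x)" for n \<omega>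
  have meas[measurable]: "w n \<in> borel_measurable M" "b n \<in> borel_measurable M"
    "c n \<in> borel_measurable M" "d n \<in> borel_measurable M" for n
    unfolding w_def[abs_def] b_def[abs_def] c_def[abs_def] d_def[abs_def] by simp_all
  have sq: "integrable M (\<lambda>\<omega>. (w n \<omega>)\<^sup>2)" "integrable M (\<lambda>\<omega>. (b n \<omega>)\<^sup>2)"
    "integrable M (\<lambda>\<omega>. (c n \<omega>)\<^sup>2)" "integrable M (\<lambda>\<omega>. (d n \<omega>)\<^sup>2)" for n
    unfolding w_def b_def c_def d_def
    by (rule W.expectation_scaled_statistic_square(1) B.expectation_scaled_statistic_square(1)
        E.expectation_scaled_statistic_square(1) D.expectation_scaled_statistic_square(1))+
  have int: "integrable M (\<lambda>\<omega>. \<bar>b n \<omega>\<bar>)" "integrable M (\<lambda>\<omega>. \<bar>c n \<omega>\<bar>)" for n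
    by (rule integrable_abs[OF square_integrable_imp_integrable[OF meas(2) sq(2)]]
        integrable_abs[OF square_integrable_imp_integrable[OF meas(3) sq(3)]])+
  define Z0 where "Z0 n \<omega> = w n \<omega> / g x" for n \<omega>
  \<comment> \<open>Outside this event the denominator is at least \<open>g x / 2\<close>, which is
    what the ratio estimate requires.\<close>
  define N where "N n = {\<omega> \<in> space M. g x / 2 < \<bar>B.statistic n \<omega> - g x\<bar>}" for n
  define U where "U n \<omega> = 1 / (g x)\<^sup>2 * (((w n \<omega>)\<^sup>2 + (b n \<omega>)\<^sup>2) / scale n)
    + 2 * \<bar>deriv f x\<bar> / g x * \<bar>b n \<omega>\<bar> + 4 * \<bar>deriv g x\<bar> / (g x)\<^sup>2 * \<bar>c n \<omega>\<bar>
    + 2 / (g x)\<^sup>2 * (((c n \<omega>)\<^sup>2 + (d n \<omega>)\<^sup>2) / scale n)" for n \<omega>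
  have N_events[measurable]: "N n \<in> events" for n unfolding N_def by simp
  have b_lim: "(\<lambda>n. expectation (\<lambda>\<omega>. (b n \<omega>)\<^sup>2)) \<longlonglongrightarrow> 0" unfolding b_def by (rule B_null)
  have c_lim: "(\<lambda>n. expectation (\<lambda>\<omega>. (c n \<omega>)\<^sup>2)) \<longlonglongrightarrow> 0" unfolding c_def by (rule E_null)
  have "converges_in_distribution M Z (centered_normal (\<xi>\<^sup>2 / ((1 + 3 * \<alpha>) * g x) * \<sigma>\<^sup>2))"
  proof (rule converges_in_distribution_centered_normalI)
    show meas_Z: "Z n \<in> borel_measurable M" for n unfolding Z_def[abs_def] by simp
    show "0 \<le> \<xi>\<^sup>2 / ((1 + 3 * \<alpha>) * g x) * \<sigma>\<^sup>2" by (rule centered_variance_nonneg) simp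
    fix t
    show "(\<lambda>n. \<integral>\<omega>. iexp (t * Z n \<omega>) \<partial>M)
      \<longlonglongrightarrow> exp (- (t\<^sup>2 * (\<xi>\<^sup>2 / ((1 + 3 * \<alpha>) * g x) * \<sigma>\<^sup>2)) / 2)"
    proof (rule integral_iexp_tendsto_perturb[where Z = Z0 and U = U and A = N, OF _ meas_Z N_events])
      show "Z0 n \<in> borel_measurable M" for n unfolding Z0_def[abs_def] by simp
      show "integrable M (U n)" for n
        unfolding U_def[abs_def]
        by (intro Bochner_Integration.integrable_add integrable_mult_right integrable_divide sq int)
      show "0 \<le> U n \<omega>" for n \<omega> unfolding U_def using gx scale_nonneg[of n] by simp
      show "\<forall>\<^sub>F n in sequentially. \<forall>\<omega>\<in>space M - N n. \<bar>Z n \<omega> - Z0 n \<omega>\<bar> \<le> U n \<omega>"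
        using eventually_scale_ge_1
      proof eventually_elim
        case (elim n)
        show ?case
        proof
          fix \<omega> assume "\<omega> \<in> space M - N n"
          then have B: "\<bar>B.statistic n \<omega> - g x\<bar> \<le> g x / 2" unfolding N_def by auto
          then have B0: "B.statistic n \<omega> \<noteq> 0" using gx by auto
          \<comment> \<open>After the cancellation, \<open>W = deriv f x * g x + w / scale\<close>
            and the subtracted \<open>deriv f x\<close> leave
            \<open>deriv f x * (g x - B) / B\<close>, the source of the \<open>b\<close> term;
            \<open>D\<close> is written as its target plus \<open>d / scale\<close>.\<close>
          have "Z n \<omega> = w n \<omega> / B.statistic n \<omega> - deriv f x * b n \<omega> / B.statistic n \<omega>
              + c n \<omega> * (deriv g x + d n \<omega> / scale n) / (B.statistic n \<omega>)\<^sup>2"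
            unfolding Z_def A_eq C_eq w_def b_def c_def d_def using B0 elim
            by (simp add: field_simps power2_eq_square)
          then show "\<bar>Z n \<omega> - Z0 n \<omega>\<bar> \<le> U n \<omega>"
            unfolding Z0_def U_def
            using ratio_perturbation[OF gx elim b_def[of n \<omega>] B, of "w n \<omega>" "deriv f x" "c n \<omega>"
                "deriv g x" "d n \<omega>"] by simp
        qed
      qed
      show "(\<lambda>n. prob (N n)) \<longlonglongrightarrow> 0"
      proof (rule tendsto_sandwich[OF always_eventually])
        show "\<forall>n. 0 \<le> prob (N n)" by simp
        show "\<forall>\<^sub>F n in sequentially. prob (N n) \<le> 4 / (g x)\<^sup>2 * expectation (\<lambda>\<omega>. (b n \<omega>)\<^sup>2)"
          using eventually_scale_ge_1
        proof eventually_elim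
          case (elim n)
          \<comment> \<open>Chebyshev's inequality for \<open>b n\<close>; as the scale is at least
            1, the deviation of \<open>B\<close> is at most
            \<open>\<bar>b n \<omega>\<bar>\<close>.\<close>
          have "prob (N n) = expectation (indicator (N n))" by simp
          also have "\<dots> \<le> expectation (\<lambda>\<omega>. 4 / (g x)\<^sup>2 * (b n \<omega>)\<^sup>2)"
          proof (rule integral_mono)
            show "integrable M (indicator (N n) :: 'a \<Rightarrow> real)"
              by (rule integrable_real_indicator) (simp_all add: emeasure_eq_measure)
            show "integrable M (\<lambda>\<omega>. 4 / (g x)\<^sup>2 * (b n \<omega>)\<^sup>2)" by (intro integrable_mult_right sq)
            fix \<omega>
            show "indicator (N n) \<omega> \<le> 4 / (g x)\<^sup>2 * (b n \<omega>)\<^sup>2"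
            proof (cases "\<omega> \<in> N n")
              case True
              then have "g x / 2 \<le> \<bar>B.statistic n \<omega> - g x\<bar>" by (simp add: N_def)
              also have "\<dots> \<le> scale n * \<bar>B.statistic n \<omega> - g x\<bar>"
                using mult_right_mono[OF elim, of "\<bar>B.statistic n \<omega> - g x\<bar>"] by simp
              also have "\<dots> = \<bar>b n \<omega>\<bar>" using elim by (simp add: b_def abs_mult)
              finally have "(g x / 2)\<^sup>2 \<le> \<bar>b n \<omega>\<bar>\<^sup>2" using gx by (intro power_mono) auto
              then show ?thesis using True gx by (simp add: power_divide field_simps)
            qed simp
          qed
          finally show ?case by simp
        qed
        show "(\<lambda>n. 4 / (g x)\<^sup>2 * expectation (\<lambda>\<omega>. (b n \<omega>)\<^sup>2)) \<longlonglongrightarrow> 0"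
          by (rule tendsto_mult_right_zero[OF b_lim])
      qed simp
      show "(\<lambda>n. expectation (U n)) \<longlonglongrightarrow> 0"
      proof -
        have "expectation (U n) = 1 / (g x)\<^sup>2 * (expectation (\<lambda>\<omega>. (w n \<omega>)\<^sup>2) / scale n
            + expectation (\<lambda>\<omega>. (b n \<omega>)\<^sup>2) / scale n)
          + 2 * \<bar>deriv f x\<bar> / g x * expectation (\<lambda>\<omega>. \<bar>b n \<omega>\<bar>)
          + 4 * \<bar>deriv g x\<bar> / (g x)\<^sup>2 * expectation (\<lambda>\<omega>. \<bar>c n \<omega>\<bar>)
          + 2 / (g x)\<^sup>2 * (expectation (\<lambda>\<omega>. (c n \<omega>)\<^sup>2) / scale n
            + expectation (\<lambda>\<omega>. (d n \<omega>)\<^sup>2) / scale n)" for n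
          unfolding U_def[abs_def] using sq[of n] int[of n]
          by (simp add: add_divide_distrib)
        moreover have "(\<lambda>n. 1 / (g x)\<^sup>2 * (expectation (\<lambda>\<omega>. (w n \<omega>)\<^sup>2) / scale n
            + expectation (\<lambda>\<omega>. (b n \<omega>)\<^sup>2) / scale n)
          + 2 * \<bar>deriv f x\<bar> / g x * expectation (\<lambda>\<omega>. \<bar>b n \<omega>\<bar>)
          + 4 * \<bar>deriv g x\<bar> / (g x)\<^sup>2 * expectation (\<lambda>\<omega>. \<bar>c n \<omega>\<bar>)
          + 2 / (g x)\<^sup>2 * (expectation (\<lambda>\<omega>. (c n \<omega>)\<^sup>2) / scale n
            + expectation (\<lambda>\<omega>. (d n \<omega>)\<^sup>2) / scale n)) \<longlonglongrightarrow> 0"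
        \<comment> \<open>The second moments of \<open>w\<close> and \<open>d\<close> are merely
          bounded and vanish after division by the scale; the undivided \<open>b\<close> and
          \<open>c\<close> vanish in \<open>L^1\<close>.\<close>
        proof (intro tendsto_add_zero tendsto_mult_right_zero bounded_div_scale_tendsto)
          show "\<exists>q. \<forall>n. expectation (\<lambda>\<omega>. (w n \<omega>)\<^sup>2) \<le> q" unfolding w_def by (rule W_bounded)
          show "\<exists>q. \<forall>n. expectation (\<lambda>\<omega>. (d n \<omega>)\<^sup>2) \<le> q" unfolding d_def by (rule D_bounded)
          show "\<exists>q. \<forall>n. expectation (\<lambda>\<omega>. (b n \<omega>)\<^sup>2) \<le> q"
            using convergent_imp_Bseq[OF convergentI[OF b_lim]] unfolding Bseq_def
            by (auto simp: abs_le_iff)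
          show "\<exists>q. \<forall>n. expectation (\<lambda>\<omega>. (c n \<omega>)\<^sup>2) \<le> q"
            using convergent_imp_Bseq[OF convergentI[OF c_lim]] unfolding Bseq_def
            by (auto simp: abs_le_iff)
          show "(\<lambda>n. expectation (\<lambda>\<omega>. \<bar>b n \<omega>\<bar>)) \<longlonglongrightarrow> 0"
            by (rule expectation_abs_tendsto[OF meas(2) sq(2) b_lim])
          show "(\<lambda>n. expectation (\<lambda>\<omega>. \<bar>c n \<omega>\<bar>)) \<longlonglongrightarrow> 0"
            by (rule expectation_abs_tendsto[OF meas(3) sq(3) c_lim])
        qed (auto intro: integral_nonneg_AE)
        ultimately show ?thesis by (simp only:)
      qed
      have "t * Z0 n \<omega> = (t / g x) * (scale n * (W.statistic n \<omega> - deriv f x * g x))" for n \<omega>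
        by (simp add: Z0_def w_def)
      \<comment> \<open>In \<open>W.intensity x\<close> the square of \<open>f x - f x\<close> is 0
        and only the noise part \<open>\<sigma>\<^sup>2 * g x\<close> survives.\<close>
      moreover have "(t / g x)\<^sup>2 * (\<xi>\<^sup>2 * W.intensity x / (1 + 3 * \<alpha>))
          = t\<^sup>2 * (\<xi>\<^sup>2 / ((1 + 3 * \<alpha>) * g x) * \<sigma>\<^sup>2)"
        using gx by (simp add: W.intensity_def power_divide power2_eq_square mult_ac)
      ultimately show "(\<lambda>n. \<integral>\<omega>. iexp (t * Z0 n \<omega>) \<partial>M)
          \<longlonglongrightarrow> exp (- (t\<^sup>2 * (\<xi>\<^sup>2 / ((1 + 3 * \<alpha>) * g x) * \<sigma>\<^sup>2)) / 2)"
        using W_limit[of "t / g x"] by (simp only:)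
    qed
  qed
  moreover have "scale n * (f_hat' K h (\<lambda>k. X k \<omega>) (\<lambda>k. Y k \<omega>) n x - deriv f x) = Z n \<omega>"
    if "\<omega> \<in> space M" for n \<omega>
    using that by (simp add: Z_def f_hat'_def h_hat_eq h_hat'_eq g_hat_eq g_hat'_eq)
  ultimately show ?thesis by (subst converges_in_distribution_cong) auto
qed

section \<open>The estimator with the density at the observations in the denominator\<close>

text \<open>Under the expectation the density cancels the denominator \<open>g y\<close>, so no
  lower bound on \<open>g\<close> is needed. Off the neighbourhood
  \<open>((y - x) / \<delta>)\<^sup>2\<close> is at least 1, and the second moment of the kernel
  gives two powers of \<open>h k\<close> besides the Jacobian. Divided by \<open>h k ^ 2\<close> the
  tail is again of order \<open>h k\<close>.\<close>

lemma kernel_tail_bound: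
  assumes k: "1 \<le> k" and \<delta>: "0 < \<delta>"
  defines "Q \<equiv> \<lambda>y. \<bar>deriv K ((x - y) / h k)\<bar> * (if \<bar>y - x\<bar> < \<delta> then 0 else 1) / g y"
  shows "integrable M (\<lambda>\<omega>. Q (X k \<omega>))"
    and "expectation (\<lambda>\<omega>. Q (X k \<omega>)) \<le> h k ^ 3 * ((\<integral>u. u\<^sup>2 * \<bar>deriv K u\<bar> \<partial>lborel) / \<delta>\<^sup>2)"
proof -
  have hk: "0 < h k" by (rule h_pos[OF k])
  define P where "P y = \<bar>deriv K ((x - y) / h k)\<bar> * ((y - x) / \<delta>)\<^sup>2" for y
  have [measurable]: "deriv K \<in> borel_measurable borel" using K'_integrable by auto
  have Q_meas[measurable]: "Q \<in> borel_measurable borel" unfolding Q_def by simp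
  have P_affine: "P (x + - h k * u) = (h k)\<^sup>2 / \<delta>\<^sup>2 * (u\<^sup>2 * \<bar>deriv K u\<bar>)" for u
    unfolding P_def using hk by (simp add: power_divide power_mult_distrib)
  have "integrable lborel (\<lambda>u. P (x + - h k * u))"
    unfolding P_affine by (rule integrable_mult_right[OF K'_second_moment])
  then have P_int: "integrable lborel P"
    using hk by (subst (asm) lborel_integrable_real_affine_iff) auto
  have gQ: "0 \<le> g y * Q y" "g y * Q y \<le> P y" for y
  proof -
    show "0 \<le> g y * Q y" unfolding Q_def using g_nonneg[of y] by simp
    \<comment> \<open>Where \<open>g y = 0\<close> the quotient is 0 by convention and the
      inequality is trivial.\<close>
    have "g y * Q y \<le> \<bar>deriv K ((x - y) / h k)\<bar> * (if \<bar>y - x\<bar> < \<delta> then 0 else 1)"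
      unfolding Q_def by (cases "g y = 0") auto
    also have "\<dots> \<le> P y"
    proof (cases "\<bar>y - x\<bar> < \<delta>")
      case False
      then have "1 \<le> (\<bar>y - x\<bar> / \<delta>)\<^sup>2" using \<delta> by (intro one_le_power) simp
      then have "1 \<le> ((y - x) / \<delta>)\<^sup>2" by (simp add: power_divide)
      then show ?thesis
        using False mult_left_mono[of 1 "((y - x) / \<delta>)\<^sup>2" "\<bar>deriv K ((x - y) / h k)\<bar>"] by (simp add: P_def)
    qed (simp add: P_def)
    finally show "g y * Q y \<le> P y" .
  qed
  have gQ_int: "integrable lborel (\<lambda>y. g y * Q y)"
  proof (rule Bochner_Integration.integrable_bound[OF P_int])
    have "norm (g y * Q y) \<le> norm (P y)" for y
      using gQ[of y] unfolding real_norm_def by linarith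
    then show "AE y in lborel. norm (g y * Q y) \<le> norm (P y)" by simp
  qed simp
  have Q_lborel: "Q \<in> borel_measurable lborel" by simp
  show "integrable M (\<lambda>\<omega>. Q (X k \<omega>))"
    using distributed_integrable[OF X_distributed[OF k] Q_lborel g_nonneg] gQ_int by simp
  have "expectation (\<lambda>\<omega>. Q (X k \<omega>)) = (\<integral>y. g y * Q y \<partial>lborel)"
    using distributed_integral[OF X_distributed[OF k] Q_lborel g_nonneg] by simp
  also have "\<dots> \<le> (\<integral>y. P y \<partial>lborel)" by (intro integral_mono gQ_int P_int gQ)
  also have "\<dots> = h k * (\<integral>u. P (x + - h k * u) \<partial>lborel)"
    using hk by (subst lborel_integral_real_affine[where t = x and c = "- h k"]) auto
  also have "\<dots> = h k ^ 3 * ((\<integral>u. u\<^sup>2 * \<bar>deriv K u\<bar> \<partial>lborel) / \<delta>\<^sup>2)"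
    unfolding P_affine integral_mult_right_zero by (simp add: power2_eq_square power3_eq_cube)
  finally show "expectation (\<lambda>\<omega>. Q (X k \<omega>)) \<le> h k ^ 3 * ((\<integral>u. u\<^sup>2 * \<bar>deriv K u\<bar> \<partial>lborel) / \<delta>\<^sup>2)" .
qed

lemma g_lower_bound: obtains \<delta> where "0 < \<delta>" "\<And>y. \<bar>y - x\<bar> < \<delta> \<Longrightarrow> g x / 2 < g y"
proof -
  from g_isCont[of x] gx obtain \<delta> where \<delta>: "0 < \<delta>" "\<And>y. dist y x < \<delta> \<Longrightarrow> dist (g y) (g x) < g x / 2"
    unfolding continuous_at_eps_delta by (metis half_gt_zero)
  show thesis
  proof (rule that[OF \<delta>(1)])
    fix y assume "\<bar>y - x\<bar> < \<delta>"
    then have "\<bar>g y - g x\<bar> < g x / 2" using \<delta>(2)[of y] by (simp add: dist_real_def)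
    then show "g x / 2 < g y" by linarith
  qed
qed

text \<open>
  Since \<open>g\<close> may vanish away from \<open>x\<close>, the summands of the third estimator need not be square
  integrable. They are therefore cut off outside a neighbourhood of \<open>x\<close> on which \<open>g\<close> is bounded
  below; the discarded part is only controlled in \<open>L\<^sup>1\<close>.
\<close>

lemma f_check_converges:
  "converges_in_distribution M
     (\<lambda>n \<omega>. scale n * (f_check' g K h (\<lambda>k. X k \<omega>) (\<lambda>k. Y k \<omega>) n x - deriv f x))
     (centered_normal (\<xi>\<^sup>2 / ((1 + 3 * \<alpha>) * g x) * ((f x)\<^sup>2 + \<sigma>\<^sup>2)))"
proof -
  obtain \<delta> where \<delta>: "0 < \<delta>" "\<And>y. \<bar>y - x\<bar> < \<delta> \<Longrightarrow> g x / 2 < g y" by (rule g_lower_bound) blast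
  obtain F where F: "\<And>y. \<bar>f y\<bar> \<le> F" using f_bounded by (auto simp: bounded_iff)
  have F0: "0 \<le> F" using F[of 0] by linarith
  define I :: "real \<Rightarrow> real" where "I y = (if \<bar>y - x\<bar> < \<delta> then 1 else 0)" for y
  have I_meas[measurable]: "I \<in> borel_measurable borel" unfolding I_def[abs_def] by simp
  have [measurable]: "deriv K \<in> borel_measurable borel" using K'_integrable by auto
  have I_g: "\<bar>I y / g y\<bar> \<le> 2 / g x" for y
    using \<delta>(2)[of y] gx by (auto simp: I_def field_simps)
  have bdd\<psi>: "bounded (range (\<lambda>y. I y / g y))"
    using I_g by (auto simp: bounded_iff intro!: exI)
  have "\<bar>f y * I y / g y\<bar> \<le> F * (2 / g x)" for y
    unfolding times_divide_eq_right[symmetric] abs_mult by (intro mult_mono F I_g F0) simp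
  then have bdd\<phi>: "bounded (range (\<lambda>y. f y * I y / g y))"
    unfolding bounded_iff by auto
  interpret V: kernel_statistic M X e g h \<sigma> \<alpha> x "deriv K" 2 "\<lambda>y. f y * I y / g y" "\<lambda>y. I y / g y"
    by (intro kernel_statistic_K' bdd\<phi> bdd\<psi>) simp_all
  have nhd: "\<forall>\<^sub>F y in nhds x. \<bar>y - x\<bar> < \<delta>"
    using eventually_nhds_ball[OF \<delta>(1), of x] by (simp add: dist_real_def abs_minus_commute)
  have g_pos: "0 < g y" if "\<bar>y - x\<bar> < \<delta>" for y using \<delta>(2)[OF that] gx by linarith
  have "isCont (\<lambda>y. ((f y)\<^sup>2 + \<sigma>\<^sup>2) / g y) x"
    using gx by (intro continuous_intros f_isCont g_isCont) auto
  \<comment> \<open>Near \<open>x\<close> the two divisions by \<open>g\<close> meet one factor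
    \<open>g\<close> from the density; this puts \<open>g x\<close> in the denominator of the
    variance.\<close>
  moreover have "\<forall>\<^sub>F y in nhds x. V.intensity y = ((f y)\<^sup>2 + \<sigma>\<^sup>2) / g y"
    using nhd
  proof eventually_elim
    case (elim y)
    then have "I y = 1" by (simp add: I_def)
    then show ?case
      unfolding V.intensity_def using g_pos[OF elim] by (simp add: power2_eq_square field_simps)
  qed
  ultimately have V_cont: "isCont V.intensity x" and V_x: "V.intensity x = ((f x)\<^sup>2 + \<sigma>\<^sup>2) / g x"
    by (simp add: isCont_cong, blast dest: eventually_nhds_x_imp_x)
  have "second_order_at (\<lambda>y. f y * I y / g y * g y) x (f x) (deriv f x)"
  proof (rule second_order_at_local[OF bounded_twice_differentiable_second_order[OF f] \<delta>(1)])
    show "f y * I y / g y * g y = f y" if "\<bar>y - x\<bar> < \<delta>" for y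
      using g_pos[OF that] that by (simp add: I_def)
  qed (rule V.bounded_\<phi>_g)
  then obtain c where c: "\<And>k. 1 \<le> k \<Longrightarrow> \<bar>expectation (V.summand k) - deriv f x\<bar> \<le> c * h k"
    using V.bias_second_order[OF refl K'(1,2) K'_second_moment] by blast
  define Q where "Q k y = \<bar>deriv K ((x - y) / h k)\<bar> * (if \<bar>y - x\<bar> < \<delta> then 0 else 1) / g y" for k y
  define J where "J = (\<integral>u. u\<^sup>2 * \<bar>deriv K u\<bar> \<partial>lborel) / \<delta>\<^sup>2"
  \<comment> \<open>The discarded part of a summand. \<open>U\<close> majorises its scaled average:
    \<open>Q\<close> carries the dependence on \<open>X k\<close>, and
    \<open>F + \<bar>e k \<omega>\<bar>\<close> bounds the response.\<close>
  define T where "T k \<omega> = deriv K ((x - X k \<omega>) / h k) * (1 - I (X k \<omega>)) * (f (X k \<omega>) + e k \<omega>)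
    / g (X k \<omega>) / h k ^ 2" for k \<omega>
  define Z where "Z n \<omega> = scale n * (V.statistic n \<omega> + 1 / real n * (\<Sum>k=1..n. T k \<omega>) - deriv f x)" for n \<omega>
  define U where "U n \<omega> = scale n / real n * (\<Sum>k=1..n. Q k (X k \<omega>) * (F + \<bar>e k \<omega>\<bar>) / h k ^ 2)" for n \<omega>
  define m where "m = expectation (\<lambda>\<omega>. F + \<bar>e 1 \<omega>\<bar>)"
  have Q_meas[measurable]: "Q k \<in> borel_measurable borel" for k
    unfolding Q_def[abs_def] by simp
  have F_meas: "(\<lambda>z. F + \<bar>z\<bar>) \<in> borel_measurable borel" by simp
  have Q_nonneg: "0 \<le> Q k y" for k y unfolding Q_def using g_nonneg[of y] by simp
  have m0: "0 \<le> m" unfolding m_def using F0 by (auto intro!: integral_nonneg_AE)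
  have F_int: "integrable M (\<lambda>\<omega>. F + \<bar>e k \<omega>\<bar>)" if "1 \<le> k" for k
    by (intro Bochner_Integration.integrable_add integrable_const integrable_abs e_integrable that)
  have term_int: "integrable M (\<lambda>\<omega>. Q k (X k \<omega>) * (F + \<bar>e k \<omega>\<bar>))"
    and term_le: "expectation (\<lambda>\<omega>. Q k (X k \<omega>) * (F + \<bar>e k \<omega>\<bar>)) \<le> h k ^ 3 * J * m" if k: "1 \<le> k" for k
  proof -
    note QF = expectation_X_times_e[OF k Q_meas F_meas
        kernel_tail_bound(1)[OF k \<delta>(1), folded Q_def] F_int[OF k]]
    show "integrable M (\<lambda>\<omega>. Q k (X k \<omega>) * (F + \<bar>e k \<omega>\<bar>))" by (rule QF(1))
    show "expectation (\<lambda>\<omega>. Q k (X k \<omega>) * (F + \<bar>e k \<omega>\<bar>)) \<le> h k ^ 3 * J * m"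
      unfolding QF(2) m_def expectation_e_eq[OF k F_meas, symmetric] J_def
      using kernel_tail_bound(2)[OF k \<delta>(1), folded Q_def] m0
      unfolding m_def expectation_e_eq[OF k F_meas, symmetric] by (rule mult_right_mono)
  qed
  have T_meas: "T k \<in> borel_measurable M" if "1 \<le> k" for k
  proof -
    note X_measurable[OF that, measurable] e_measurable[OF that, measurable]
    show ?thesis unfolding T_def[abs_def] by simp
  qed
  have sum_T_meas[measurable]: "(\<lambda>\<omega>. \<Sum>k=1..n. T k \<omega>) \<in> borel_measurable M" for n
    by (rule borel_measurable_sum) (use T_meas in auto)
  have "converges_in_distribution M Z (centered_normal (\<xi>\<^sup>2 / ((1 + 3 * \<alpha>) * g x) * ((f x)\<^sup>2 + \<sigma>\<^sup>2)))"
  proof (rule converges_in_distribution_centered_normalI)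
    show meas: "Z n \<in> borel_measurable M" for n
      unfolding Z_def[abs_def]
      by (intro borel_measurable_times borel_measurable_diff borel_measurable_add borel_measurable_const
          V.statistic_measurable sum_T_meas)
    show "0 \<le> \<xi>\<^sup>2 / ((1 + 3 * \<alpha>) * g x) * ((f x)\<^sup>2 + \<sigma>\<^sup>2)" by (rule centered_variance_nonneg) simp
    fix t
    show "(\<lambda>n. \<integral>\<omega>. iexp (t * Z n \<omega>) \<partial>M)
      \<longlonglongrightarrow> exp (- (t\<^sup>2 * (\<xi>\<^sup>2 / ((1 + 3 * \<alpha>) * g x) * ((f x)\<^sup>2 + \<sigma>\<^sup>2))) / 2)"
    proof (rule integral_iexp_tendsto_perturb[where U = U and A = "\<lambda>_. {}", OF _ meas])
      show "(\<lambda>\<omega>. scale n * (V.statistic n \<omega> - deriv f x)) \<in> borel_measurable M" for n by simp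
      show U_int: "integrable M (U n)" for n
        unfolding U_def[abs_def]
        by (rule integrable_mult_right[OF Bochner_Integration.integrable_sum[OF integrable_divide[OF term_int]]]) simp
      show "0 \<le> U n \<omega>" for n \<omega>
        unfolding U_def using F0
        by (intro mult_nonneg_nonneg divide_nonneg_nonneg sum_nonneg scale_nonneg Q_nonneg) auto
      show "\<forall>\<^sub>F n in sequentially. \<forall>\<omega>\<in>space M - {}.
          \<bar>Z n \<omega> - scale n * (V.statistic n \<omega> - deriv f x)\<bar> \<le> U n \<omega>"
      proof (rule always_eventually, intro allI ballI)
        fix n \<omega>
        have "Z n \<omega> - scale n * (V.statistic n \<omega> - deriv f x) = scale n / real n * (\<Sum>k=1..n. T k \<omega>)"
          unfolding Z_def by (simp add: algebra_simps)
        then have eq: "\<bar>Z n \<omega> - scale n * (V.statistic n \<omega> - deriv f x)\<bar>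
            = scale n / real n * \<bar>\<Sum>k=1..n. T k \<omega>\<bar>"
          using scale_nonneg[of n] by (simp add: abs_mult)
        have "\<bar>\<Sum>k=1..n. T k \<omega>\<bar> \<le> (\<Sum>k=1..n. Q k (X k \<omega>) * (F + \<bar>e k \<omega>\<bar>) / h k ^ 2)"
        proof (rule order_trans[OF sum_abs sum_mono])
          fix k
          have "\<bar>T k \<omega>\<bar> = Q k (X k \<omega>) * \<bar>f (X k \<omega>) + e k \<omega>\<bar> / h k ^ 2"
            unfolding T_def Q_def I_def using g_nonneg[of "X k \<omega>"] by (simp add: abs_mult)
          also have "\<dots> \<le> Q k (X k \<omega>) * (F + \<bar>e k \<omega>\<bar>) / h k ^ 2"
            using F[of "X k \<omega>"] abs_triangle_ineq[of "f (X k \<omega>)" "e k \<omega>"]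
            by (intro divide_right_mono mult_left_mono Q_nonneg) auto
          finally show "\<bar>T k \<omega>\<bar> \<le> Q k (X k \<omega>) * (F + \<bar>e k \<omega>\<bar>) / h k ^ 2" .
        qed
        then show "\<bar>Z n \<omega> - scale n * (V.statistic n \<omega> - deriv f x)\<bar> \<le> U n \<omega>"
          unfolding eq U_def by (rule mult_left_mono) (simp add: scale_nonneg)
      qed
      show "(\<lambda>n. expectation (U n)) \<longlonglongrightarrow> 0"
      proof (rule tendsto_sandwich[OF always_eventually always_eventually])
        show "\<forall>n. 0 \<le> expectation (U n)"
          using \<open>\<And>n \<omega>. 0 \<le> U n \<omega>\<close> by (simp add: integral_nonneg_AE)
        show "\<forall>n. expectation (U n) \<le> J * m * (scale n / real n * (\<Sum>k=1..n. h k))"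
        proof
          fix n
          have "expectation (U n) = scale n / real n *
              (\<Sum>k=1..n. expectation (\<lambda>\<omega>. Q k (X k \<omega>) * (F + \<bar>e k \<omega>\<bar>)) / h k ^ 2)"
            unfolding U_def[abs_def] integral_mult_right_zero
            by (subst Bochner_Integration.integral_sum) (use integrable_divide[OF term_int] in auto)
          also have "\<dots> \<le> scale n / real n * (\<Sum>k=1..n. J * m * h k)"
          proof (intro mult_left_mono sum_mono divide_nonneg_nonneg scale_nonneg)
            fix k assume "k \<in> {1..n}"
            then have k: "1 \<le> k" by simp
            \<comment> \<open>The tail estimate supplies \<open>h k ^ 3\<close>, so one bandwidth is
              left and the bias limit applies.\<close>
            have "expectation (\<lambda>\<omega>. Q k (X k \<omega>) * (F + \<bar>e k \<omega>\<bar>)) / h k ^ 2 \<le> (h k ^ 3 * J * m) / h k ^ 2"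
              by (rule divide_right_mono[OF term_le[OF k]]) simp
            also have "\<dots> = J * m * h k"
              using h_pos[OF k] by (simp add: power2_eq_square power3_eq_cube)
            finally show "expectation (\<lambda>\<omega>. Q k (X k \<omega>) * (F + \<bar>e k \<omega>\<bar>)) / h k ^ 2 \<le> J * m * h k" .
          qed simp
          also have "\<dots> = J * m * (scale n / real n * (\<Sum>k=1..n. h k))"
            by (simp add: sum_distrib_left[symmetric])
          finally show "expectation (U n) \<le> J * m * (scale n / real n * (\<Sum>k=1..n. h k))" .
        qed
        show "(\<lambda>n. J * m * (scale n / real n * (\<Sum>k=1..n. h k))) \<longlonglongrightarrow> 0"
          by (rule tendsto_mult_right_zero[OF scale_mean_bandwidth_tendsto])
      qed simp
      have "(\<integral>u. (deriv K u)\<^sup>2 \<partial>lborel) * V.intensity x / (1 + 3 * \<alpha>)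
          = \<xi>\<^sup>2 / ((1 + 3 * \<alpha>) * g x) * ((f x)\<^sup>2 + \<sigma>\<^sup>2)"
        unfolding V_x \<xi> by (simp add: mult_ac)
      with V.integral_iexp_statistic[OF refl V_cont c, of t]
      show "(\<lambda>n. \<integral>\<omega>. iexp (t * (scale n * (V.statistic n \<omega> - deriv f x))) \<partial>M)
          \<longlonglongrightarrow> exp (- (t\<^sup>2 * (\<xi>\<^sup>2 / ((1 + 3 * \<alpha>) * g x) * ((f x)\<^sup>2 + \<sigma>\<^sup>2))) / 2)"
        by (simp only:)
    qed simp_all
  qed
  moreover have "scale n * (f_check' g K h (\<lambda>k. X k \<omega>) (\<lambda>k. Y k \<omega>) n x - deriv f x) = Z n \<omega>"
    if \<omega>: "\<omega> \<in> space M" for n \<omega>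
  proof -
    \<comment> \<open>The summands recombine from \<open>I\<close> and \<open>1 - I\<close>. At
      observations with \<open>g (X k \<omega>) = 0\<close> all quotients are 0, so the identity
      holds there too.\<close>
    have "(\<Sum>k=1..n. Y k \<omega> / (g (X k \<omega>) * (h k)\<^sup>2) * deriv K ((x - X k \<omega>) / h k))
        = (\<Sum>k=1..n. V.summand k \<omega> + T k \<omega>)"
    proof (rule sum.cong[OF refl])
      fix k assume "k \<in> {1..n}"
      then have "Y k \<omega> = f (X k \<omega>) + e k \<omega>" using model \<omega> by simp
      then show "Y k \<omega> / (g (X k \<omega>) * (h k)\<^sup>2) * deriv K ((x - X k \<omega>) / h k) = V.summand k \<omega> + T k \<omega>"
        unfolding V.summand_def T_def by (simp add: divide_inverse algebra_simps)
    qed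
    then show ?thesis
      unfolding f_check'_def Z_def V.statistic_def by (simp add: sum.distrib distrib_left)
  qed
  ultimately show ?thesis by (subst converges_in_distribution_cong) auto
qed

end

theorem theorem3p2:
  fixes M :: "'a measure"
    and X Y \<epsilon> :: "nat \<Rightarrow> 'a \<Rightarrow> real"
    and f g K :: "real \<Rightarrow> real"
    and h :: "nat \<Rightarrow> real"
    and \<sigma> \<xi> \<alpha> p x :: real
  assumes "prob_space M"
    (* regression model *)
    and "\<And>n \<omega>. n \<ge> 1 \<Longrightarrow> \<omega> \<in> space M \<Longrightarrow> Y n \<omega> = f (X n \<omega>) + \<epsilon> n \<omega>"
    and "prob_space.indep_vars M (\<lambda>_. borel) X {1..}"
    and "\<And>y. 0 \<le> g y"
    and "\<And>n. n \<ge> 1 \<Longrightarrow> distributed M lborel (X n) (\<lambda>y. ennreal (g y))"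
    (* (1) *)
    and "\<And>u. 0 \<le> K u"
    and "\<And>u. K (- u) = K u"
    and "bounded (range K)"
    and "\<And>u. K differentiable (at u)"
    and "bounded (range (deriv K))"
    and "has_bochner_integral lborel K 1"
    and "has_bochner_integral lborel (deriv K) 0"
    and "has_bochner_integral lborel (\<lambda>u. u * deriv K u) (- 1)"
    and "has_bochner_integral lborel (\<lambda>u. u ^ 2 * deriv K u) 0"
    and "integrable lborel (\<lambda>u. u ^ 4 * K u)"
    and "integrable lborel (\<lambda>u. u ^ 4 * \<bar>deriv K u\<bar>)"
    (* (2) *)
    and "bounded_twice_differentiable f"
    and "bounded_twice_differentiable g"
    (* (3) *)
    and "prob_space.indep_var M
           (\<Pi>\<^sub>M n\<in>{1..}. borel) (\<lambda>\<omega>. \<lambda>n\<in>{1..}. \<epsilon> n \<omega>)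
           (\<Pi>\<^sub>M n\<in>{1..}. borel) (\<lambda>\<omega>. \<lambda>n\<in>{1..}. X n \<omega>)"
    and "prob_space.indep_vars M (\<lambda>_. borel) \<epsilon> {1..}"
    and "\<And>n. n \<ge> 1 \<Longrightarrow> distr M borel (\<epsilon> n) = distr M borel (\<epsilon> 1)"
    and "\<And>n. n \<ge> 1 \<Longrightarrow> integrable M (\<lambda>\<omega>. (\<epsilon> n \<omega>)\<^sup>2)"
    and "\<And>n. n \<ge> 1 \<Longrightarrow> prob_space.expectation M (\<epsilon> n) = 0"
    and "\<And>n. n \<ge> 1 \<Longrightarrow> prob_space.expectation M (\<lambda>\<omega>. (\<epsilon> n \<omega>)\<^sup>2) = \<sigma>\<^sup>2"
    (* (4) *)
    and "p > 2"
    and "\<And>n. n \<ge> 1 \<Longrightarrow> integrable M (\<lambda>\<omega>. \<bar>\<epsilon> n \<omega>\<bar> powr p)"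
    (* bandwidths *)
    and "1 / 5 < \<alpha>" and "\<alpha> < 1 / 3"
    and "\<And>n. n \<ge> 1 \<Longrightarrow> h n = real n powr (- \<alpha>)"
    and "\<xi>\<^sup>2 = (\<integral>u. (deriv K u)\<^sup>2 \<partial>lborel)"
    and "g x > 0"
  shows "converges_in_distribution M
           (\<lambda>n \<omega>. sqrt (real n * h n ^ 3) *
             (f_hat' K h (\<lambda>k. X k \<omega>) (\<lambda>k. Y k \<omega>) n x - deriv f x))
           (centered_normal (\<xi>\<^sup>2 / ((1 + 3 * \<alpha>) * g x) * \<sigma>\<^sup>2))
       \<and> converges_in_distribution M
           (\<lambda>n \<omega>. sqrt (real n * h n ^ 3) *
             (f_tilde' g K h (\<lambda>k. X k \<omega>) (\<lambda>k. Y k \<omega>) n x - deriv f x))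
           (centered_normal (\<xi>\<^sup>2 / ((1 + 3 * \<alpha>) * g x) * ((f x)\<^sup>2 + \<sigma>\<^sup>2)))
       \<and> converges_in_distribution M
           (\<lambda>n \<omega>. sqrt (real n * h n ^ 3) *
             (f_check' g K h (\<lambda>k. X k \<omega>) (\<lambda>k. Y k \<omega>) n x - deriv f x))
           (centered_normal (\<xi>\<^sup>2 / ((1 + 3 * \<alpha>) * g x) * ((f x)\<^sup>2 + \<sigma>\<^sup>2)))"
proof -
  interpret prob_space M by fact
  note X_indep = assms(3) and \<epsilon>_X_indep = assms(19) and \<epsilon>_indep = assms(20)
  have pairs: "indep_vars (\<lambda>_. borel \<Otimes>\<^sub>M borel) (\<lambda>n \<omega>. (X n \<omega>, \<epsilon> n \<omega>)) {1..}"
    by (rule indep_vars_Pair[OF X_indep \<epsilon>_indep \<epsilon>_X_indep])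
  have \<epsilon>_X: "indep_var borel (\<epsilon> n) borel (X n)" if "1 \<le> n" for n
  proof -
    have "indep_var borel ((\<lambda>w. w n) \<circ> (\<lambda>\<omega>. \<lambda>i\<in>{1..}. \<epsilon> i \<omega>)) borel ((\<lambda>w. w n) \<circ> (\<lambda>\<omega>. \<lambda>i\<in>{1..}. X i \<omega>))"
      using that by (intro indep_var_compose[OF \<epsilon>_X_indep] measurable_component_singleton) auto
    then show ?thesis using that by (simp add: comp_def)
  qed
  have g_meas: "g \<in> borel_measurable borel" and g_bdd: "bounded (range g)"
    using assms(18) borel_measurable_continuous_onI unfolding bounded_twice_differentiable_def by blast+
  have K4: "integrable lborel (\<lambda>u. u ^ 4 * \<bar>K u\<bar>)"
    using assms(15) by (simp add: abs_of_nonneg[OF assms(6)])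
  interpret regression_estimation M X \<epsilon> g h \<sigma> \<alpha> x f K Y \<xi>
    by unfold_locales (fact assms pairs \<epsilon>_X g_meas g_bdd K4)+
  show ?thesis
    using f_hat_converges f_tilde_converges f_check_converges unfolding scale_def by blast
qed

end
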